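(* Let $\mathfrak G=(G_2\xrightarrow{\partial}G_1)$ be a crossed module with crossed submodule $\mathfrak H=(H_2\to H_1)$, let $\mathbb K$ be a field and let $A$ be an $\mathfrak H$-algebra over $\mathbb K$ with induced algebra $\widetilde A=\mathrm{Ind}_{\mathfrak H}^{\mathfrak G}A$. Assume that both indices $|G_1:H_1|$ and $|G_2:H_2|$ are finite. (i) If $A$ is finite dimensional over $\mathbb K$, then so too is $\widetilde A$. (ii) Assume that $|G_2:H_2|$ is not divisible by the characteristic of $\mathbb K$. If $A$ is separable, then so too is $\widetilde A$.
   Context: A crossed module $\mathfrak G=(G_2\xrightarrow{\partial}G_1)$ consists of groups $G_1,G_2$, an action $(g,x)\mapsto{}^gx$ of $G_1$ on $G_2$ by automorphisms and a homomorphism $\partial$ with $\partial({}^gx)=g\partial(x)g^{-1}$, ${}^{\partial(y)}x=yxy^{-1}$. A crossed submodule consists of subgroups $H_i\le G_i$ with $\partial(H_2)\le H_1$ and $H_2$ stable under $H_1$. No grading is involved here. An $\mathfrak H$-algebra is an associative unital $\mathbb K$-algebra $A$ with homomorphisms $\omega_{A,1}:H_1\to\mathrm{Aut}(A)$ and $\omega_{A,2}:H_2\to A^\times$ such that $\omega_{A,1}(\partial z)(a)=\omega_{A,2}(z)a\omega_{A,2}(z)^{-1}$ and $\omega_{A,2}({}^hz)=\omega_{A,1}(h)(\omega_{A,2}(z))$. The induced algebra: fix a left transversal $\mathcal T$ to $H_1$ in $G_1$. As a vector space $\widetilde A=\prod_{t\in\mathcal T}\mathbb KG_{2,t}\otimes_{\mathbb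 KH_2}A$, where $\mathbb KG_{2,t}$ is the group algebra of $G_2$ with right $\mathbb KH_2$-action $x\cdot z=x({}^tz)$; so $[x({}^tz)\otimes a]_t=[x\otimes\omega_{A,2}(z)a]_t$, $[-]_t$ denoting an element of the $t$-th factor. With $\delta_{g_2,g_1}=1$ if $g_1H_1=g_2H_1$ and $0$ otherwise, the associative unital algebra structure is $[x_2\otimes a_2]_{t_2}\cdot[x_1\otimes a_1]_{t_1}=\delta_{\partial(x_1^{-1})t_2,t_1}[x_2x_1\otimes\omega_{A,1}(t_1^{-1}\partial(x_1^{-1})t_2)(a_2)a_1]_{t_1}$ with unit $([e\otimes1_A]_t)_t$. Separable means separable as a $\mathbb K$-algebra (the multiplication map $\widetilde A\otimes_{\mathbb K}\widetilde A\to\widetilde A$ splits as a bimodule map). *)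

theory Defs
  imports
    "HOL-Algebra.AbelCoset"
    "HOL-Algebra.Bij"
    "HOL-Algebra.Left_Coset"
    "Jordan_Normal_Form.Missing_VectorSpace"
begin

section \<open>Associative algebras over a field\<close>

text \<open>The locale \<open>algebra\<close> of HOL-Algebra is restricted to commutative algebras.\<close>

locale assoc_algebra = vectorspace K A + ring A
  for K (structure) and A (structure) +
  assumes smult_mult_left:
      "\<lbrakk>c \<in> carrier K; x \<in> carrier A; y \<in> carrier A\<rbrakk> \<Longrightarrow>
        (c \<odot>\<^bsub>A\<^esub> x) \<otimes>\<^bsub>A\<^esub> y = c \<odot>\<^bsub>A\<^esub> (x \<otimes>\<^bsub>A\<^esub> y)"
    and smult_mult_right:
      "\<lbrakk>c \<in> carrier K; x \<in> carrier A; y \<in> carrier A\<rbrakk> \<Longrightarrow>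
        x \<otimes>\<^bsub>A\<^esub> (c \<odot>\<^bsub>A\<^esub> y) = c \<odot>\<^bsub>A\<^esub> (x \<otimes>\<^bsub>A\<^esub> y)"

text \<open>The group of unital \<open>K\<close>-algebra automorphisms. As in \<^const>\<open>AutoGroup\<close>, automorphisms
  are represented by extensional functions.\<close>

definition alg_aut_group ::
  "('k, 'm) ring_scheme \<Rightarrow> ('k, 'a, 'n) module_scheme \<Rightarrow> ('a \<Rightarrow> 'a) monoid" where
  "alg_aut_group K A =
    BijGroup (carrier A) \<lparr>carrier := Bij (carrier A) \<inter> ring_hom A A \<inter> module_hom K A A\<rparr>"

definition ring_characteristic :: "('k, 'm) ring_scheme \<Rightarrow> nat" where
  "ring_characteristic R =
    (if \<exists>n::nat. 0 < n \<and> [n] \<cdot>\<^bsub>R\<^esub> \<one>\<^bsub>R\<^esub> = \<zero>\<^bsub>R\<^esub>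
     then LEAST n::nat. 0 < n \<and> [n] \<cdot>\<^bsub>R\<^esub> \<one>\<^bsub>R\<^esub> = \<zero>\<^bsub>R\<^esub> else 0)"


section \<open>Free modules, group algebras and tensor products\<close>

definition supp :: "('k, 'm) ring_scheme \<Rightarrow> ('s \<Rightarrow> 'k) \<Rightarrow> 's set" where
  "supp K f = {x. f x \<noteq> \<zero>\<^bsub>K\<^esub>}"

definition delta :: "('k, 'm) ring_scheme \<Rightarrow> 's \<Rightarrow> 's \<Rightarrow> 'k" where
  "delta K x = (\<lambda>y. if y = x then \<one>\<^bsub>K\<^esub> else \<zero>\<^bsub>K\<^esub>)"

text \<open>\<^typ>\<open>('k, 'v) module\<close> extends rings; the fields \<open>mult\<close> and \<open>one\<close> are irrelevant for a
  plain module.\<close>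

definition free_module :: "('k, 'm) ring_scheme \<Rightarrow> 's set \<Rightarrow> ('k, 's \<Rightarrow> 'k) module" where
  "free_module K S =
    \<lparr>carrier = {f. range f \<subseteq> carrier K \<and> finite (supp K f) \<and> supp K f \<subseteq> S},
     mult = undefined, one = undefined,
     zero = (\<lambda>_. \<zero>\<^bsub>K\<^esub>), add = (\<lambda>f g x. f x \<oplus>\<^bsub>K\<^esub> g x),
     smult = (\<lambda>c f x. c \<otimes>\<^bsub>K\<^esub> f x)\<rparr>"

definition group_algebra ::
  "('k, 'm) ring_scheme \<Rightarrow> ('g, 'n) monoid_scheme \<Rightarrow> ('k, 'g \<Rightarrow> 'k) module" where
  "group_algebra K G = (free_module K (carrier G))
    \<lparr>mult := (\<lambda>f g x. if x \<in> carrier G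
        then (\<Oplus>\<^bsub>K\<^esub>y\<in>supp K f. f y \<otimes>\<^bsub>K\<^esub> g (inv\<^bsub>G\<^esub> y \<otimes>\<^bsub>G\<^esub> x)) else \<zero>\<^bsub>K\<^esub>),
     one := delta K \<one>\<^bsub>G\<^esub>\<rparr>"

definition quotient_module ::
  "('k, 'v, 'm) module_scheme \<Rightarrow> 'v set \<Rightarrow> ('k, 'v set) module" where
  "quotient_module V N =
    \<lparr>carrier = a_rcosets\<^bsub>V\<^esub> N, mult = undefined, one = undefined,
     zero = N, add = set_add V,
     smult = (\<lambda>c X. \<Union>x\<in>X. N +>\<^bsub>V\<^esub> (c \<odot>\<^bsub>V\<^esub> x))\<rparr>"

text \<open>The tensor product of a right module \<open>M\<close> (action \<open>ract\<close>) and a left module \<open>N\<close> (action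
  \<open>lact\<close>) over a \<open>K\<close>-algebra \<open>R\<close>, as a \<open>K\<close>-module: the free \<open>K\<close>-module on
  \<open>M \<times> N\<close> modulo \<open>K\<close>-bilinearity and \<open>R\<close>-balancedness.\<close>

definition tensor_relators where
  "tensor_relators K R M ract N lact =
    (let F = free_module K (carrier M \<times> carrier N) in
      {delta K (x \<oplus>\<^bsub>M\<^esub> x', y) \<ominus>\<^bsub>F\<^esub> (delta K (x, y) \<oplus>\<^bsub>F\<^esub> delta K (x', y)) | x x' y.
         x \<in> carrier M \<and> x' \<in> carrier M \<and> y \<in> carrier N} \<union>
      {delta K (x, y \<oplus>\<^bsub>N\<^esub> y') \<ominus>\<^bsub>F\<^esub> (delta K (x, y) \<oplus>\<^bsub>F\<^esub> delta K (x, y')) | x y y'.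
         x \<in> carrier M \<and> y \<in> carrier N \<and> y' \<in> carrier N} \<union>
      {delta K (c \<odot>\<^bsub>M\<^esub> x, y) \<ominus>\<^bsub>F\<^esub> c \<odot>\<^bsub>F\<^esub> delta K (x, y) | c x y.
         c \<in> carrier K \<and> x \<in> carrier M \<and> y \<in> carrier N} \<union>
      {delta K (x, c \<odot>\<^bsub>N\<^esub> y) \<ominus>\<^bsub>F\<^esub> c \<odot>\<^bsub>F\<^esub> delta K (x, y) | c x y.
         c \<in> carrier K \<and> x \<in> carrier M \<and> y \<in> carrier N} \<union>
      {delta K (ract x r, y) \<ominus>\<^bsub>F\<^esub> delta K (x, lact r y) | x r y.
         x \<in> carrier M \<and> r \<in> carrier R \<and> y \<in> carrier N})"

definition tensor_null ::
  "('k, 'u1) ring_scheme \<Rightarrow> ('r, 'u2) ring_scheme \<Rightarrow>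
   ('k, 'm, 'u3) module_scheme \<Rightarrow> ('m \<Rightarrow> 'r \<Rightarrow> 'm) \<Rightarrow>
   ('k, 'n, 'u4) module_scheme \<Rightarrow> ('r \<Rightarrow> 'n \<Rightarrow> 'n) \<Rightarrow> ('m \<times> 'n \<Rightarrow> 'k) set" where
  "tensor_null K R M ract N lact =
    LinearCombinations.module.span K (free_module K (carrier M \<times> carrier N))
      (tensor_relators K R M ract N lact)"

definition tensor_product ::
  "('k, 'u1) ring_scheme \<Rightarrow> ('r, 'u2) ring_scheme \<Rightarrow>
   ('k, 'm, 'u3) module_scheme \<Rightarrow> ('m \<Rightarrow> 'r \<Rightarrow> 'm) \<Rightarrow>
   ('k, 'n, 'u4) module_scheme \<Rightarrow> ('r \<Rightarrow> 'n \<Rightarrow> 'n) \<Rightarrow>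
   ('k, ('m \<times> 'n \<Rightarrow> 'k) set) module" where
  "tensor_product K R M ract N lact =
    quotient_module (free_module K (carrier M \<times> carrier N)) (tensor_null K R M ract N lact)"

definition pure_tensor ::
  "('k, 'u1) ring_scheme \<Rightarrow> ('r, 'u2) ring_scheme \<Rightarrow>
   ('k, 'm, 'u3) module_scheme \<Rightarrow> ('m \<Rightarrow> 'r \<Rightarrow> 'm) \<Rightarrow>
   ('k, 'n, 'u4) module_scheme \<Rightarrow> ('r \<Rightarrow> 'n \<Rightarrow> 'n) \<Rightarrow>
   'm \<Rightarrow> 'n \<Rightarrow> ('m \<times> 'n \<Rightarrow> 'k) set" where
  "pure_tensor K R M ract N lact x y =
    tensor_null K R M ract N lact +>\<^bsub>free_module K (carrier M \<times> carrier N)\<^esub> delta K (x, y)"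

text \<open>The linear map from a tensor product to \<open>V\<close> with \<open>x \<otimes> y \<mapsto> \<phi> x y\<close>, for \<open>\<phi>\<close>
  bilinear and balanced: the linear extension of \<open>\<phi>\<close> takes the same value on all
  representatives of the coset \<open>X\<close>.\<close>

definition tensor_lift ::
  "('k, 'u1) ring_scheme \<Rightarrow> ('k, 'v, 'u2) module_scheme \<Rightarrow> ('m \<Rightarrow> 'n \<Rightarrow> 'v) \<Rightarrow>
   ('m \<times> 'n \<Rightarrow> 'k) set \<Rightarrow> 'v" where
  "tensor_lift K V \<phi> X =
    the_elem ((\<lambda>f. \<Oplus>\<^bsub>V\<^esub>p\<in>supp K f. f p \<odot>\<^bsub>V\<^esub> \<phi> (fst p) (snd p)) ` X)"


section \<open>Separable algebras\<close>

definition tensor_square ::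
  "('k, 'm) ring_scheme \<Rightarrow> ('k, 'a, 'n) module_scheme \<Rightarrow> ('k, ('a \<times> 'a \<Rightarrow> 'k) set) module" where
  "tensor_square K A =
    tensor_product K K A (\<lambda>x c. c \<odot>\<^bsub>A\<^esub> x) A (\<lambda>c x. c \<odot>\<^bsub>A\<^esub> x)"

definition tensor_square_pure ::
  "('k, 'm) ring_scheme \<Rightarrow> ('k, 'a, 'n) module_scheme \<Rightarrow> 'a \<Rightarrow> 'a \<Rightarrow> ('a \<times> 'a \<Rightarrow> 'k) set" where
  "tensor_square_pure K A =
    pure_tensor K K A (\<lambda>x c. c \<odot>\<^bsub>A\<^esub> x) A (\<lambda>c x. c \<odot>\<^bsub>A\<^esub> x)"

text \<open>The \<open>A\<close>-bimodule structure \<open>a \<cdot> (x \<otimes> y) \<cdot> b = (a x) \<otimes> (y b)\<close>.\<close>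

definition tensor_square_bimult where
  "tensor_square_bimult K A a X b =
    tensor_lift K (tensor_square K A)
      (\<lambda>x y. tensor_square_pure K A (a \<otimes>\<^bsub>A\<^esub> x) (y \<otimes>\<^bsub>A\<^esub> b)) X"

definition mult_map where
  "mult_map K A X = tensor_lift K A (\<lambda>x y. x \<otimes>\<^bsub>A\<^esub> y) X"

definition separable_algebra ::
  "('k, 'm) ring_scheme \<Rightarrow> ('k, 'a, 'n) module_scheme \<Rightarrow> bool" where
  "separable_algebra K A \<longleftrightarrow> assoc_algebra K A \<and>
    (\<exists>\<sigma> \<in> module_hom K A (tensor_square K A).
      (\<forall>a\<in>carrier A. \<forall>x\<in>carrier A. \<forall>b\<in>carrier A.
         \<sigma> (a \<otimes>\<^bsub>A\<^esub> x \<otimes>\<^bsub>A\<^esub> b) = tensor_square_bimult K A a (\<sigma> x) b) \<and>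
      (\<forall>x\<in>carrier A. mult_map K A (\<sigma> x) = x))"


section \<open>Crossed modules and their algebras\<close>

text \<open>\<open>act g x\<close> is the action of \<open>g\<close> in \<open>G1\<close> on \<open>x\<close> in \<open>G2\<close>.\<close>

locale crossed_module = G1: group G1 + G2: group G2
  for G1 :: "('g, 'u) monoid_scheme" and G2 :: "('h, 'v) monoid_scheme" +
  fixes act :: "'g \<Rightarrow> 'h \<Rightarrow> 'h" and bd :: "'h \<Rightarrow> 'g"
  assumes act_hom: "act \<in> hom G1 (AutoGroup G2)"
    and bd_hom: "bd \<in> hom G2 G1"
    and bd_act: "\<lbrakk>g \<in> carrier G1; x \<in> carrier G2\<rbrakk> \<Longrightarrow>
      bd (act g x) = g \<otimes>\<^bsub>G1\<^esub> bd x \<otimes>\<^bsub>G1\<^esub> inv\<^bsub>G1\<^esub> g"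
    and peiffer: "\<lbrakk>x \<in> carrier G2; y \<in> carrier G2\<rbrakk> \<Longrightarrow>
      act (bd y) x = y \<otimes>\<^bsub>G2\<^esub> x \<otimes>\<^bsub>G2\<^esub> inv\<^bsub>G2\<^esub> y"

locale crossed_submodule = crossed_module G1 G2 act bd
  for G1 :: "('g, 'u) monoid_scheme" and G2 :: "('h, 'v) monoid_scheme" and act bd +
  fixes H1 :: "'g set" and H2 :: "'h set"
  assumes subgroup_H1: "subgroup H1 G1"
    and subgroup_H2: "subgroup H2 G2"
    and bd_H2: "bd ` H2 \<subseteq> H1"
    and act_H2: "\<lbrakk>h \<in> H1; z \<in> H2\<rbrakk> \<Longrightarrow> act h z \<in> H2"

text \<open>An algebra over the crossed module \<open>H2 \<rightarrow> H1\<close>.\<close>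

locale crossed_module_algebra =
  crossed_submodule G1 G2 act bd H1 H2 + assoc_algebra K A
  for G1 :: "('g, 'u) monoid_scheme" and G2 :: "('h, 'v) monoid_scheme" and act bd H1 H2
    and K :: "('k, 'w) ring_scheme" and A :: "('k, 'a, 'x) module_scheme" +
  fixes \<omega>1 :: "'g \<Rightarrow> 'a \<Rightarrow> 'a" and \<omega>2 :: "'h \<Rightarrow> 'a"
  assumes \<omega>1_hom: "\<omega>1 \<in> hom (G1\<lparr>carrier := H1\<rparr>) (alg_aut_group K A)"
    and \<omega>2_hom: "\<omega>2 \<in> hom (G2\<lparr>carrier := H2\<rparr>) (units_of A)"
    and \<omega>1_bd: "\<lbrakk>z \<in> H2; a \<in> carrier A\<rbrakk> \<Longrightarrow>
      \<omega>1 (bd z) a = \<omega>2 z \<otimes>\<^bsub>A\<^esub> a \<otimes>\<^bsub>A\<^esub> inv\<^bsub>A\<^esub> (\<omega>2 z)"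
    and \<omega>2_act: "\<lbrakk>h \<in> H1; z \<in> H2\<rbrakk> \<Longrightarrow> \<omega>2 (act h z) = \<omega>1 h (\<omega>2 z)"

definition left_transversal :: "('g, 'u) monoid_scheme \<Rightarrow> 'g set \<Rightarrow> 'g set \<Rightarrow> bool" where
  "left_transversal G H T \<longleftrightarrow>
    T \<subseteq> carrier G \<and> (\<forall>C \<in> lcosets\<^bsub>G\<^esub> H. \<exists>!t. t \<in> T \<inter> C)"


section \<open>The induced algebra\<close>

locale induction_setup = crossed_module_algebra G1 G2 act bd H1 H2 K A \<omega>1 \<omega>2
  for G1 :: "('g, 'u) monoid_scheme" and G2 :: "('h, 'v) monoid_scheme" and act bd H1 H2
    and K :: "('k, 'w) ring_scheme" and A :: "('k, 'a, 'x) module_scheme" and \<omega>1 \<omega>2 +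
  fixes T :: "'g set"
  assumes transversal: "left_transversal G1 H1 T"
begin

abbreviation KG2 :: "('k, 'h \<Rightarrow> 'k) module" where
  "KG2 \<equiv> group_algebra K G2"

abbreviation KH2 :: "('k, 'h \<Rightarrow> 'k) module" where
  "KH2 \<equiv> group_algebra K (G2\<lparr>carrier := H2\<rparr>)"

text \<open>The linear extensions of \<open>x \<cdot> z = x (act t z)\<close> and \<open>z \<cdot> a = \<omega>2 z a\<close>.\<close>

definition KG2_ract :: "'g \<Rightarrow> ('h \<Rightarrow> 'k) \<Rightarrow> ('h \<Rightarrow> 'k) \<Rightarrow> ('h \<Rightarrow> 'k)" where
  "KG2_ract t \<xi> \<eta> = (\<Oplus>\<^bsub>KG2\<^esub>z\<in>supp K \<eta>. \<eta> z \<odot>\<^bsub>KG2\<^esub> (\<xi> \<otimes>\<^bsub>KG2\<^esub> delta K (act t z)))"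

definition A_lact :: "('h \<Rightarrow> 'k) \<Rightarrow> 'a \<Rightarrow> 'a" where
  "A_lact \<eta> a = (\<Oplus>\<^bsub>A\<^esub>z\<in>supp K \<eta>. \<eta> z \<odot>\<^bsub>A\<^esub> (\<omega>2 z \<otimes>\<^bsub>A\<^esub> a))"

definition ind_factor :: "'g \<Rightarrow> ('k, (('h \<Rightarrow> 'k) \<times> 'a \<Rightarrow> 'k) set) module" where
  "ind_factor t = tensor_product K KH2 KG2 (KG2_ract t) A A_lact"

definition ind_pure :: "'g \<Rightarrow> ('h \<Rightarrow> 'k) \<Rightarrow> 'a \<Rightarrow> (('h \<Rightarrow> 'k) \<times> 'a \<Rightarrow> 'k) set" where
  "ind_pure t = pure_tensor K KH2 KG2 (KG2_ract t) A A_lact"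

definition coset_rep :: "'g \<Rightarrow> 'g" where
  "coset_rep g = (THE t. t \<in> T \<and> t \<in> g <#\<^bsub>G1\<^esub> H1)"

text \<open>The component at \<open>t1\<close> of the product of the family \<open>X\<close> with
  \<open>[\<xi>1 \<otimes> a1]\<close> at \<open>t1\<close>. A basis element \<open>x1\<close> occurring in \<open>\<xi>1\<close> interacts only with
  the component of \<open>X\<close> at the unique \<open>t2\<close> in \<open>T\<close> for which \<open>bd (x1\<^sup>-\<^sup>1) t2\<close> and \<open>t1\<close> are in
  the same left coset of \<open>H1\<close>; there
  \<open>[x2 \<otimes> a2] \<cdot> [x1 \<otimes> a1] = [x2 x1 \<otimes> \<omega>1 (t1\<^sup>-\<^sup>1 bd (x1\<^sup>-\<^sup>1) t2) a2 a1]\<close>.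
  Working componentwise covers infinite transversals as well.\<close>

definition ind_mult_pure ::
  "('g \<Rightarrow> (('h \<Rightarrow> 'k) \<times> 'a \<Rightarrow> 'k) set) \<Rightarrow> 'g \<Rightarrow> ('h \<Rightarrow> 'k) \<Rightarrow> 'a \<Rightarrow>
   (('h \<Rightarrow> 'k) \<times> 'a \<Rightarrow> 'k) set" where
  "ind_mult_pure X t1 \<xi>1 a1 =
    (\<Oplus>\<^bsub>ind_factor t1\<^esub>x1\<in>supp K \<xi>1. \<xi>1 x1 \<odot>\<^bsub>ind_factor t1\<^esub>
      (let t2 = coset_rep (bd x1 \<otimes>\<^bsub>G1\<^esub> t1) in
        tensor_lift K (ind_factor t1)
          (\<lambda>\<xi>2 a2. ind_pure t1 (\<xi>2 \<otimes>\<^bsub>KG2\<^esub> delta K x1)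
            (\<omega>1 (inv\<^bsub>G1\<^esub> t1 \<otimes>\<^bsub>G1\<^esub> bd (inv\<^bsub>G2\<^esub> x1) \<otimes>\<^bsub>G1\<^esub> t2) a2 \<otimes>\<^bsub>A\<^esub> a1))
          (X t2)))"

definition induced_algebra :: "('k, 'g \<Rightarrow> (('h \<Rightarrow> 'k) \<times> 'a \<Rightarrow> 'k) set) module" where
  "induced_algebra =
    \<lparr>carrier = (\<Pi>\<^sub>E t\<in>T. carrier (ind_factor t)),
     mult = (\<lambda>X Y. \<lambda>t\<in>T. tensor_lift K (ind_factor t) (ind_mult_pure X t) (Y t)),
     one = (\<lambda>t\<in>T. ind_pure t (delta K \<one>\<^bsub>G2\<^esub>) \<one>\<^bsub>A\<^esub>),
     zero = (\<lambda>t\<in>T. \<zero>\<^bsub>ind_factor t\<^esub>),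
     add = (\<lambda>X Y. \<lambda>t\<in>T. X t \<oplus>\<^bsub>ind_factor t\<^esub> Y t),
     smult = (\<lambda>c X. \<lambda>t\<in>T. c \<odot>\<^bsub>ind_factor t\<^esub> X t)\<rparr>"

end

end

theory Submission
  imports Defs
begin

text \<open>
  Think of \<open>[x \<otimes> a]\<close> at \<open>t\<close> as an arrow from \<open>t\<close> to the representative of \<open>\<partial>(x) t H\<^sub>1\<close>
  with coefficient \<open>a\<close>; the product of the induced algebra composes arrows, and \<open>[x \<otimes> 1]\<close> is
  invertible. Since \<open>[x (\<^sup>tz) \<otimes> a] = [x \<otimes> \<omega>\<^sub>2(z) a]\<close>, the factor at \<open>t\<close> is spanned by one copy
  of \<open>A\<close> for each coset in \<open>G\<^sub>2 / \<^sup>tH\<^sub>2\<close>, and there are \<open>n = |G\<^sub>2 : H\<^sub>2|\<close> of them; this gives (i).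
  For (ii), let \<open>E = \<Sum> p\<^sub>i \<otimes> q\<^sub>i\<close> be a separability idempotent of \<open>A\<close>. Conjugating it along all
  arrows gives
  \<open>n\<^sup>-\<^sup>1 \<Sum>\<^sub>t \<Sum>\<^sub>x \<Sum>\<^sub>i [x \<otimes> p\<^sub>i]\<^sub>t \<otimes> [e \<otimes> q\<^sub>i]\<^sub>t [x\<^sup>-\<^sup>1 \<otimes> 1]\<close>, with \<open>x\<close> running through
  \<open>G\<^sub>2 / \<^sup>tH\<^sub>2\<close>. It does not depend on the chosen \<open>x\<close> and commutes with the algebra, because left
  translation permutes the cosets. Its image under multiplication is \<open>1\<close>: the summand of an arrow
  maps to the identity at its target, and inversion of arrows shows that every object is the
  target of exactly \<open>n\<close> arrows.
\<close>

section \<open>Modules and tensor products\<close>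

text \<open>Most of the work precedes separability. The product is defined through
  \<open>tensor_lift\<close>, which is meaningful only for balanced maps, so balancing has to be
  checked for the left and for the right factor. On the left an element z of \<open>H2\<close> must
  pass across x, which the Peiffer identity permits; on the right it changes the twist by an inner
  automorphism, which \<open>\<omega>1_bd\<close> absorbs. Linear maps on a factor are compared on
  the arrows at group elements, which span it. Elements of the induced algebra are families over
  \<open>T\<close>, so associativity is obtained for arbitrary families by showing that left
  multiplications commute with right multiplications by arrows.

  The idempotent does not depend on the choice of x because replacing x by x times
  \<open>act t z\<close> multiplies E by \<open>\<omega>2 z\<close> on the left and by its inverse
  on the right; these cancel since E commutes with \<open>A\<close>. A single summand of the new
  tensor is not central: multiplication by an arrow at w turns the summand at x into the one at w x,
  and only the sum over all cosets is invariant.\<close>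

lemma module_homI:
  assumes "\<And>x. x \<in> carrier M \<Longrightarrow> f x \<in> carrier N"
    and "\<And>x y. \<lbrakk>x \<in> carrier M; y \<in> carrier M\<rbrakk> \<Longrightarrow> f (x \<oplus>\<^bsub>M\<^esub> y) = f x \<oplus>\<^bsub>N\<^esub> f y"
    and "\<And>c x. \<lbrakk>c \<in> carrier R; x \<in> carrier M\<rbrakk> \<Longrightarrow> f (c \<odot>\<^bsub>M\<^esub> x) = c \<odot>\<^bsub>N\<^esub> f x"
  shows "f \<in> module_hom R M N"
  using assms by (auto simp: module_hom_def)

lemma module_hom_mem: "\<lbrakk>f \<in> module_hom R M N; x \<in> carrier M\<rbrakk> \<Longrightarrow> f x \<in> carrier N"
  by (auto simp: module_hom_def)

lemma module_hom_id: "(\<lambda>x. x) \<in> module_hom K V V"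
  by (rule module_homI) auto

lemma module_hom_comp:
  assumes "f \<in> module_hom R M N" and "g \<in> module_hom R N P"
  shows "(\<lambda>x. g (f x)) \<in> module_hom R M P"
  using assms by (auto simp: module_hom_def Pi_def)

lemma module_hom_cong:
  assumes "module R M" and "\<And>x. x \<in> carrier M \<Longrightarrow> f x = g x"
  shows "f \<in> module_hom R M N \<longleftrightarrow> g \<in> module_hom R M N"
proof -
  interpret module R M by fact
  show ?thesis using assms(2) by (auto simp: module_hom_def Pi_def)
qed

lemma (in module) module_hom_zero:
  assumes "module R N" and "f \<in> module_hom R M N"
  shows "f \<zero>\<^bsub>M\<^esub> = \<zero>\<^bsub>N\<^esub>"
proof -
  interpret mod_hom R M N f
    using assms module_axioms by (simp add: mod_hom_def mod_hom_axioms_def)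
  show ?thesis by simp
qed

lemma (in module) module_hom_finsum:
  assumes "module R N" and f: "f \<in> module_hom R M N" and "finite I"
    and "\<And>i. i \<in> I \<Longrightarrow> g i \<in> carrier M"
  shows "f (\<Oplus>\<^bsub>M\<^esub>i\<in>I. g i) = (\<Oplus>\<^bsub>N\<^esub>i\<in>I. f (g i))"
proof -
  interpret N: module R N by fact
  show ?thesis using assms(3,4)
  proof (induction I)
    case empty
    then show ?case using module_hom_zero[OF assms(1) f] by simp
  next
    case (insert i I)
    then show ?case
      using f by (simp add: Pi_def module_hom_add[OF f] module_hom_mem[OF f])
  qed
qed

lemma (in module) module_hom_smult_fixed:
  "c \<in> carrier R \<Longrightarrow> (\<lambda>x. c \<odot>\<^bsub>M\<^esub> x) \<in> module_hom R M M"
  by (rule module_homI) (auto simp: smult_r_distr smult_assoc1[symmetric] R.m_comm)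

lemma (in module) module_hom_add_fun:
  assumes f: "f \<in> module_hom R P M" and g: "g \<in> module_hom R P M"
  shows "(\<lambda>x. f x \<oplus>\<^bsub>M\<^esub> g x) \<in> module_hom R P M"
proof (rule module_homI)
  fix x assume x: "x \<in> carrier P"
  then have fx: "f x \<in> carrier M" "g x \<in> carrier M" using f g by (auto simp: module_hom_mem)
  then show "f x \<oplus>\<^bsub>M\<^esub> g x \<in> carrier M" by simp
  show "f (c \<odot>\<^bsub>P\<^esub> x) \<oplus>\<^bsub>M\<^esub> g (c \<odot>\<^bsub>P\<^esub> x) = c \<odot>\<^bsub>M\<^esub> (f x \<oplus>\<^bsub>M\<^esub> g x)" if "c \<in> carrier R" for c
    using that x fx by (simp add: module_hom_smult[OF f] module_hom_smult[OF g] smult_r_distr)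
  show "f (x \<oplus>\<^bsub>P\<^esub> y) \<oplus>\<^bsub>M\<^esub> g (x \<oplus>\<^bsub>P\<^esub> y) = f x \<oplus>\<^bsub>M\<^esub> g x \<oplus>\<^bsub>M\<^esub> (f y \<oplus>\<^bsub>M\<^esub> g y)"
    if y: "y \<in> carrier P" for y
  proof -
    have "f y \<in> carrier M" "g y \<in> carrier M" using f g y by (auto simp: module_hom_mem)
    then show ?thesis
      using x y fx by (simp add: module_hom_add[OF f] module_hom_add[OF g] M.a_ac)
  qed
qed

lemma (in module) module_hom_smult_fun:
  assumes f: "f \<in> module_hom R P M" and c: "c \<in> carrier R"
  shows "(\<lambda>x. c \<odot>\<^bsub>M\<^esub> f x) \<in> module_hom R P M"
  using module_hom_comp[OF f module_hom_smult_fixed[OF c]] .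

lemma (in module) module_hom_zero_fun: "(\<lambda>x. \<zero>\<^bsub>M\<^esub>) \<in> module_hom R P M"
  by (rule module_homI) auto

lemma (in module) module_hom_finsum_fun:
  assumes P: "module R P" and "finite I" and "\<And>i. i \<in> I \<Longrightarrow> f i \<in> module_hom R P M"
  shows "(\<lambda>x. \<Oplus>\<^bsub>M\<^esub>i\<in>I. f i x) \<in> module_hom R P M"
  using assms(2,3)
proof (induction I)
  case empty
  then show ?case by (simp add: module_hom_zero_fun)
next
  case (insert i I)
  have mem: "f j x \<in> carrier M" if "j \<in> insert i I" "x \<in> carrier P" for j x
    using insert.prems that by (auto intro: module_hom_mem)
  have "(\<lambda>x. f i x \<oplus>\<^bsub>M\<^esub> (\<Oplus>\<^bsub>M\<^esub>i\<in>I. f i x)) \<in> module_hom R P M"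
    using insert by (intro module_hom_add_fun) auto
  moreover have "(\<Oplus>\<^bsub>M\<^esub>i\<in>insert i I. f i x) = f i x \<oplus>\<^bsub>M\<^esub> (\<Oplus>\<^bsub>M\<^esub>i\<in>I. f i x)"
    if "x \<in> carrier P" for x
    using insert.hyps mem that by (subst M.finsum_insert) (auto simp: Pi_def)
  ultimately show ?case
    using module_hom_cong[OF P, of "\<lambda>x. \<Oplus>\<^bsub>M\<^esub>i\<in>insert i I. f i x"
        "\<lambda>x. f i x \<oplus>\<^bsub>M\<^esub> (\<Oplus>\<^bsub>M\<^esub>i\<in>I. f i x)"] by blast
qed

section \<open>Bilinear maps\<close>

definition bilinear_map ::
  "('k, 'u1) ring_scheme \<Rightarrow> ('k, 'm, 'u2) module_scheme \<Rightarrow> ('k, 'n, 'u3) module_scheme \<Rightarrow>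
   ('k, 'v, 'u4) module_scheme \<Rightarrow> ('m \<Rightarrow> 'n \<Rightarrow> 'v) \<Rightarrow> bool" where
  "bilinear_map K M N V \<phi> \<longleftrightarrow>
    (\<forall>x\<in>carrier M. \<phi> x \<in> module_hom K N V) \<and>
    (\<forall>y\<in>carrier N. (\<lambda>x. \<phi> x y) \<in> module_hom K M V)"

lemma bilinear_mapI:
  assumes "\<And>x. x \<in> carrier M \<Longrightarrow> \<phi> x \<in> module_hom K N V"
    and "\<And>y. y \<in> carrier N \<Longrightarrow> (\<lambda>x. \<phi> x y) \<in> module_hom K M V"
  shows "bilinear_map K M N V \<phi>"
  using assms by (auto simp: bilinear_map_def)

lemma bilinear_mapD:
  assumes "bilinear_map K M N V \<phi>"
  shows "x \<in> carrier M \<Longrightarrow> \<phi> x \<in> module_hom K N V"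
    and "y \<in> carrier N \<Longrightarrow> (\<lambda>x. \<phi> x y) \<in> module_hom K M V"
  using assms by (auto simp: bilinear_map_def)

lemma bilinear_map_mem:
  "\<lbrakk>bilinear_map K M N V \<phi>; x \<in> carrier M; y \<in> carrier N\<rbrakk> \<Longrightarrow> \<phi> x y \<in> carrier V"
  by (rule module_hom_mem[OF bilinear_mapD(1)])

lemma bilinear_map_comp:
  assumes "bilinear_map K M N V \<phi>" and "f \<in> module_hom K M' M" and "g \<in> module_hom K N' N"
    and "h \<in> module_hom K V V'"
  shows "bilinear_map K M' N' V' (\<lambda>x y. h (\<phi> (f x) (g y)))"
proof (rule bilinear_mapI)
  fix x assume "x \<in> carrier M'"
  then have "\<phi> (f x) \<in> module_hom K N V"
    using assms by (intro bilinear_mapD(1)[OF assms(1)]) (rule module_hom_mem)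
  then show "(\<lambda>y. h (\<phi> (f x) (g y))) \<in> module_hom K N' V'"
    by (intro module_hom_comp[OF _ assms(4)] module_hom_comp[OF assms(3)])
next
  fix y assume "y \<in> carrier N'"
  then have "(\<lambda>x. \<phi> x (g y)) \<in> module_hom K M V"
    using assms by (intro bilinear_mapD(2)[OF assms(1)]) (rule module_hom_mem)
  then show "(\<lambda>x. h (\<phi> (f x) (g y))) \<in> module_hom K M' V'"
    by (intro module_hom_comp[OF _ assms(4)] module_hom_comp[OF assms(2)])
qed

section \<open>Free modules and linear extension from a basis\<close>

lemma free_module_simps:
  "carrier (free_module K S) = {f. range f \<subseteq> carrier K \<and> finite (supp K f) \<and> supp K f \<subseteq> S}"
  "zero (free_module K S) = (\<lambda>_. \<zero>\<^bsub>K\<^esub>)"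
  "add (free_module K S) = (\<lambda>f g x. f x \<oplus>\<^bsub>K\<^esub> g x)"
  "smult (free_module K S) = (\<lambda>c f x. c \<otimes>\<^bsub>K\<^esub> f x)"
  by (simp_all add: free_module_def)

lemma (in cring) free_module_closed:
  assumes "f \<in> carrier (free_module R S)" and "g \<in> carrier (free_module R S)"
  shows "(\<lambda>x. f x \<oplus> g x) \<in> carrier (free_module R S)"
proof -
  have "supp R (\<lambda>x. f x \<oplus> g x) \<subseteq> supp R f \<union> supp R g"
    by (auto simp: supp_def)
  then show ?thesis using assms
    by (auto simp: free_module_simps image_subset_iff intro: finite_subset)
qed

lemma (in cring) free_module_smult_closed:
  assumes "c \<in> carrier R" and "f \<in> carrier (free_module R S)"
  shows "(\<lambda>x. c \<otimes> f x) \<in> carrier (free_module R S)"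
proof -
  have "supp R (\<lambda>x. c \<otimes> f x) \<subseteq> supp R f"
    using assms by (auto simp: supp_def)
  then show ?thesis using assms
    by (auto simp: free_module_simps image_subset_iff intro: finite_subset)
qed

lemma (in cring) module_free_module: "module R (free_module R S)"
proof (rule module_criteria)
  have mem: "f x \<in> carrier R" if "f \<in> carrier (free_module R S)" for f x
    using that by (auto simp: free_module_simps)
  show "\<forall>v\<in>carrier (free_module R S). \<exists>w\<in>carrier (free_module R S).
      v \<oplus>\<^bsub>free_module R S\<^esub> w = \<zero>\<^bsub>free_module R S\<^esub>"
  proof
    fix v assume v: "v \<in> carrier (free_module R S)"
    then have "(\<lambda>x. (\<ominus> \<one>) \<otimes> v x) \<in> carrier (free_module R S)"
      by (intro free_module_smult_closed) auto
    then show "\<exists>w\<in>carrier (free_module R S). v \<oplus>\<^bsub>free_module R S\<^esub> w = \<zero>\<^bsub>free_module R S\<^esub>"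
      using mem[OF v] by (intro bexI) (auto simp: free_module_simps l_minus r_neg)
  qed
qed (auto simp: free_module_simps(2-4) free_module_closed free_module_smult_closed is_cring,
     auto simp: free_module_simps image_subset_iff fun_eq_iff a_ac m_assoc l_distr r_distr supp_def)

lemma (in cring) delta_closed:
  "x \<in> S \<Longrightarrow> delta R x \<in> carrier (free_module R S)"
  by (auto simp: free_module_simps delta_def supp_def intro: finite_subset[of _ "{x}"])

text \<open>Splitting off the value at one support point shrinks the finite support, so scaled basis
  vectors and sums reach every element.\<close>

lemma (in cring) free_module_induct [consumes 1, case_names zero smult_delta add]:
  assumes f: "f \<in> carrier (free_module R S)"
    and zero: "P (\<lambda>_. \<zero>)"
    and smult_delta: "\<And>c x. \<lbrakk>c \<in> carrier R; x \<in> S\<rbrakk> \<Longrightarrow> P (\<lambda>y. c \<otimes> delta R x y)"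
    and add: "\<And>f g. \<lbrakk>f \<in> carrier (free_module R S); g \<in> carrier (free_module R S); P f; P g\<rbrakk>
      \<Longrightarrow> P (\<lambda>y. f y \<oplus> g y)"
  shows "P f"
proof -
  have "finite (supp R f)" using f by (simp add: free_module_simps)
  then show ?thesis using f
  proof (induction "supp R f" arbitrary: f rule: finite_induct)
    case empty
    then have "f = (\<lambda>_. \<zero>)" by (auto simp: supp_def)
    then show ?case using zero by simp
  next
    case (insert x U)
    have fm: "f y \<in> carrier R" for y using insert.prems by (auto simp: free_module_simps)
    have x: "x \<in> S" using insert.hyps(4) insert.prems by (auto simp: free_module_simps)
    define g where "g = f(x := \<zero>)"
    have U: "U = supp R g" using insert.hyps(2,4) by (auto simp: supp_def g_def)
    have g: "g \<in> carrier (free_module R S)"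
      using insert.prems insert.hyps(1) U
      by (auto simp: free_module_simps g_def image_subset_iff supp_def)
    have d: "(\<lambda>y. f x \<otimes> delta R x y) \<in> carrier (free_module R S)"
      using fm x by (intro free_module_smult_closed delta_closed)
    have "f = (\<lambda>y. f x \<otimes> delta R x y \<oplus> g y)"
      using fm by (auto simp: g_def delta_def fun_eq_iff)
    moreover have "P (\<lambda>y. f x \<otimes> delta R x y \<oplus> g y)"
      using insert.hyps(3)[OF U g] smult_delta[OF fm x] d g by (intro add)
    ultimately show ?case by simp
  qed
qed

text \<open>The sums inside \<open>tensor_lift\<close>, \<open>KG2_ract\<close>,
  \<open>A_lact\<close> and \<open>ind_mult_pure\<close> are all of this shape, so one proof of
  linearity serves the four.\<close>

definition lin_ext ::
  "('k, 'u1) ring_scheme \<Rightarrow> ('k, 'v, 'u2) module_scheme \<Rightarrow> ('s \<Rightarrow> 'v) \<Rightarrow> ('s \<Rightarrow> 'k) \<Rightarrow> 'v" where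
  "lin_ext K V \<phi> f = (\<Oplus>\<^bsub>V\<^esub>p\<in>supp K f. f p \<odot>\<^bsub>V\<^esub> \<phi> p)"

context module
begin

text \<open>Cancellation makes the support of a sum unpredictable. Outside the support the summands
  vanish, so any larger finite set may be used, in particular a common one for two
  functions.\<close>

lemma lin_ext_superset:
  assumes "f \<in> carrier (free_module R S)" and "\<And>x. x \<in> S \<Longrightarrow> \<phi> x \<in> carrier M"
    and "finite U" and "supp R f \<subseteq> U" and "U \<subseteq> S"
  shows "lin_ext R M \<phi> f = (\<Oplus>\<^bsub>M\<^esub>p\<in>U. f p \<odot>\<^bsub>M\<^esub> \<phi> p)"
  unfolding lin_ext_def using assms
  by (intro M.add.finprod_mono_neutral_cong_left)
     (auto simp: supp_def free_module_simps image_subset_iff subset_iff)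

lemma lin_ext_closed:
  assumes "f \<in> carrier (free_module R S)" and "\<And>x. x \<in> S \<Longrightarrow> \<phi> x \<in> carrier M"
  shows "lin_ext R M \<phi> f \<in> carrier M"
  unfolding lin_ext_def using assms
  by (intro M.finsum_closed) (auto simp: free_module_simps image_subset_iff subset_iff)

lemma lin_ext_delta:
  assumes "x \<in> S" and "\<phi> x \<in> carrier M"
  shows "lin_ext R M \<phi> (delta R x) = \<phi> x"
proof -
  have "lin_ext R M \<phi> (delta R x) = (\<Oplus>\<^bsub>M\<^esub>p\<in>{x}. delta R x p \<odot>\<^bsub>M\<^esub> \<phi> p)"
    by (rule lin_ext_superset[where S = "{x}"])
       (use assms R.delta_closed[of x "{x}"] in \<open>auto simp: supp_def delta_def\<close>)
  then show ?thesis using assms by (simp add: delta_def)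
qed

lemma lin_ext_hom:
  assumes \<phi>: "\<And>x. x \<in> S \<Longrightarrow> \<phi> x \<in> carrier M"
  shows "lin_ext R M \<phi> \<in> module_hom R (free_module R S) M"
proof (rule module_homI)
  fix f assume f: "f \<in> carrier (free_module R S)"
  have fm: "f p \<in> carrier R" for p using f by (auto simp: free_module_simps)
  have ff: "finite (supp R f)" "supp R f \<subseteq> S" using f by (auto simp: free_module_simps)
  show "lin_ext R M \<phi> f \<in> carrier M" by (rule lin_ext_closed[OF f \<phi>])
  show "lin_ext R M \<phi> (c \<odot>\<^bsub>free_module R S\<^esub> f) = c \<odot>\<^bsub>M\<^esub> lin_ext R M \<phi> f"
    if c: "c \<in> carrier R" for c
  proof -
    have "lin_ext R M \<phi> (\<lambda>x. c \<otimes> f x) = (\<Oplus>\<^bsub>M\<^esub>p\<in>supp R f. (c \<otimes> f p) \<odot>\<^bsub>M\<^esub> \<phi> p)"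
      using ff c fm by (intro lin_ext_superset[OF R.free_module_smult_closed[OF c f] \<phi>])
        (auto simp: supp_def)
    also have "\<dots> = (\<Oplus>\<^bsub>M\<^esub>p\<in>supp R f. c \<odot>\<^bsub>M\<^esub> (f p \<odot>\<^bsub>M\<^esub> \<phi> p))"
      using ff c fm \<phi> by (intro M.finsum_cong') (auto simp: smult_assoc1 subset_iff)
    also have "\<dots> = c \<odot>\<^bsub>M\<^esub> (\<Oplus>\<^bsub>M\<^esub>p\<in>supp R f. f p \<odot>\<^bsub>M\<^esub> \<phi> p)"
      using ff c fm \<phi> by (intro finsum_smult_ldistr[symmetric]) auto
    finally show ?thesis by (simp add: free_module_simps lin_ext_def)
  qed
  show "lin_ext R M \<phi> (f \<oplus>\<^bsub>free_module R S\<^esub> g) = lin_ext R M \<phi> f \<oplus>\<^bsub>M\<^esub> lin_ext R M \<phi> g"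
    if g: "g \<in> carrier (free_module R S)" for g
  proof -
    have gm: "g p \<in> carrier R" for p using g by (auto simp: free_module_simps)
    define U where "U = supp R f \<union> supp R g"
    have U: "finite U" "supp R f \<subseteq> U" "supp R g \<subseteq> U" "U \<subseteq> S"
      "supp R (\<lambda>x. f x \<oplus> g x) \<subseteq> U"
      using f g by (auto simp: U_def free_module_simps supp_def)
    have \<phi>U: "\<phi> p \<in> carrier M" if "p \<in> U" for p using that U \<phi> by auto
    have "lin_ext R M \<phi> (\<lambda>x. f x \<oplus> g x) = (\<Oplus>\<^bsub>M\<^esub>p\<in>U. (f p \<oplus> g p) \<odot>\<^bsub>M\<^esub> \<phi> p)"
      using U by (intro lin_ext_superset[OF R.free_module_closed[OF f g] \<phi>])
    also have "\<dots> = (\<Oplus>\<^bsub>M\<^esub>p\<in>U. f p \<odot>\<^bsub>M\<^esub> \<phi> p \<oplus>\<^bsub>M\<^esub> g p \<odot>\<^bsub>M\<^esub> \<phi> p)"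
      using fm gm \<phi>U by (intro M.finsum_cong') (auto simp: smult_l_distr)
    also have "\<dots> = (\<Oplus>\<^bsub>M\<^esub>p\<in>U. f p \<odot>\<^bsub>M\<^esub> \<phi> p) \<oplus>\<^bsub>M\<^esub> (\<Oplus>\<^bsub>M\<^esub>p\<in>U. g p \<odot>\<^bsub>M\<^esub> \<phi> p)"
      using fm gm \<phi>U by (intro M.finsum_addf) auto
    also have "\<dots> = lin_ext R M \<phi> f \<oplus>\<^bsub>M\<^esub> lin_ext R M \<phi> g"
      using U by (simp add: lin_ext_superset[OF f \<phi>] lin_ext_superset[OF g \<phi>])
    finally show ?thesis by (simp add: free_module_simps)
  qed
qed

text \<open>Linearity in the parameter of \<open>\<phi>\<close> rather than in \<open>f\<close>: for
  fixed \<open>f\<close> the value is a finite combination of linear maps.\<close>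

lemma lin_ext_fun_hom:
  assumes P: "module R P" and f: "f \<in> carrier (free_module R S)"
    and \<phi>: "\<And>x. x \<in> S \<Longrightarrow> \<phi> x \<in> module_hom R P M"
  shows "(\<lambda>a. lin_ext R M (\<lambda>x. \<phi> x a) f) \<in> module_hom R P M"
  unfolding lin_ext_def using f \<phi>
  by (intro module_hom_finsum_fun[OF P] module_hom_smult_fun)
     (auto simp: free_module_simps image_subset_iff subset_iff)

lemma lin_ext_bilinear:
  assumes P: "module R P" and \<phi>: "\<And>x. x \<in> S \<Longrightarrow> \<phi> x \<in> module_hom R P M"
  shows "bilinear_map R (free_module R S) P M (\<lambda>f a. lin_ext R M (\<lambda>x. \<phi> x a) f)"
  using \<phi> by (intro bilinear_mapI lin_ext_fun_hom[OF P] lin_ext_hom) (auto intro: module_hom_mem)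

end

section \<open>Quotient modules\<close>

lemma quotient_module_simps:
  "carrier (quotient_module V N) = a_rcosets\<^bsub>V\<^esub> N"
  "zero (quotient_module V N) = N"
  "add (quotient_module V N) = set_add V"
  "smult (quotient_module V N) = (\<lambda>c X. \<Union>x\<in>X. N +>\<^bsub>V\<^esub> (c \<odot>\<^bsub>V\<^esub> x))"
  by (simp_all add: quotient_module_def)

context module
begin

lemma submodule_abelian_subgroup:
  assumes "submodule R N M"
  shows "abelian_subgroup N M"
proof (rule abelian_subgroupI3)
  interpret N: submodule R N M by fact
  show "additive_subgroup N M"
  proof (rule additive_subgroupI, rule add.subgroupI)
    show "N \<subseteq> carrier M" by (rule N.subset)
    show "N \<noteq> {}" using N.zero_closed by blast
    fix a assume a: "a \<in> N"
    then have "(\<ominus> \<one>) \<odot>\<^bsub>M\<^esub> a = \<ominus>\<^bsub>M\<^esub> a" using N.subset by (simp add: smult_l_minus subset_iff)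
    then show "\<ominus>\<^bsub>M\<^esub> a \<in> N" using a N.smult_closed[of "\<ominus> \<one>" a] by simp
  qed simp
  show "abelian_group M" by (rule M.abelian_group_axioms)
qed

context
  fixes N assumes N: "submodule R N M"
begin

text \<open>The quotient scales a coset by uniting the cosets of all scaled representatives. They
  coincide: scaling n + v gives c n + c v, and c n stays in \<open>N\<close>.\<close>

lemma quotient_smult_coset:
  assumes "c \<in> carrier R" and "v \<in> carrier M"
  shows "c \<odot>\<^bsub>quotient_module M N\<^esub> (N +>\<^bsub>M\<^esub> v) = N +>\<^bsub>M\<^esub> (c \<odot>\<^bsub>M\<^esub> v)"
proof -
  interpret N: submodule R N M by (rule N)
  interpret A: abelian_subgroup N M by (rule submodule_abelian_subgroup[OF N])
  have "N +>\<^bsub>M\<^esub> (c \<odot>\<^bsub>M\<^esub> x) = N +>\<^bsub>M\<^esub> (c \<odot>\<^bsub>M\<^esub> v)" if x: "x \<in> N +>\<^bsub>M\<^esub> v" for x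
  proof -
    obtain n where n: "n \<in> N" "x = n \<oplus>\<^bsub>M\<^esub> v" using x by (auto simp: a_r_coset_def')
    then have "n \<in> carrier M" using N.subset by auto
    then have "c \<odot>\<^bsub>M\<^esub> x = c \<odot>\<^bsub>M\<^esub> n \<oplus>\<^bsub>M\<^esub> c \<odot>\<^bsub>M\<^esub> v" using n assms by (simp add: smult_r_distr)
    then have "c \<odot>\<^bsub>M\<^esub> x \<in> N +>\<^bsub>M\<^esub> (c \<odot>\<^bsub>M\<^esub> v)" using n assms by (auto simp: a_r_coset_def')
    then show ?thesis using assms by (metis A.a_repr_independence' smult_closed)
  qed
  moreover have "v \<in> N +>\<^bsub>M\<^esub> v" using assms by (simp add: A.a_rcos_self)
  ultimately show ?thesis unfolding quotient_module_simps by blast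
qed

lemma quotient_add_coset:
  assumes "v \<in> carrier M" and "w \<in> carrier M"
  shows "(N +>\<^bsub>M\<^esub> v) \<oplus>\<^bsub>quotient_module M N\<^esub> (N +>\<^bsub>M\<^esub> w) = N +>\<^bsub>M\<^esub> (v \<oplus>\<^bsub>M\<^esub> w)"
proof -
  interpret A: abelian_subgroup N M by (rule submodule_abelian_subgroup[OF N])
  show ?thesis using assms by (simp add: quotient_module_simps A.a_rcos_sum)
qed

lemma carrier_quotient_module: "carrier (quotient_module M N) = (\<lambda>v. N +>\<^bsub>M\<^esub> v) ` carrier M"
  by (auto simp: quotient_module_simps A_RCOSETS_def')

lemma zero_quotient_module: "\<zero>\<^bsub>quotient_module M N\<^esub> = N +>\<^bsub>M\<^esub> \<zero>\<^bsub>M\<^esub>"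
proof -
  interpret A: abelian_subgroup N M by (rule submodule_abelian_subgroup[OF N])
  show ?thesis using A.a_subset by (simp add: quotient_module_simps)
qed

lemma module_quotient_module: "module R (quotient_module M N)"
proof (rule module_criteria)
  note c = quotient_add_coset quotient_smult_coset zero_quotient_module
  let ?Q = "quotient_module M N"
  \<comment> \<open>Quantifying over representatives instead of cosets reduces each module axiom of
    the quotient to the same axiom of \<open>M\<close>.\<close>
  have ball: "(\<forall>X\<in>carrier ?Q. P X) \<longleftrightarrow> (\<forall>v\<in>carrier M. P (N +>\<^bsub>M\<^esub> v))" for P
    by (auto simp: carrier_quotient_module)
  have mem: "v \<in> carrier M \<Longrightarrow> N +>\<^bsub>M\<^esub> v \<in> carrier ?Q" for v
    by (auto simp: carrier_quotient_module)
  show "cring R" by (rule R.is_cring)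
  show "\<zero>\<^bsub>?Q\<^esub> \<in> carrier ?Q" by (simp add: zero_quotient_module mem)
  have "\<forall>X\<in>carrier ?Q. \<forall>Y\<in>carrier ?Q. X \<oplus>\<^bsub>?Q\<^esub> Y \<in> carrier ?Q"
    unfolding ball by (simp add: c mem)
  then show "\<forall>v w. v \<in> carrier ?Q \<and> w \<in> carrier ?Q \<longrightarrow> v \<oplus>\<^bsub>?Q\<^esub> w \<in> carrier ?Q" by blast
  have "\<exists>Y\<in>carrier ?Q. (N +>\<^bsub>M\<^esub> v) \<oplus>\<^bsub>?Q\<^esub> Y = \<zero>\<^bsub>?Q\<^esub>" if "v \<in> carrier M" for v
    using that by (intro bexI[of _ "N +>\<^bsub>M\<^esub> (\<ominus>\<^bsub>M\<^esub> v)"]) (auto simp: c M.r_neg mem)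
  then show "\<forall>v\<in>carrier ?Q. \<exists>w\<in>carrier ?Q. v \<oplus>\<^bsub>?Q\<^esub> w = \<zero>\<^bsub>?Q\<^esub>"
    unfolding ball by blast
  have "\<forall>X\<in>carrier ?Q. \<forall>c\<in>carrier R. c \<odot>\<^bsub>?Q\<^esub> X \<in> carrier ?Q"
    unfolding ball by (simp add: c mem)
  then show "\<forall>c v. c \<in> carrier R \<and> v \<in> carrier ?Q \<longrightarrow> c \<odot>\<^bsub>?Q\<^esub> v \<in> carrier ?Q" by blast
  have "\<forall>X\<in>carrier ?Q. \<forall>Y\<in>carrier ?Q. X \<oplus>\<^bsub>?Q\<^esub> Y = Y \<oplus>\<^bsub>?Q\<^esub> X"
    unfolding ball by (simp add: c M.a_comm)
  then show "\<forall>v w. v \<in> carrier ?Q \<and> w \<in> carrier ?Q \<longrightarrow> v \<oplus>\<^bsub>?Q\<^esub> w = w \<oplus>\<^bsub>?Q\<^esub> v" by blast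
  have "\<forall>X\<in>carrier ?Q. \<forall>Y\<in>carrier ?Q. \<forall>Z\<in>carrier ?Q.
      (X \<oplus>\<^bsub>?Q\<^esub> Y) \<oplus>\<^bsub>?Q\<^esub> Z = X \<oplus>\<^bsub>?Q\<^esub> (Y \<oplus>\<^bsub>?Q\<^esub> Z)"
    unfolding ball by (simp add: c M.a_assoc)
  then show "\<forall>v w x. v \<in> carrier ?Q \<and> w \<in> carrier ?Q \<and> x \<in> carrier ?Q \<longrightarrow>
      (v \<oplus>\<^bsub>?Q\<^esub> w) \<oplus>\<^bsub>?Q\<^esub> x = v \<oplus>\<^bsub>?Q\<^esub> (w \<oplus>\<^bsub>?Q\<^esub> x)" by blast
  show "\<forall>v\<in>carrier ?Q. v \<oplus>\<^bsub>?Q\<^esub> \<zero>\<^bsub>?Q\<^esub> = v" unfolding ball by (simp add: c)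
  have "\<forall>X\<in>carrier ?Q. \<forall>a\<in>carrier R. \<forall>b\<in>carrier R. (a \<otimes> b) \<odot>\<^bsub>?Q\<^esub> X = a \<odot>\<^bsub>?Q\<^esub> (b \<odot>\<^bsub>?Q\<^esub> X)"
    unfolding ball by (simp add: c smult_assoc1)
  then show "\<forall>a b v. a \<in> carrier R \<and> b \<in> carrier R \<and> v \<in> carrier ?Q \<longrightarrow>
      (a \<otimes> b) \<odot>\<^bsub>?Q\<^esub> v = a \<odot>\<^bsub>?Q\<^esub> (b \<odot>\<^bsub>?Q\<^esub> v)" by blast
  show "\<forall>v\<in>carrier ?Q. \<one> \<odot>\<^bsub>?Q\<^esub> v = v" unfolding ball by (simp add: c)
  have "\<forall>X\<in>carrier ?Q. \<forall>a\<in>carrier R. \<forall>b\<in>carrier R.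
      (a \<oplus> b) \<odot>\<^bsub>?Q\<^esub> X = a \<odot>\<^bsub>?Q\<^esub> X \<oplus>\<^bsub>?Q\<^esub> b \<odot>\<^bsub>?Q\<^esub> X"
    unfolding ball by (simp add: c smult_l_distr)
  then show "\<forall>a b v. a \<in> carrier R \<and> b \<in> carrier R \<and> v \<in> carrier ?Q \<longrightarrow>
      (a \<oplus> b) \<odot>\<^bsub>?Q\<^esub> v = a \<odot>\<^bsub>?Q\<^esub> v \<oplus>\<^bsub>?Q\<^esub> b \<odot>\<^bsub>?Q\<^esub> v" by blast
  have "\<forall>X\<in>carrier ?Q. \<forall>Y\<in>carrier ?Q. \<forall>a\<in>carrier R.
      a \<odot>\<^bsub>?Q\<^esub> (X \<oplus>\<^bsub>?Q\<^esub> Y) = a \<odot>\<^bsub>?Q\<^esub> X \<oplus>\<^bsub>?Q\<^esub> a \<odot>\<^bsub>?Q\<^esub> Y"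
    unfolding ball by (simp add: c smult_r_distr)
  then show "\<forall>a v w. a \<in> carrier R \<and> v \<in> carrier ?Q \<and> w \<in> carrier ?Q \<longrightarrow>
      a \<odot>\<^bsub>?Q\<^esub> (v \<oplus>\<^bsub>?Q\<^esub> w) = a \<odot>\<^bsub>?Q\<^esub> v \<oplus>\<^bsub>?Q\<^esub> a \<odot>\<^bsub>?Q\<^esub> w" by blast
qed

lemma coset_hom: "(\<lambda>v. N +>\<^bsub>M\<^esub> v) \<in> module_hom R M (quotient_module M N)"
  by (rule module_homI)
     (auto simp: carrier_quotient_module quotient_add_coset quotient_smult_coset)

end

end

text \<open>There are two instances: scalars acting on \<open>A\<close> from both sides, which gives
  the tensor square, and \<open>KH2\<close> acting on \<open>KG2\<close> and on \<open>A\<close>,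
  which gives the factors of the induced algebra. Closure of the actions keeps the relators inside
  the free module.\<close>

locale tensor_data = M: module K M + N: module K N
  for K :: "('k, 'u1) ring_scheme" and M :: "('k, 'm, 'u2) module_scheme"
    and N :: "('k, 'n, 'u3) module_scheme" +
  fixes R :: "('r, 'u4) ring_scheme" and ract :: "'m \<Rightarrow> 'r \<Rightarrow> 'm" and lact :: "'r \<Rightarrow> 'n \<Rightarrow> 'n"
  assumes ract_closed: "\<lbrakk>x \<in> carrier M; r \<in> carrier R\<rbrakk> \<Longrightarrow> ract x r \<in> carrier M"
    and lact_closed: "\<lbrakk>r \<in> carrier R; y \<in> carrier N\<rbrakk> \<Longrightarrow> lact r y \<in> carrier N"
begin

abbreviation "F \<equiv> free_module K (carrier M \<times> carrier N)"
abbreviation "null \<equiv> tensor_null K R M ract N lact"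
abbreviation "TP \<equiv> tensor_product K R M ract N lact"
abbreviation "pure \<equiv> pure_tensor K R M ract N lact"
abbreviation "relators \<equiv> tensor_relators K R M ract N lact"

sublocale F: module K F
  by (rule M.R.module_free_module)

lemma delta_mem: "\<lbrakk>x \<in> carrier M; y \<in> carrier N\<rbrakk> \<Longrightarrow> delta K (x, y) \<in> carrier F"
  by (rule M.R.delta_closed) simp

lemma relators_subset: "relators \<subseteq> carrier F"
  unfolding tensor_relators_def Let_def
  by (auto intro!: F.minus_closed F.a_closed F.smult_closed delta_mem ract_closed lact_closed
      simp del: M.R.minus_closed)

lemma relators_intros:
  "\<lbrakk>x \<in> carrier M; x' \<in> carrier M; y \<in> carrier N\<rbrakk> \<Longrightarrow>
    delta K (x \<oplus>\<^bsub>M\<^esub> x', y) \<ominus>\<^bsub>F\<^esub> (delta K (x, y) \<oplus>\<^bsub>F\<^esub> delta K (x', y)) \<in> relators"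
  "\<lbrakk>x \<in> carrier M; y \<in> carrier N; y' \<in> carrier N\<rbrakk> \<Longrightarrow>
    delta K (x, y \<oplus>\<^bsub>N\<^esub> y') \<ominus>\<^bsub>F\<^esub> (delta K (x, y) \<oplus>\<^bsub>F\<^esub> delta K (x, y')) \<in> relators"
  "\<lbrakk>c \<in> carrier K; x \<in> carrier M; y \<in> carrier N\<rbrakk> \<Longrightarrow>
    delta K (c \<odot>\<^bsub>M\<^esub> x, y) \<ominus>\<^bsub>F\<^esub> c \<odot>\<^bsub>F\<^esub> delta K (x, y) \<in> relators"
  "\<lbrakk>c \<in> carrier K; x \<in> carrier M; y \<in> carrier N\<rbrakk> \<Longrightarrow>
    delta K (x, c \<odot>\<^bsub>N\<^esub> y) \<ominus>\<^bsub>F\<^esub> c \<odot>\<^bsub>F\<^esub> delta K (x, y) \<in> relators"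
  "\<lbrakk>x \<in> carrier M; r \<in> carrier R; y \<in> carrier N\<rbrakk> \<Longrightarrow>
    delta K (ract x r, y) \<ominus>\<^bsub>F\<^esub> delta K (x, lact r y) \<in> relators"
  unfolding tensor_relators_def Let_def by blast+

lemma submodule_null: "submodule K null F"
  unfolding tensor_null_def by (rule F.span_is_submodule[OF relators_subset])

lemma relators_null: "relators \<subseteq> null"
  unfolding tensor_null_def by (rule F.in_own_span[OF relators_subset])

lemma TP_eq: "TP = quotient_module F null"
  by (simp add: tensor_product_def)

sublocale TP: module K TP
  unfolding TP_eq by (rule F.module_quotient_module[OF submodule_null])

lemma pure_eq: "pure x y = null +>\<^bsub>F\<^esub> delta K (x, y)"
  by (simp add: pure_tensor_def)

lemma coset_hom_TP: "(\<lambda>f. null +>\<^bsub>F\<^esub> f) \<in> module_hom K F TP"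
  unfolding TP_eq by (rule F.coset_hom[OF submodule_null])

lemma pure_closed [simp, intro]: "\<lbrakk>x \<in> carrier M; y \<in> carrier N\<rbrakk> \<Longrightarrow> pure x y \<in> carrier TP"
  unfolding pure_eq by (intro module_hom_mem[OF coset_hom_TP] delta_mem)

lemma coset_eqI:
  assumes "f \<ominus>\<^bsub>F\<^esub> g \<in> relators" and "f \<in> carrier F" and "g \<in> carrier F"
  shows "null +>\<^bsub>F\<^esub> f = null +>\<^bsub>F\<^esub> g"
proof -
  interpret A: abelian_subgroup null F by (rule F.submodule_abelian_subgroup[OF submodule_null])
  have "f \<in> null +>\<^bsub>F\<^esub> g"
    using assms relators_null
    by (subst A.a_rcos_module) (auto simp: a_minus_def)
  then show ?thesis using assms by (metis A.a_repr_independence')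
qed

lemma pure_add_left:
  assumes "x \<in> carrier M" "x' \<in> carrier M" "y \<in> carrier N"
  shows "pure (x \<oplus>\<^bsub>M\<^esub> x') y = pure x y \<oplus>\<^bsub>TP\<^esub> pure x' y"
  unfolding pure_eq using assms
  by (subst module_hom_add[OF coset_hom_TP, symmetric]; (intro coset_eqI relators_intros)?) (auto intro: delta_mem)

lemma pure_add_right:
  assumes "x \<in> carrier M" "y \<in> carrier N" "y' \<in> carrier N"
  shows "pure x (y \<oplus>\<^bsub>N\<^esub> y') = pure x y \<oplus>\<^bsub>TP\<^esub> pure x y'"
  unfolding pure_eq using assms
  by (subst module_hom_add[OF coset_hom_TP, symmetric]; (intro coset_eqI relators_intros)?) (auto intro: delta_mem)

lemma pure_smult_left:
  assumes "c \<in> carrier K" "x \<in> carrier M" "y \<in> carrier N"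
  shows "pure (c \<odot>\<^bsub>M\<^esub> x) y = c \<odot>\<^bsub>TP\<^esub> pure x y"
  unfolding pure_eq using assms
  by (subst module_hom_smult[OF coset_hom_TP, symmetric]; (intro coset_eqI relators_intros)?) (auto intro: delta_mem)

lemma pure_smult_right:
  assumes "c \<in> carrier K" "x \<in> carrier M" "y \<in> carrier N"
  shows "pure x (c \<odot>\<^bsub>N\<^esub> y) = c \<odot>\<^bsub>TP\<^esub> pure x y"
  unfolding pure_eq using assms
  by (subst module_hom_smult[OF coset_hom_TP, symmetric]; (intro coset_eqI relators_intros)?) (auto intro: delta_mem)

lemma pure_balanced:
  assumes "x \<in> carrier M" "r \<in> carrier R" "y \<in> carrier N"
  shows "pure (ract x r) y = pure x (lact r y)"
  unfolding pure_eq using assms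
  by (intro coset_eqI relators_intros) (auto intro!: delta_mem ract_closed lact_closed)

lemma pure_bilinear: "bilinear_map K M N TP pure"
  by (intro bilinear_mapI module_homI)
     (auto simp: pure_add_left pure_add_right pure_smult_left pure_smult_right)

text \<open>No case for scalars occurs: a multiple of \<open>pure x y\<close> is again pure, since
  the scalar goes into x.\<close>

lemma TP_induct [consumes 1, case_names zero pure add]:
  assumes X: "X \<in> carrier TP"
    and zero: "P \<zero>\<^bsub>TP\<^esub>"
    and pure: "\<And>x y. \<lbrakk>x \<in> carrier M; y \<in> carrier N\<rbrakk> \<Longrightarrow> P (pure x y)"
    and add: "\<And>X Y. \<lbrakk>X \<in> carrier TP; Y \<in> carrier TP; P X; P Y\<rbrakk> \<Longrightarrow> P (X \<oplus>\<^bsub>TP\<^esub> Y)"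
  shows "P X"
proof -
  obtain f where f: "f \<in> carrier F" "X = null +>\<^bsub>F\<^esub> f"
    using X by (auto simp: TP_eq F.carrier_quotient_module[OF submodule_null])
  from f(1) have "P (null +>\<^bsub>F\<^esub> f)"
  proof (induction rule: M.R.free_module_induct)
    case zero
    then show ?case
      using assms(2) F.zero_quotient_module[OF submodule_null]
      by (simp add: TP_eq free_module_simps)
  next
    case (smult_delta c p)
    obtain x y where p: "p = (x, y)" "x \<in> carrier M" "y \<in> carrier N" using smult_delta by auto
    have "null +>\<^bsub>F\<^esub> (c \<odot>\<^bsub>F\<^esub> delta K p) = pure (c \<odot>\<^bsub>M\<^esub> x) y"
      using smult_delta p
      by (simp add: pure_smult_left module_hom_smult[OF coset_hom_TP] delta_mem) (simp add: pure_eq)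
    then show ?case using pure smult_delta p by (simp add: free_module_simps)
  next
    case (add f g)
    have "null +>\<^bsub>F\<^esub> (f \<oplus>\<^bsub>F\<^esub> g) = (null +>\<^bsub>F\<^esub> f) \<oplus>\<^bsub>TP\<^esub> (null +>\<^bsub>F\<^esub> g)"
      using add by (simp add: module_hom_add[OF coset_hom_TP])
    then show ?case
      using add assms(4) module_hom_mem[OF coset_hom_TP]
      by (simp add: free_module_simps(3))
  qed
  then show ?thesis using f by simp
qed

lemma TP_hom_eqI:
  assumes V: "module K V" and f: "f \<in> module_hom K TP V" and g: "g \<in> module_hom K TP V"
    and eq: "\<And>x y. \<lbrakk>x \<in> carrier M; y \<in> carrier N\<rbrakk> \<Longrightarrow> f (pure x y) = g (pure x y)"
    and X: "X \<in> carrier TP"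
  shows "f X = g X"
  using X
proof (induction rule: TP_induct)
  case zero
  then show ?case by (simp add: TP.module_hom_zero[OF V f] TP.module_hom_zero[OF V g])
next
  case (add X Y)
  then show ?case by (simp add: module_hom_add[OF f] module_hom_add[OF g])
qed (rule eq)

context
  fixes V :: "('k, 'v, 'u5) module_scheme" and \<phi> :: "'m \<Rightarrow> 'n \<Rightarrow> 'v"
  assumes V: "module K V" and \<phi>: "bilinear_map K M N V \<phi>"
    and balanced: "\<And>x r y. \<lbrakk>x \<in> carrier M; r \<in> carrier R; y \<in> carrier N\<rbrakk>
      \<Longrightarrow> \<phi> (ract x r) y = \<phi> x (lact r y)"
begin

text \<open>This justifies the \<open>the_elem\<close> in \<open>tensor_lift\<close>: the linear
  extension kills every relator, hence their span \<open>null\<close>, so it is constant on each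
  coset.\<close>

lemma tensor_lift_coset:
  assumes f: "f \<in> carrier F"
  shows "tensor_lift K V \<phi> (null +>\<^bsub>F\<^esub> f) = lin_ext K V (\<lambda>p. \<phi> (fst p) (snd p)) f"
proof -
  interpret V: module K V by (rule V)
  let ?L = "lin_ext K V (\<lambda>p. \<phi> (fst p) (snd p))"
  have \<phi>c: "\<phi> x y \<in> carrier V" if "x \<in> carrier M" "y \<in> carrier N" for x y
    using that by (rule bilinear_map_mem[OF \<phi>])
  have L: "?L \<in> module_hom K F V" using \<phi>c by (intro V.lin_ext_hom) auto
  interpret L: mod_hom K F V ?L using L
    by (simp add: mod_hom_def mod_hom_axioms_def F.module_axioms V)
  have d: "?L (delta K (x, y)) = \<phi> x y" if "x \<in> carrier M" "y \<in> carrier N" for x y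
    using that \<phi>c by (subst V.lin_ext_delta[of _ "carrier M \<times> carrier N"]) auto
  have "relators \<subseteq> L.ker"
  proof
    fix r assume r: "r \<in> relators"
    then have rF: "r \<in> carrier F" using relators_subset by blast
    \<comment> \<open>Bilinearity of \<open>\<phi>\<close> kills the first four families of
      relators, \<open>balanced\<close> the fifth.\<close>
    have "?L r = \<zero>\<^bsub>V\<^esub>"
      using r unfolding tensor_relators_def Let_def
      using \<phi>c ract_closed lact_closed balanced
      by (elim UnE CollectE exE conjE)
         (simp_all add: L.f_minus delta_mem d module_hom_add[OF bilinear_mapD(1)[OF \<phi>]]
           module_hom_add[OF bilinear_mapD(2)[OF \<phi>]] module_hom_smult[OF bilinear_mapD(1)[OF \<phi>]]
           module_hom_smult[OF bilinear_mapD(2)[OF \<phi>]] V.r_neg a_minus_def[of V]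
           V.M.r_neg)
    then show "r \<in> L.ker" using rF by (simp add: L.ker_def)
  qed
  then have null: "null \<subseteq> L.ker"
    unfolding tensor_null_def by (intro F.span_is_subset L.ker_is_submodule)
  have "?L g = ?L f" if g: "g \<in> null +>\<^bsub>F\<^esub> f" for g
  proof -
    obtain n where n: "n \<in> null" "g = n \<oplus>\<^bsub>F\<^esub> f" using g unfolding a_r_coset_def' by blast
    then have "n \<in> carrier F" "?L n = \<zero>\<^bsub>V\<^esub>" using null by (auto simp: L.ker_def)
    then show ?thesis using n f L.f_im[OF f] by (simp add: L.f_add)
  qed
  moreover have "f \<in> null +>\<^bsub>F\<^esub> f"
    using f abelian_subgroup.a_rcos_self[OF F.submodule_abelian_subgroup[OF submodule_null]]
    by blast
  ultimately have "?L ` (null +>\<^bsub>F\<^esub> f) = {?L f}" by blast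
  then show ?thesis by (simp add: tensor_lift_def lin_ext_def)
qed

lemma tensor_lift_hom: "tensor_lift K V \<phi> \<in> module_hom K TP V"
proof -
  interpret V: module K V by (rule V)
  let ?L = "lin_ext K V (\<lambda>p. \<phi> (fst p) (snd p))"
  have L: "?L \<in> module_hom K F V"
    by (intro V.lin_ext_hom) (auto intro: bilinear_map_mem[OF \<phi>])
  have ex: "\<exists>f\<in>carrier F. X = null +>\<^bsub>F\<^esub> f" if "X \<in> carrier TP" for X
    using that by (auto simp: TP_eq F.carrier_quotient_module[OF submodule_null])
  show ?thesis
  proof (rule module_homI)
    fix X assume "X \<in> carrier TP"
    then obtain f where f: "f \<in> carrier F" "X = null +>\<^bsub>F\<^esub> f" using ex by blast
    show "tensor_lift K V \<phi> X \<in> carrier V"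
      using f module_hom_mem[OF L] by (simp add: tensor_lift_coset)
    show "tensor_lift K V \<phi> (c \<odot>\<^bsub>TP\<^esub> X) = c \<odot>\<^bsub>V\<^esub> tensor_lift K V \<phi> X" if "c \<in> carrier K" for c
      using f that
      by (simp add: tensor_lift_coset module_hom_smult[OF coset_hom_TP, symmetric]
          module_hom_smult[OF L])
    show "tensor_lift K V \<phi> (X \<oplus>\<^bsub>TP\<^esub> Y) = tensor_lift K V \<phi> X \<oplus>\<^bsub>V\<^esub> tensor_lift K V \<phi> Y"
      if Y: "Y \<in> carrier TP" for Y
    proof -
      obtain g where g: "g \<in> carrier F" "Y = null +>\<^bsub>F\<^esub> g" using ex[OF Y] by blast
      show ?thesis using f g
        by (simp add: tensor_lift_coset module_hom_add[OF coset_hom_TP, symmetric]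
            module_hom_add[OF L])
    qed
  qed
qed

lemma tensor_lift_pure:
  assumes "x \<in> carrier M" "y \<in> carrier N"
  shows "tensor_lift K V \<phi> (pure x y) = \<phi> x y"
proof -
  interpret V: module K V by (rule V)
  have "\<phi> x y \<in> carrier V"
    using assms by (rule bilinear_map_mem[OF \<phi>])
  then show ?thesis using assms
    by (simp add: pure_eq tensor_lift_coset delta_mem
        V.lin_ext_delta[of _ "carrier M \<times> carrier N"])
qed

end

end

section \<open>Separability idempotents\<close>

context assoc_algebra
begin

lemma mult_hom_left: "b \<in> carrier A \<Longrightarrow> (\<lambda>a. a \<otimes>\<^bsub>A\<^esub> b) \<in> module_hom K A A"
  by (rule module_homI) (auto simp: l_distr smult_mult_left)

lemma mult_hom_right: "a \<in> carrier A \<Longrightarrow> (\<lambda>b. a \<otimes>\<^bsub>A\<^esub> b) \<in> module_hom K A A"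
  by (rule module_homI) (auto simp: r_distr smult_mult_right)

lemma mult_bilinear: "bilinear_map K A A A (\<lambda>a b. a \<otimes>\<^bsub>A\<^esub> b)"
  by (intro bilinear_mapI mult_hom_left mult_hom_right)

abbreviation "A2 \<equiv> tensor_square K A"
abbreviation "pure2 \<equiv> tensor_square_pure K A"
abbreviation "bimult \<equiv> tensor_square_bimult K A"

lemma tensor_data_square: "tensor_data K A A K (\<lambda>x c. c \<odot>\<^bsub>A\<^esub> x) (\<lambda>c x. c \<odot>\<^bsub>A\<^esub> x)"
  by (intro tensor_data.intro tensor_data_axioms.intro module_axioms) auto

lemma module_tensor_square: "module K A2"
proof -
  interpret T: tensor_data K A A K "\<lambda>x c. c \<odot>\<^bsub>A\<^esub> x" "\<lambda>c x. c \<odot>\<^bsub>A\<^esub> x"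
    by (rule tensor_data_square)
  show ?thesis unfolding tensor_square_def by (rule T.TP.module_axioms)
qed

lemma pure2_bilinear: "bilinear_map K A A A2 pure2"
proof -
  interpret T: tensor_data K A A K "\<lambda>x c. c \<odot>\<^bsub>A\<^esub> x" "\<lambda>c x. c \<odot>\<^bsub>A\<^esub> x"
    by (rule tensor_data_square)
  show ?thesis unfolding tensor_square_def tensor_square_pure_def by (rule T.pure_bilinear)
qed

lemmas pure2_closed [simp, intro] = bilinear_map_mem[OF pure2_bilinear]

lemma A2_hom_eqI:
  assumes "module K V" and "f \<in> module_hom K A2 V" and "g \<in> module_hom K A2 V"
    and "\<And>x y. \<lbrakk>x \<in> carrier A; y \<in> carrier A\<rbrakk> \<Longrightarrow> f (pure2 x y) = g (pure2 x y)"
    and "X \<in> carrier A2"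
  shows "f X = g X"
proof -
  interpret T: tensor_data K A A K "\<lambda>x c. c \<odot>\<^bsub>A\<^esub> x" "\<lambda>c x. c \<odot>\<^bsub>A\<^esub> x"
    by (rule tensor_data_square)
  show ?thesis using assms unfolding tensor_square_def tensor_square_pure_def
    by (rule T.TP_hom_eqI)
qed

context
  fixes V :: "('a, 'v, 'w) module_scheme" and \<phi>
  assumes V: "module K V" and \<phi>: "bilinear_map K A A V \<phi>"
begin

text \<open>Over the field itself balancing follows from bilinearity, so every bilinear map lifts to
  the tensor square.\<close>

lemma A2_balanced:
  assumes "x \<in> carrier A" "c \<in> carrier K" "y \<in> carrier A"
  shows "\<phi> (c \<odot>\<^bsub>A\<^esub> x) y = \<phi> x (c \<odot>\<^bsub>A\<^esub> y)"
  using assms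
  by (simp add: module_hom_smult[OF bilinear_mapD(1)[OF \<phi>]] module_hom_smult[OF bilinear_mapD(2)[OF \<phi>]])

lemma A2_lift_hom: "tensor_lift K V \<phi> \<in> module_hom K A2 V"
proof -
  interpret T: tensor_data K A A K "\<lambda>x c. c \<odot>\<^bsub>A\<^esub> x" "\<lambda>c x. c \<odot>\<^bsub>A\<^esub> x"
    by (rule tensor_data_square)
  show ?thesis unfolding tensor_square_def
    by (rule T.tensor_lift_hom[OF V \<phi> A2_balanced])
qed

lemma A2_lift_pure:
  "\<lbrakk>x \<in> carrier A; y \<in> carrier A\<rbrakk> \<Longrightarrow> tensor_lift K V \<phi> (pure2 x y) = \<phi> x y"
proof -
  interpret T: tensor_data K A A K "\<lambda>x c. c \<odot>\<^bsub>A\<^esub> x" "\<lambda>c x. c \<odot>\<^bsub>A\<^esub> x"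
    by (rule tensor_data_square)
  show "\<lbrakk>x \<in> carrier A; y \<in> carrier A\<rbrakk> \<Longrightarrow> ?thesis" unfolding tensor_square_pure_def
    by (rule T.tensor_lift_pure[OF V \<phi> A2_balanced])
qed

end

lemma mult_map_hom: "mult_map K A \<in> module_hom K A2 A"
  using A2_lift_hom[OF module_axioms mult_bilinear] by (simp add: mult_map_def[abs_def])

lemma mult_map_pure: "\<lbrakk>x \<in> carrier A; y \<in> carrier A\<rbrakk> \<Longrightarrow> mult_map K A (pure2 x y) = x \<otimes>\<^bsub>A\<^esub> y"
  using A2_lift_pure[OF module_axioms mult_bilinear] by (simp add: mult_map_def)

lemma bimult_bilinear:
  assumes "a \<in> carrier A" "b \<in> carrier A"
  shows "bilinear_map K A A A2 (\<lambda>x y. pure2 (a \<otimes>\<^bsub>A\<^esub> x) (y \<otimes>\<^bsub>A\<^esub> b))"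
  using assms
  by (intro bilinear_map_comp[OF pure2_bilinear, where h = "\<lambda>x. x"] mult_hom_left mult_hom_right
      module_hom_id)

lemma bimult_hom:
  assumes "a \<in> carrier A" "b \<in> carrier A"
  shows "(\<lambda>X. bimult a X b) \<in> module_hom K A2 A2"
  unfolding tensor_square_bimult_def
  using A2_lift_hom[OF module_tensor_square bimult_bilinear[OF assms]] by simp

lemma bimult_closed [simp, intro]:
  "\<lbrakk>a \<in> carrier A; b \<in> carrier A; X \<in> carrier A2\<rbrakk> \<Longrightarrow> bimult a X b \<in> carrier A2"
  by (rule module_hom_mem[OF bimult_hom])

lemma bimult_pure:
  assumes "a \<in> carrier A" "b \<in> carrier A" "x \<in> carrier A" "y \<in> carrier A"
  shows "bimult a (pure2 x y) b = pure2 (a \<otimes>\<^bsub>A\<^esub> x) (y \<otimes>\<^bsub>A\<^esub> b)"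
  unfolding tensor_square_bimult_def
  using assms by (intro A2_lift_pure[OF module_tensor_square bimult_bilinear])

lemma bimult_bimult:
  assumes "a \<in> carrier A" "a' \<in> carrier A" "b \<in> carrier A" "b' \<in> carrier A" "X \<in> carrier A2"
  shows "bimult a (bimult a' X b') b = bimult (a \<otimes>\<^bsub>A\<^esub> a') X (b' \<otimes>\<^bsub>A\<^esub> b)"
  by (rule A2_hom_eqI[OF module_tensor_square _ _ _ assms(5)];
      (rule module_hom_comp[OF bimult_hom bimult_hom] bimult_hom)?)
     (use assms in \<open>auto simp: bimult_pure m_assoc\<close>)

lemma mult_map_bimult:
  assumes "a \<in> carrier A" "b \<in> carrier A" "X \<in> carrier A2"
  shows "mult_map K A (bimult a X b) = a \<otimes>\<^bsub>A\<^esub> mult_map K A X \<otimes>\<^bsub>A\<^esub> b"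
  by (rule A2_hom_eqI[OF module_axioms _ _ _ assms(3)],
      rule module_hom_comp[OF bimult_hom mult_map_hom],
      (rule assms)+,
      rule module_hom_comp[OF module_hom_comp[OF mult_map_hom mult_hom_right] mult_hom_left])
     (use assms in \<open>auto simp: bimult_pure mult_map_pure m_assoc\<close>)

lemma bimult_hom_left:
  assumes X: "X \<in> carrier A2" and b: "b \<in> carrier A"
  shows "(\<lambda>a. bimult a X b) \<in> module_hom K A A2"
proof (rule module_homI)
  interpret A2: module K A2 by (rule module_tensor_square)
  note p = bilinear_mapD(2)[OF pure2_bilinear]
  show "bimult a X b \<in> carrier A2" if "a \<in> carrier A" for a
    using assms that by simp
  show "bimult (a \<oplus>\<^bsub>A\<^esub> a') X b = bimult a X b \<oplus>\<^bsub>A2\<^esub> bimult a' X b"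
    if a: "a \<in> carrier A" "a' \<in> carrier A" for a a'
    by (rule A2_hom_eqI[OF module_tensor_square _ _ _ X],
        (intro bimult_hom A2.module_hom_add_fun b a M.a_closed)+)
       (use a b in \<open>simp add: bimult_pure l_distr module_hom_add[OF p]\<close>)
  show "bimult (c \<odot>\<^bsub>A\<^esub> a) X b = c \<odot>\<^bsub>A2\<^esub> bimult a X b"
    if a: "c \<in> carrier K" "a \<in> carrier A" for a c
    by (rule A2_hom_eqI[OF module_tensor_square _ _ _ X],
        (intro bimult_hom A2.module_hom_smult_fun b a smult_closed)+)
       (use a b in \<open>simp add: bimult_pure smult_mult_left module_hom_smult[OF p]\<close>)
qed

lemma bimult_hom_right:
  assumes X: "X \<in> carrier A2" and a: "a \<in> carrier A"
  shows "(\<lambda>b. bimult a X b) \<in> module_hom K A A2"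
proof (rule module_homI)
  interpret A2: module K A2 by (rule module_tensor_square)
  note p = bilinear_mapD(1)[OF pure2_bilinear]
  show "bimult a X b \<in> carrier A2" if "b \<in> carrier A" for b
    using assms that by simp
  show "bimult a X (b \<oplus>\<^bsub>A\<^esub> b') = bimult a X b \<oplus>\<^bsub>A2\<^esub> bimult a X b'"
    if b: "b \<in> carrier A" "b' \<in> carrier A" for b b'
    by (rule A2_hom_eqI[OF module_tensor_square _ _ _ X],
        (intro bimult_hom A2.module_hom_add_fun b a M.a_closed)+)
       (use a b in \<open>simp add: bimult_pure r_distr module_hom_add[OF p]\<close>)
  show "bimult a X (c \<odot>\<^bsub>A\<^esub> b) = c \<odot>\<^bsub>A2\<^esub> bimult a X b"
    if b: "c \<in> carrier K" "b \<in> carrier A" for b c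
    by (rule A2_hom_eqI[OF module_tensor_square _ _ _ X],
        (intro bimult_hom A2.module_hom_smult_fun b a smult_closed)+)
       (use a b in \<open>simp add: bimult_pure smult_mult_right module_hom_smult[OF p]\<close>)
qed

lemma bimult_one: "X \<in> carrier A2 \<Longrightarrow> bimult \<one>\<^bsub>A\<^esub> X \<one>\<^bsub>A\<^esub> = X"
  by (rule A2_hom_eqI[OF module_tensor_square bimult_hom module_hom_id])
     (auto simp: bimult_pure)

text \<open>A bimodule splitting \<sigma> is determined by E = \<sigma>(1), since \<sigma>(a) = a E
  = E a; conversely x is sent to x E, which is right linear because E commutes with
  \<open>A\<close>. An element, unlike a splitting, is easily transported to the induced
  algebra.\<close>

lemma separable_algebra_iff:
  "separable_algebra K A \<longleftrightarrow>
    (\<exists>E\<in>carrier A2. mult_map K A E = \<one>\<^bsub>A\<^esub> \<and>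
      (\<forall>a\<in>carrier A. bimult a E \<one>\<^bsub>A\<^esub> = bimult \<one>\<^bsub>A\<^esub> E a))"
proof
  assume "separable_algebra K A"
  then obtain \<sigma> where \<sigma>: "\<sigma> \<in> module_hom K A A2"
    and bi: "\<And>a x b. \<lbrakk>a \<in> carrier A; x \<in> carrier A; b \<in> carrier A\<rbrakk>
      \<Longrightarrow> \<sigma> (a \<otimes>\<^bsub>A\<^esub> x \<otimes>\<^bsub>A\<^esub> b) = bimult a (\<sigma> x) b"
    and m: "\<And>x. x \<in> carrier A \<Longrightarrow> mult_map K A (\<sigma> x) = x"
    unfolding separable_algebra_def by blast
  show "\<exists>E\<in>carrier A2. mult_map K A E = \<one>\<^bsub>A\<^esub> \<and>
      (\<forall>a\<in>carrier A. bimult a E \<one>\<^bsub>A\<^esub> = bimult \<one>\<^bsub>A\<^esub> E a)"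
  proof (intro bexI conjI ballI)
    show "\<sigma> \<one>\<^bsub>A\<^esub> \<in> carrier A2" by (rule module_hom_mem[OF \<sigma>]) simp
    show "mult_map K A (\<sigma> \<one>\<^bsub>A\<^esub>) = \<one>\<^bsub>A\<^esub>" by (rule m) simp
    show "bimult a (\<sigma> \<one>\<^bsub>A\<^esub>) \<one>\<^bsub>A\<^esub> = bimult \<one>\<^bsub>A\<^esub> (\<sigma> \<one>\<^bsub>A\<^esub>) a" if "a \<in> carrier A" for a
      using that bi[of a "\<one>\<^bsub>A\<^esub>" "\<one>\<^bsub>A\<^esub>"] bi[of "\<one>\<^bsub>A\<^esub>" "\<one>\<^bsub>A\<^esub>" a] by simp
  qed
next
  assume "\<exists>E\<in>carrier A2. mult_map K A E = \<one>\<^bsub>A\<^esub> \<and>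
      (\<forall>a\<in>carrier A. bimult a E \<one>\<^bsub>A\<^esub> = bimult \<one>\<^bsub>A\<^esub> E a)"
  then obtain E where E: "E \<in> carrier A2" "mult_map K A E = \<one>\<^bsub>A\<^esub>"
    and cent: "\<And>a. a \<in> carrier A \<Longrightarrow> bimult a E \<one>\<^bsub>A\<^esub> = bimult \<one>\<^bsub>A\<^esub> E a"
    by blast
  show "separable_algebra K A"
    unfolding separable_algebra_def
  proof (intro conjI bexI[of _ "\<lambda>x. bimult x E \<one>\<^bsub>A\<^esub>"] ballI)
    show "assoc_algebra K A" by (rule assoc_algebra_axioms)
    show "(\<lambda>x. bimult x E \<one>\<^bsub>A\<^esub>) \<in> module_hom K A A2"
      using E by (intro bimult_hom_left) auto
    show "mult_map K A (bimult x E \<one>\<^bsub>A\<^esub>) = x" if "x \<in> carrier A" for x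
      using E that by (simp add: mult_map_bimult)
    show "bimult (a \<otimes>\<^bsub>A\<^esub> x \<otimes>\<^bsub>A\<^esub> b) E \<one>\<^bsub>A\<^esub> = bimult a (bimult x E \<one>\<^bsub>A\<^esub>) b"
      if abx: "a \<in> carrier A" "x \<in> carrier A" "b \<in> carrier A" for a x b
    proof -
      \<comment> \<open>The factor b passes through E to the left, where it joins a x.\<close>
      have "bimult a (bimult x E \<one>\<^bsub>A\<^esub>) b = bimult (a \<otimes>\<^bsub>A\<^esub> x) (bimult \<one>\<^bsub>A\<^esub> E b) \<one>\<^bsub>A\<^esub>"
        using abx E by (simp add: bimult_bimult)
      also have "\<dots> = bimult (a \<otimes>\<^bsub>A\<^esub> x) (bimult b E \<one>\<^bsub>A\<^esub>) \<one>\<^bsub>A\<^esub>"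
        using abx by (simp add: cent)
      also have "\<dots> = bimult (a \<otimes>\<^bsub>A\<^esub> x \<otimes>\<^bsub>A\<^esub> b) E \<one>\<^bsub>A\<^esub>"
        using abx E by (simp add: bimult_bimult)
      finally show ?thesis ..
    qed
  qed
qed

end

section \<open>Crossed modules and transversals\<close>

context crossed_module
begin

lemma act_auto: "g \<in> carrier G1 \<Longrightarrow> act g \<in> auto G2"
  using act_hom by (auto simp: hom_def AutoGroup_def)

lemma act_closed [simp, intro]: "\<lbrakk>g \<in> carrier G1; x \<in> carrier G2\<rbrakk> \<Longrightarrow> act g x \<in> carrier G2"
  using act_auto by (auto simp: auto_def hom_def)

lemma act_mult:
  "\<lbrakk>g \<in> carrier G1; x \<in> carrier G2; y \<in> carrier G2\<rbrakk> \<Longrightarrow>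
    act g (x \<otimes>\<^bsub>G2\<^esub> y) = act g x \<otimes>\<^bsub>G2\<^esub> act g y"
  using act_auto by (auto simp: auto_def hom_def)

lemma act_inj: "g \<in> carrier G1 \<Longrightarrow> inj_on (act g) (carrier G2)"
  using act_auto by (auto simp: auto_def Bij_def bij_betw_def)

lemma act_act:
  assumes "g \<in> carrier G1" "h \<in> carrier G1" "x \<in> carrier G2"
  shows "act (g \<otimes>\<^bsub>G1\<^esub> h) x = act g (act h x)"
proof -
  have "act (g \<otimes>\<^bsub>G1\<^esub> h) = act g \<otimes>\<^bsub>AutoGroup G2\<^esub> act h"
    using act_hom assms by (auto simp: hom_def)
  then show ?thesis
    using assms act_auto by (auto simp: AutoGroup_def BijGroup_def auto_def compose_def)
qed

text \<open>By multiplicativity the map is idempotent, and an injective idempotent map is the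
  identity. The same argument gives \<open>\<omega>1_one\<close> below.\<close>

lemma act_one [simp]:
  assumes "x \<in> carrier G2" shows "act \<one>\<^bsub>G1\<^esub> x = x"
proof -
  have "act \<one>\<^bsub>G1\<^esub> (act \<one>\<^bsub>G1\<^esub> x) = act \<one>\<^bsub>G1\<^esub> x"
    using act_act[of "\<one>\<^bsub>G1\<^esub>" "\<one>\<^bsub>G1\<^esub>" x] assms by simp
  then show ?thesis using act_inj[of "\<one>\<^bsub>G1\<^esub>"] assms by (auto dest: inj_onD)
qed

lemma act_inv_act [simp]:
  "\<lbrakk>g \<in> carrier G1; x \<in> carrier G2\<rbrakk> \<Longrightarrow> act (inv\<^bsub>G1\<^esub> g) (act g x) = x"
  by (simp add: act_act[symmetric])

lemma act_act_inv [simp]: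
  "\<lbrakk>g \<in> carrier G1; x \<in> carrier G2\<rbrakk> \<Longrightarrow> act g (act (inv\<^bsub>G1\<^esub> g) x) = x"
  by (simp add: act_act[symmetric])

lemma act_group_hom: "g \<in> carrier G1 \<Longrightarrow> group_hom G2 G2 (act g)"
  using act_auto by (auto simp: group_hom_def group_hom_axioms_def auto_def G2.group_axioms)

lemma act_inv:
  "\<lbrakk>g \<in> carrier G1; x \<in> carrier G2\<rbrakk> \<Longrightarrow> act g (inv\<^bsub>G2\<^esub> x) = inv\<^bsub>G2\<^esub> (act g x)"
  using group_hom.hom_inv[OF act_group_hom] by simp

lemma act_unit [simp]: "g \<in> carrier G1 \<Longrightarrow> act g \<one>\<^bsub>G2\<^esub> = \<one>\<^bsub>G2\<^esub>"
  using group_hom.hom_one[OF act_group_hom] by simp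

lemma bd_group_hom: "group_hom G2 G1 bd"
  using bd_hom by (simp add: group_hom_def group_hom_axioms_def G1.group_axioms G2.group_axioms)

lemma bd_closed [simp, intro]: "x \<in> carrier G2 \<Longrightarrow> bd x \<in> carrier G1"
  using group_hom.hom_closed[OF bd_group_hom] .

lemma bd_mult: "\<lbrakk>x \<in> carrier G2; y \<in> carrier G2\<rbrakk> \<Longrightarrow> bd (x \<otimes>\<^bsub>G2\<^esub> y) = bd x \<otimes>\<^bsub>G1\<^esub> bd y"
  using group_hom.hom_mult[OF bd_group_hom] .

lemma bd_inv: "x \<in> carrier G2 \<Longrightarrow> bd (inv\<^bsub>G2\<^esub> x) = inv\<^bsub>G1\<^esub> (bd x)"
  using group_hom.hom_inv[OF bd_group_hom] .

lemma bd_one [simp]: "bd \<one>\<^bsub>G2\<^esub> = \<one>\<^bsub>G1\<^esub>"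
  using group_hom.hom_one[OF bd_group_hom] .

end

context crossed_module_algebra
begin

lemma H1_carrier: "h \<in> H1 \<Longrightarrow> h \<in> carrier G1"
  using subgroup.subset[OF subgroup_H1] by blast

lemma H2_carrier: "z \<in> H2 \<Longrightarrow> z \<in> carrier G2"
  using subgroup.subset[OF subgroup_H2] by blast

lemma \<omega>1_mem: "h \<in> H1 \<Longrightarrow> \<omega>1 h \<in> Bij (carrier A) \<inter> ring_hom A A \<inter> module_hom K A A"
  using \<omega>1_hom by (auto simp: hom_def alg_aut_group_def)

lemma \<omega>1_module_hom: "h \<in> H1 \<Longrightarrow> \<omega>1 h \<in> module_hom K A A"
  using \<omega>1_mem by blast

lemma \<omega>1_closed [simp, intro]: "\<lbrakk>h \<in> H1; a \<in> carrier A\<rbrakk> \<Longrightarrow> \<omega>1 h a \<in> carrier A"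
  by (rule module_hom_mem[OF \<omega>1_module_hom])

lemma \<omega>1_ring_mult:
  "\<lbrakk>h \<in> H1; a \<in> carrier A; b \<in> carrier A\<rbrakk> \<Longrightarrow> \<omega>1 h (a \<otimes>\<^bsub>A\<^esub> b) = \<omega>1 h a \<otimes>\<^bsub>A\<^esub> \<omega>1 h b"
  using ring_hom_mult[of "\<omega>1 h" A A] \<omega>1_mem[of h] by simp

lemma \<omega>1_ring_one [simp]: "h \<in> H1 \<Longrightarrow> \<omega>1 h \<one>\<^bsub>A\<^esub> = \<one>\<^bsub>A\<^esub>"
  using ring_hom_one[of "\<omega>1 h" A A] \<omega>1_mem[of h] by simp

lemma \<omega>1_inj: "h \<in> H1 \<Longrightarrow> inj_on (\<omega>1 h) (carrier A)"
  using \<omega>1_mem[of h] by (auto simp: Bij_def bij_betw_def)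

lemma \<omega>1_\<omega>1:
  assumes "g \<in> H1" "h \<in> H1" "a \<in> carrier A"
  shows "\<omega>1 (g \<otimes>\<^bsub>G1\<^esub> h) a = \<omega>1 g (\<omega>1 h a)"
proof -
  have "\<omega>1 (g \<otimes>\<^bsub>G1\<^esub> h) = \<omega>1 g \<otimes>\<^bsub>alg_aut_group K A\<^esub> \<omega>1 h"
    using \<omega>1_hom assms by (auto simp: hom_def)
  then show ?thesis
    using assms \<omega>1_mem[of g] \<omega>1_mem[of h] by (auto simp: alg_aut_group_def BijGroup_def compose_def)
qed

lemma \<omega>1_one [simp]:
  assumes "a \<in> carrier A" shows "\<omega>1 \<one>\<^bsub>G1\<^esub> a = a"
proof -
  have 1: "\<one>\<^bsub>G1\<^esub> \<in> H1" by (rule subgroup.one_closed[OF subgroup_H1])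
  have "\<omega>1 \<one>\<^bsub>G1\<^esub> (\<omega>1 \<one>\<^bsub>G1\<^esub> a) = \<omega>1 \<one>\<^bsub>G1\<^esub> a"
    using \<omega>1_\<omega>1[OF 1 1 assms] by simp
  then show ?thesis using \<omega>1_inj[OF 1] assms 1 by (auto dest: inj_onD)
qed

lemma \<omega>2_Units: "z \<in> H2 \<Longrightarrow> \<omega>2 z \<in> Units A"
  using \<omega>2_hom by (auto simp: hom_def units_of_def)

lemma \<omega>2_closed [simp, intro]: "z \<in> H2 \<Longrightarrow> \<omega>2 z \<in> carrier A"
  using \<omega>2_Units by (auto simp: Units_def)

lemma \<omega>2_mult: "\<lbrakk>y \<in> H2; z \<in> H2\<rbrakk> \<Longrightarrow> \<omega>2 (y \<otimes>\<^bsub>G2\<^esub> z) = \<omega>2 y \<otimes>\<^bsub>A\<^esub> \<omega>2 z"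
  using \<omega>2_hom by (auto simp: hom_def units_of_def)

lemma \<omega>2_one [simp]: "\<omega>2 \<one>\<^bsub>G2\<^esub> = \<one>\<^bsub>A\<^esub>"
proof -
  have 1: "\<one>\<^bsub>G2\<^esub> \<in> H2" by (rule subgroup.one_closed[OF subgroup_H2])
  have "\<omega>2 \<one>\<^bsub>G2\<^esub> \<otimes>\<^bsub>A\<^esub> \<omega>2 \<one>\<^bsub>G2\<^esub> = \<omega>2 \<one>\<^bsub>G2\<^esub> \<otimes>\<^bsub>A\<^esub> \<one>\<^bsub>A\<^esub>"
    using \<omega>2_mult[OF 1 1] 1 \<omega>2_closed by simp
  then show ?thesis using Units_l_cancel[OF \<omega>2_Units[OF 1]] 1 by blast
qed

lemma H2_inv_closed [simp, intro]: "z \<in> H2 \<Longrightarrow> inv\<^bsub>G2\<^esub> z \<in> H2"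
  by (rule subgroup.m_inv_closed[OF subgroup_H2])

lemma \<omega>2_r_inv: "z \<in> H2 \<Longrightarrow> \<omega>2 z \<otimes>\<^bsub>A\<^esub> \<omega>2 (inv\<^bsub>G2\<^esub> z) = \<one>\<^bsub>A\<^esub>"
  by (simp add: \<omega>2_mult[symmetric] H2_carrier)

lemma \<omega>2_l_inv: "z \<in> H2 \<Longrightarrow> \<omega>2 (inv\<^bsub>G2\<^esub> z) \<otimes>\<^bsub>A\<^esub> \<omega>2 z = \<one>\<^bsub>A\<^esub>"
  by (simp add: \<omega>2_mult[symmetric] H2_carrier)

lemma \<omega>2_inv: "z \<in> H2 \<Longrightarrow> inv\<^bsub>A\<^esub> (\<omega>2 z) = \<omega>2 (inv\<^bsub>G2\<^esub> z)"
  by (rule inv_char) (auto simp: \<omega>2_r_inv \<omega>2_l_inv)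

lemma bd_H2_mem: "z \<in> H2 \<Longrightarrow> bd z \<in> H1"
  using bd_H2 by blast

text \<open>The automorphism attached to \<open>bd (inv z)\<close> is conjugation by the inverse of
  \<open>\<omega>2 z\<close>. Thus a unit to the left of a twisted coefficient becomes a unit to the
  right of the untwisted one.\<close>

lemma \<omega>2_\<omega>1_bd_inv:
  assumes "z \<in> H2" "a \<in> carrier A"
  shows "\<omega>2 z \<otimes>\<^bsub>A\<^esub> \<omega>1 (bd (inv\<^bsub>G2\<^esub> z)) a = a \<otimes>\<^bsub>A\<^esub> \<omega>2 z"
proof -
  have "\<omega>2 z \<otimes>\<^bsub>A\<^esub> \<omega>1 (bd (inv\<^bsub>G2\<^esub> z)) a
      = (\<omega>2 z \<otimes>\<^bsub>A\<^esub> \<omega>2 (inv\<^bsub>G2\<^esub> z)) \<otimes>\<^bsub>A\<^esub> a \<otimes>\<^bsub>A\<^esub> \<omega>2 z"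
    using assms by (simp add: \<omega>1_bd \<omega>2_inv H2_carrier m_assoc del: \<omega>2_mult)
  then show ?thesis using assms by (simp add: \<omega>2_r_inv)
qed

end

section \<open>Targets and twists of arrows\<close>

context induction_setup
begin

lemma T_carrier: "t \<in> T \<Longrightarrow> t \<in> carrier G1"
  using transversal by (auto simp: left_transversal_def)

lemma coset_rep_unique:
  assumes "g \<in> carrier G1"
  shows "\<exists>!t. t \<in> T \<and> t \<in> g <#\<^bsub>G1\<^esub> H1"
  using transversal assms by (auto simp: left_transversal_def LCOSETS_def)

lemma coset_rep_mem:
  assumes "g \<in> carrier G1"
  shows "coset_rep g \<in> T" "coset_rep g \<in> g <#\<^bsub>G1\<^esub> H1"
  using theI'[OF coset_rep_unique[OF assms]] by (auto simp: coset_rep_def)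

lemma coset_rep_H1:
  assumes "g \<in> carrier G1"
  shows "inv\<^bsub>G1\<^esub> g \<otimes>\<^bsub>G1\<^esub> coset_rep g \<in> H1"
  using subgroup.lcos_module_imp[OF subgroup_H1 G1.group_axioms assms coset_rep_mem(2)[OF assms]] .

lemma coset_rep_eqI:
  assumes "g \<in> carrier G1" "t \<in> T" "inv\<^bsub>G1\<^esub> g \<otimes>\<^bsub>G1\<^esub> t \<in> H1"
  shows "coset_rep g = t"
proof -
  have "t = g \<otimes>\<^bsub>G1\<^esub> (inv\<^bsub>G1\<^esub> g \<otimes>\<^bsub>G1\<^esub> t)"
    using assms T_carrier by (simp add: G1.m_assoc[symmetric])
  then have "t \<in> g <#\<^bsub>G1\<^esub> H1" using assms(3) unfolding l_coset_def by blast
  then show ?thesis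
    using coset_rep_unique[OF assms(1)] coset_rep_mem[OF assms(1)] assms(2) by blast
qed

text \<open>The element \<open>[x \<otimes> a]\<close> at \<open>t\<close> behaves like an arrow from \<open>t\<close> to \<open>tgt t x\<close>; composing
  with it twists the left factor by \<open>twist t x\<close>.\<close>

definition tgt :: "'g \<Rightarrow> 'h \<Rightarrow> 'g" where
  "tgt t x = coset_rep (bd x \<otimes>\<^bsub>G1\<^esub> t)"

definition twist :: "'g \<Rightarrow> 'h \<Rightarrow> 'g" where
  "twist t x = inv\<^bsub>G1\<^esub> t \<otimes>\<^bsub>G1\<^esub> bd (inv\<^bsub>G2\<^esub> x) \<otimes>\<^bsub>G1\<^esub> tgt t x"

lemma tgt_T [simp, intro]: "\<lbrakk>t \<in> T; x \<in> carrier G2\<rbrakk> \<Longrightarrow> tgt t x \<in> T"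
  by (simp add: tgt_def coset_rep_mem T_carrier)

text \<open>The twist is the quotient of two elements of one coset of \<open>H1\<close>: it carries
  the product of \<open>bd x\<close> and t to the representative \<open>tgt t x\<close>.\<close>

lemma twist_H1 [simp, intro]:
  assumes "t \<in> T" "x \<in> carrier G2" shows "twist t x \<in> H1"
  using coset_rep_H1[of "bd x \<otimes>\<^bsub>G1\<^esub> t"] assms
  by (simp add: twist_def tgt_def T_carrier bd_inv G1.inv_mult_group)

lemma tgt_eqI:
  assumes "t \<in> T" "x \<in> carrier G2" "s \<in> T"
    and "inv\<^bsub>G1\<^esub> t \<otimes>\<^bsub>G1\<^esub> bd (inv\<^bsub>G2\<^esub> x) \<otimes>\<^bsub>G1\<^esub> s \<in> H1"
  shows "tgt t x = s"
  unfolding tgt_def using assms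
  by (intro coset_rep_eqI) (auto simp: T_carrier bd_inv G1.inv_mult_group)

text \<open>\<open>tgt\<close> is the action of \<open>G2\<close> on the cosets of
  \<open>H1\<close>, read off on representatives, and \<open>twist\<close> is its cocycle. The
  cocycle rule is what makes the product of arrows associative.\<close>

lemma tgt_twist_mult:
  assumes t: "t \<in> T" and x: "x \<in> carrier G2" and y: "y \<in> carrier G2"
  shows "tgt t (y \<otimes>\<^bsub>G2\<^esub> x) = tgt (tgt t x) y"
    and "twist t (y \<otimes>\<^bsub>G2\<^esub> x) = twist t x \<otimes>\<^bsub>G1\<^esub> twist (tgt t x) y"
proof -
  let ?s = "tgt t x" and ?r = "tgt (tgt t x) y"
  have mem: "t \<in> carrier G1" "?s \<in> carrier G1" "?r \<in> carrier G1"
    using assms by (auto intro!: T_carrier)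
  have eq: "inv\<^bsub>G1\<^esub> t \<otimes>\<^bsub>G1\<^esub> bd (inv\<^bsub>G2\<^esub> (y \<otimes>\<^bsub>G2\<^esub> x)) \<otimes>\<^bsub>G1\<^esub> ?r = twist t x \<otimes>\<^bsub>G1\<^esub> twist ?s y"
  proof -
    \<comment> \<open>The intermediate representative cancels between the two twists.\<close>
    have "?s \<otimes>\<^bsub>G1\<^esub> (inv\<^bsub>G1\<^esub> ?s \<otimes>\<^bsub>G1\<^esub> w) = w" if "w \<in> carrier G1" for w
      using mem that by (simp add: G1.m_assoc[symmetric])
    then show ?thesis
      using mem x y by (simp add: twist_def G2.inv_mult_group bd_mult G1.m_assoc)
  qed
  show *: "tgt t (y \<otimes>\<^bsub>G2\<^esub> x) = ?r"
  proof (rule tgt_eqI)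
    show "inv\<^bsub>G1\<^esub> t \<otimes>\<^bsub>G1\<^esub> bd (inv\<^bsub>G2\<^esub> (y \<otimes>\<^bsub>G2\<^esub> x)) \<otimes>\<^bsub>G1\<^esub> ?r \<in> H1"
      unfolding eq using assms by (intro subgroup.m_closed[OF subgroup_H1]) auto
  qed (use assms in auto)
  show "twist t (y \<otimes>\<^bsub>G2\<^esub> x) = twist t x \<otimes>\<^bsub>G1\<^esub> twist ?s y"
    using eq by (simp add: twist_def *)
qed

text \<open>\<open>bd (act t z)\<close> is the conjugate of \<open>bd z\<close> by t, and
  \<open>bd z\<close> lies in \<open>H1\<close>, so it fixes the coset of t.\<close>

lemma tgt_act:
  assumes t: "t \<in> T" and z: "z \<in> H2"
  shows "tgt t (act t z) = t" "twist t (act t z) = bd (inv\<^bsub>G2\<^esub> z)"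
proof -
  have mem: "t \<in> carrier G1" "z \<in> carrier G2" using assms T_carrier H2_carrier by auto
  have eq: "inv\<^bsub>G1\<^esub> t \<otimes>\<^bsub>G1\<^esub> bd (inv\<^bsub>G2\<^esub> (act t z)) \<otimes>\<^bsub>G1\<^esub> t = bd (inv\<^bsub>G2\<^esub> z)"
    using mem by (simp add: act_inv[symmetric] bd_act G1.m_assoc)
      (simp add: G1.m_assoc[symmetric])
  show *: "tgt t (act t z) = t"
    using mem t z by (intro tgt_eqI) (auto simp: eq intro!: bd_H2_mem)
  show "twist t (act t z) = bd (inv\<^bsub>G2\<^esub> z)" using eq by (simp add: twist_def *)
qed

lemma tgt_one [simp]: "t \<in> T \<Longrightarrow> tgt t \<one>\<^bsub>G2\<^esub> = t"
  and twist_one [simp]: "t \<in> T \<Longrightarrow> twist t \<one>\<^bsub>G2\<^esub> = \<one>\<^bsub>G1\<^esub>"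
  using tgt_act[of t "\<one>\<^bsub>G2\<^esub>"] subgroup.one_closed[OF subgroup_H2] T_carrier by auto

lemma tgt_inv:
  assumes "t \<in> T" "x \<in> carrier G2"
  shows "tgt (tgt t x) (inv\<^bsub>G2\<^esub> x) = t"
  using tgt_twist_mult(1)[of t x "inv\<^bsub>G2\<^esub> x"] assms by simp

text \<open>Write s for the target and h for the twist. Then t h is \<open>bd (inv x)\<close> times
  s, and by the Peiffer identity \<open>bd (inv x)\<close> acts as conjugation by
  \<open>inv x\<close>. Moving an element of the subgroup at s across x to the subgroup at t is
  needed both for the product and for inverting cosets.\<close>

lemma act_tgt_conj:
  assumes t: "t \<in> T" and x: "x \<in> carrier G2" and z: "z \<in> carrier G2"
  shows "act (tgt t x) z \<otimes>\<^bsub>G2\<^esub> x = x \<otimes>\<^bsub>G2\<^esub> act t (act (twist t x) z)"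
proof -
  let ?s = "tgt t x"
  have mem: "t \<in> carrier G1" "?s \<in> carrier G1" using assms by (auto intro!: T_carrier)
  have "act t (act (twist t x) z) = act (t \<otimes>\<^bsub>G1\<^esub> twist t x) z"
    using mem t x z H1_carrier by (simp add: act_act)
  also have "t \<otimes>\<^bsub>G1\<^esub> twist t x = bd (inv\<^bsub>G2\<^esub> x) \<otimes>\<^bsub>G1\<^esub> ?s"
    using mem x by (simp add: twist_def G1.m_assoc[symmetric])
  also have "act \<dots> z = inv\<^bsub>G2\<^esub> x \<otimes>\<^bsub>G2\<^esub> act ?s z \<otimes>\<^bsub>G2\<^esub> x"
    using mem x z by (simp add: act_act peiffer)
  finally show ?thesis using mem x z by (simp add: G2.m_assoc[symmetric])
qed

end

section \<open>The induced algebra\<close>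

lemma group_algebra_simps:
  "carrier (group_algebra K G) = carrier (free_module K (carrier G))"
  "zero (group_algebra K G) = zero (free_module K (carrier G))"
  "add (group_algebra K G) = add (free_module K (carrier G))"
  "smult (group_algebra K G) = smult (free_module K (carrier G))"
  by (simp_all add: group_algebra_def)

lemma (in cring) module_group_algebra: "module R (group_algebra R G)"
proof -
  interpret F: module R "free_module R (carrier G)" by (rule module_free_module)
  show ?thesis
    by (rule module_criteria)
       (auto simp: group_algebra_simps F.smult_assoc1 F.smult_l_distr F.smult_r_distr F.M.a_ac is_cring
         intro: F.M.r_neg bexI[of _ "\<ominus>\<^bsub>free_module R (carrier G)\<^esub> v" for v])
qed

lemma module_hom_group_algebra:
  "module_hom K (group_algebra K G) V = module_hom K (free_module K (carrier G)) V"
  "module_hom K V (group_algebra K G) = module_hom K V (free_module K (carrier G))"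
  by (simp_all add: module_hom_def group_algebra_simps)

lemma bilinear_map_group_algebra:
  "bilinear_map K (group_algebra K G) N V = bilinear_map K (free_module K (carrier G)) N V"
  by (simp add: bilinear_map_def fun_eq_iff module_hom_group_algebra group_algebra_simps)

text \<open>In the convolution sum over w only w = x times \<open>inv y\<close> contributes.\<close>

lemma (in group) group_algebra_mult_delta:
  assumes R: "cring R" and f: "f \<in> carrier (free_module R (carrier G))" and y: "y \<in> carrier G"
  shows "f \<otimes>\<^bsub>group_algebra R G\<^esub> delta R y
    = (\<lambda>x. if x \<in> carrier G then f (x \<otimes> inv y) else \<zero>\<^bsub>R\<^esub>)"
proof
  interpret R: cring R by (rule R)
  fix x
  have fm: "f w \<in> carrier R" for w using f by (auto simp: free_module_simps)
  have fin: "finite (supp R f)" "supp R f \<subseteq> carrier G" using f by (auto simp: free_module_simps)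
  show "(f \<otimes>\<^bsub>group_algebra R G\<^esub> delta R y) x
    = (if x \<in> carrier G then f (x \<otimes> inv y) else \<zero>\<^bsub>R\<^esub>)"
  proof (cases "x \<in> carrier G")
    case x: True
    have iff: "inv w \<otimes> x = y \<longleftrightarrow> w = x \<otimes> inv y" if "w \<in> carrier G" for w
      using that x y by (metis inv_solve_left inv_solve_right inv_closed inv_inv m_closed)
    have "(f \<otimes>\<^bsub>group_algebra R G\<^esub> delta R y) x
      = (\<Oplus>\<^bsub>R\<^esub>w\<in>supp R f. f w \<otimes>\<^bsub>R\<^esub> delta R y (inv w \<otimes> x))"
      using x by (simp add: group_algebra_def)
    also have "\<dots> = (\<Oplus>\<^bsub>R\<^esub>w\<in>supp R f. if x \<otimes> inv y = w then f w else \<zero>\<^bsub>R\<^esub>)"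
    proof (rule R.finsum_cong')
      fix w assume w: "w \<in> supp R f"
      then show "f w \<otimes>\<^bsub>R\<^esub> delta R y (inv w \<otimes> x) = (if x \<otimes> inv y = w then f w else \<zero>\<^bsub>R\<^esub>)"
        using iff[of w] fin fm[of w] by (cases "w = x \<otimes> inv y") (auto simp: delta_def)
    qed (use fm in auto)
    also have "\<dots> = f (x \<otimes> inv y)"
    proof (cases "x \<otimes> inv y \<in> supp R f")
      case True
      then show ?thesis using fin fm by (subst R.add.finprod_singleton) auto
    next
      case False
      then have "(\<Oplus>\<^bsub>R\<^esub>w\<in>supp R f. if x \<otimes> inv y = w then f w else \<zero>\<^bsub>R\<^esub>) = (\<Oplus>\<^bsub>R\<^esub>w\<in>supp R f. \<zero>\<^bsub>R\<^esub>)"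
        by (intro R.finsum_cong') auto
      then show ?thesis using False by (simp add: supp_def)
    qed
    finally show ?thesis using x by simp
  qed (simp add: group_algebra_def)
qed

lemma (in group) group_algebra_delta_delta:
  assumes R: "cring R" and x: "x \<in> carrier G" and y: "y \<in> carrier G"
  shows "delta R x \<otimes>\<^bsub>group_algebra R G\<^esub> delta R y = delta R (x \<otimes> y)"
proof -
  have "w \<otimes> inv y = x \<longleftrightarrow> w = x \<otimes> y" if "w \<in> carrier G" for w
    using that x y by (metis inv_solve_right m_assoc r_inv l_inv r_one inv_closed)
  then show ?thesis
    using x y
    by (subst group_algebra_mult_delta[OF R cring.delta_closed[OF R x] y])
       (auto simp: delta_def fun_eq_iff)
qed

lemma (in group) group_algebra_mult_delta_hom:
  assumes R: "cring R" and y: "y \<in> carrier G"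
  shows "(\<lambda>f. f \<otimes>\<^bsub>group_algebra R G\<^esub> delta R y) \<in> module_hom R (group_algebra R G) (group_algebra R G)"
proof -
  interpret R: cring R by (rule R)
  let ?F = "free_module R (carrier G)"
  interpret F: module R ?F by (rule R.module_free_module)
  have "(\<lambda>f. f \<otimes>\<^bsub>group_algebra R G\<^esub> delta R y) \<in> module_hom R ?F ?F"
  proof (rule module_homI)
    fix f assume f: "f \<in> carrier ?F"
    have fm: "f w \<in> carrier R" for w using f by (auto simp: free_module_simps)
    show "f \<otimes>\<^bsub>group_algebra R G\<^esub> delta R y \<in> carrier ?F"
    proof -
      let ?g = "\<lambda>x. if x \<in> carrier G then f (x \<otimes> inv y) else \<zero>\<^bsub>R\<^esub>"
      \<comment> \<open>The support lies in the translate by y of the support of \<open>f\<close>,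
        hence is finite.\<close>
      have "supp R ?g \<subseteq> (\<lambda>w. w \<otimes> y) ` supp R f"
      proof
        fix x assume "x \<in> supp R ?g"
        then have "x \<in> carrier G" "x \<otimes> inv y \<in> supp R f" by (auto simp: supp_def split: if_splits)
        moreover from this have "x = (x \<otimes> inv y) \<otimes> y" using y by (simp add: m_assoc)
        ultimately show "x \<in> (\<lambda>w. w \<otimes> y) ` supp R f" by blast
      qed
      then have "finite (supp R ?g)"
        using f by (auto simp: free_module_simps intro: finite_subset)
      then show ?thesis
        using fm by (auto simp: group_algebra_mult_delta[OF R f y] free_module_simps supp_def)
    qed
    show "(c \<odot>\<^bsub>?F\<^esub> f) \<otimes>\<^bsub>group_algebra R G\<^esub> delta R y = c \<odot>\<^bsub>?F\<^esub> (f \<otimes>\<^bsub>group_algebra R G\<^esub> delta R y)"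
      if c: "c \<in> carrier R" for c
      using c by (simp add: group_algebra_mult_delta[OF R f y]
          group_algebra_mult_delta[OF R F.smult_closed[OF c f] y])
        (auto simp: free_module_simps)
    show "(f \<oplus>\<^bsub>?F\<^esub> g) \<otimes>\<^bsub>group_algebra R G\<^esub> delta R y
        = (f \<otimes>\<^bsub>group_algebra R G\<^esub> delta R y) \<oplus>\<^bsub>?F\<^esub> (g \<otimes>\<^bsub>group_algebra R G\<^esub> delta R y)"
      if g: "g \<in> carrier ?F" for g
      by (simp add: group_algebra_mult_delta[OF R f y] group_algebra_mult_delta[OF R g y]
          group_algebra_mult_delta[OF R F.a_closed[OF f g] y])
        (auto simp: free_module_simps)
  qed
  then show ?thesis by (simp add: module_hom_group_algebra)
qed

lemma (in cring) free_module_hom_eqI: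
  assumes V: "module R V" and f: "f \<in> module_hom R (free_module R S) V"
    and g: "g \<in> module_hom R (free_module R S) V"
    and eq: "\<And>x. x \<in> S \<Longrightarrow> f (delta R x) = g (delta R x)" and \<xi>: "\<xi> \<in> carrier (free_module R S)"
  shows "f \<xi> = g \<xi>"
proof -
  interpret F: module R "free_module R S" by (rule module_free_module)
  from \<xi> show ?thesis
  proof (induction rule: free_module_induct)
    case zero
    then show ?case
      using F.module_hom_zero[OF V f] F.module_hom_zero[OF V g] by (simp add: free_module_simps)
  next
    case (smult_delta c x)
    then show ?case
      using module_hom_smult[OF f, of c "delta R x"] module_hom_smult[OF g, of c "delta R x"]
      by (simp add: delta_closed eq free_module_simps(4))
  next
    case (add f' g')
    then show ?case
      using module_hom_add[OF f, of f' g'] module_hom_add[OF g, of f' g']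
      by (simp add: free_module_simps(3))
  qed
qed

section \<open>The factors of the induced algebra and maps out of them\<close>

context induction_setup
begin

lemma module_KG2: "module K KG2"
  by (rule R.module_group_algebra)

lemma delta_KG2 [simp, intro]: "x \<in> carrier G2 \<Longrightarrow> delta K x \<in> carrier KG2"
  by (simp add: group_algebra_simps R.delta_closed)

lemma KH2_carrier: "carrier KH2 = carrier (free_module K H2)"
  by (simp add: group_algebra_simps)

lemma KG2_ract_lin_ext:
  "KG2_ract t \<xi> \<eta> = lin_ext K KG2 (\<lambda>z. \<xi> \<otimes>\<^bsub>KG2\<^esub> delta K (act t z)) \<eta>"
  by (simp add: KG2_ract_def lin_ext_def)

lemma A_lact_lin_ext: "A_lact \<eta> a = lin_ext K A (\<lambda>z. \<omega>2 z \<otimes>\<^bsub>A\<^esub> a) \<eta>"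
  by (simp add: A_lact_def lin_ext_def)

lemma KG2_mult_delta_closed:
  "\<lbrakk>\<xi> \<in> carrier KG2; x \<in> carrier G2\<rbrakk> \<Longrightarrow> \<xi> \<otimes>\<^bsub>KG2\<^esub> delta K x \<in> carrier KG2"
  by (rule module_hom_mem[OF G2.group_algebra_mult_delta_hom[OF R.is_cring]])

lemma ract_term_closed:
  "\<lbrakk>t \<in> T; \<xi> \<in> carrier KG2; z \<in> H2\<rbrakk> \<Longrightarrow> \<xi> \<otimes>\<^bsub>KG2\<^esub> delta K (act t z) \<in> carrier KG2"
  by (intro KG2_mult_delta_closed act_closed T_carrier H2_carrier)

lemma KG2_ract_hom:
  assumes "t \<in> T" "\<xi> \<in> carrier KG2"
  shows "KG2_ract t \<xi> \<in> module_hom K (free_module K H2) KG2"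
proof -
  interpret KG2: module K KG2 by (rule module_KG2)
  have "lin_ext K KG2 (\<lambda>z. \<xi> \<otimes>\<^bsub>KG2\<^esub> delta K (act t z)) \<in> module_hom K (free_module K H2) KG2"
    using assms by (intro KG2.lin_ext_hom ract_term_closed)
  then show ?thesis by (simp add: KG2_ract_lin_ext[abs_def])
qed

lemma KG2_ract_hom_left:
  assumes t: "t \<in> T" and \<eta>: "\<eta> \<in> carrier (free_module K H2)"
  shows "(\<lambda>\<xi>. KG2_ract t \<xi> \<eta>) \<in> module_hom K KG2 KG2"
proof -
  interpret KG2: module K KG2 by (rule module_KG2)
  show ?thesis unfolding KG2_ract_lin_ext
    using t by (intro KG2.lin_ext_fun_hom[OF module_KG2 \<eta>] G2.group_algebra_mult_delta_hom[OF R.is_cring]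
      act_closed T_carrier H2_carrier)
qed

lemma KG2_ract_delta:
  assumes "t \<in> T" "x \<in> carrier G2" "z \<in> H2"
  shows "KG2_ract t (delta K x) (delta K z) = delta K (x \<otimes>\<^bsub>G2\<^esub> act t z)"
proof -
  interpret KG2: module K KG2 by (rule module_KG2)
  have "KG2_ract t (delta K x) (delta K z) = delta K x \<otimes>\<^bsub>KG2\<^esub> delta K (act t z)"
    unfolding KG2_ract_lin_ext
    using assms by (intro KG2.lin_ext_delta[where S = H2] ract_term_closed) auto
  then show ?thesis
    using assms by (simp add: G2.group_algebra_delta_delta[OF R.is_cring] T_carrier H2_carrier)
qed

lemma A_lact_hom: "a \<in> carrier A \<Longrightarrow> (\<lambda>\<eta>. A_lact \<eta> a) \<in> module_hom K (free_module K H2) A"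
  unfolding A_lact_lin_ext by (intro lin_ext_hom) auto

lemma A_lact_hom_right:
  "\<eta> \<in> carrier (free_module K H2) \<Longrightarrow> A_lact \<eta> \<in> module_hom K A A"
  unfolding A_lact_lin_ext[abs_def]
  by (intro lin_ext_fun_hom[OF module_axioms] mult_hom_right) auto

lemma A_lact_delta:
  "\<lbrakk>z \<in> H2; a \<in> carrier A\<rbrakk> \<Longrightarrow> A_lact (delta K z) a = \<omega>2 z \<otimes>\<^bsub>A\<^esub> a"
  unfolding A_lact_lin_ext by (intro lin_ext_delta[where S = H2]) auto

lemma tensor_data_ind:
  assumes t: "t \<in> T"
  shows "tensor_data K KG2 A KH2 (KG2_ract t) A_lact"
proof (intro tensor_data.intro tensor_data_axioms.intro module_KG2 module_axioms)
  show "KG2_ract t \<xi> \<eta> \<in> carrier KG2" if "\<xi> \<in> carrier KG2" "\<eta> \<in> carrier KH2" for \<xi> \<eta>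
    using that module_hom_mem[OF KG2_ract_hom[OF t]] by (simp add: KH2_carrier)
  show "A_lact \<eta> a \<in> carrier A" if "\<eta> \<in> carrier KH2" "a \<in> carrier A" for \<eta> a
    using that module_hom_mem[OF A_lact_hom] by (simp add: KH2_carrier)
qed

lemma module_ind_factor:
  assumes "t \<in> T" shows "module K (ind_factor t)"
proof -
  interpret D: tensor_data K KG2 A KH2 "KG2_ract t" A_lact
    using assms by (rule tensor_data_ind)
  show ?thesis unfolding ind_factor_def by (rule D.TP.module_axioms)
qed

lemma ind_pure_bilinear: "t \<in> T \<Longrightarrow> bilinear_map K KG2 A (ind_factor t) (ind_pure t)"
  unfolding ind_factor_def ind_pure_def by (rule tensor_data.pure_bilinear[OF tensor_data_ind])

definition arrow :: "'g \<Rightarrow> 'h \<Rightarrow> 'a \<Rightarrow> (('h \<Rightarrow> 'k) \<times> 'a \<Rightarrow> 'k) set" where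
  "arrow t x a = ind_pure t (delta K x) a"

lemma arrow_hom: "\<lbrakk>t \<in> T; x \<in> carrier G2\<rbrakk> \<Longrightarrow> arrow t x \<in> module_hom K A (ind_factor t)"
  unfolding arrow_def[abs_def] by (intro bilinear_mapD(1)[OF ind_pure_bilinear]) auto

lemma arrow_closed [simp, intro]:
  "\<lbrakk>t \<in> T; x \<in> carrier G2; a \<in> carrier A\<rbrakk> \<Longrightarrow> arrow t x a \<in> carrier (ind_factor t)"
  by (rule module_hom_mem[OF arrow_hom])

lemma arrow_act:
  assumes "t \<in> T" "x \<in> carrier G2" "z \<in> H2" "a \<in> carrier A"
  shows "arrow t (x \<otimes>\<^bsub>G2\<^esub> act t z) a = arrow t x (\<omega>2 z \<otimes>\<^bsub>A\<^esub> a)"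
  using tensor_data.pure_balanced[OF tensor_data_ind, of t "delta K x" "delta K z" a] assms
  by (simp add: arrow_def ind_pure_def KG2_ract_delta A_lact_delta KH2_carrier R.delta_closed)

text \<open>Pure tensors span the factor, and by linearity their first entry may be taken to be a
  group element. Most identities about the product are reduced to arrows in this way.\<close>

lemma ind_factor_hom_eqI:
  assumes t: "t \<in> T" and V: "module K V"
    and f: "f \<in> module_hom K (ind_factor t) V" and g: "g \<in> module_hom K (ind_factor t) V"
    and eq: "\<And>x a. \<lbrakk>x \<in> carrier G2; a \<in> carrier A\<rbrakk> \<Longrightarrow> f (arrow t x a) = g (arrow t x a)"
    and X: "X \<in> carrier (ind_factor t)"
  shows "f X = g X"
proof -
  have "f (ind_pure t \<xi> a) = g (ind_pure t \<xi> a)" if \<xi>: "\<xi> \<in> carrier KG2" and a: "a \<in> carrier A" for \<xi> a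
  proof (rule R.free_module_hom_eqI[OF V, where S = "carrier G2"])
    note p = bilinear_mapD(2)[OF ind_pure_bilinear[OF t] a]
    show "(\<lambda>\<xi>. f (ind_pure t \<xi> a)) \<in> module_hom K (free_module K (carrier G2)) V"
      using module_hom_comp[OF p f] by (simp add: module_hom_group_algebra)
    show "(\<lambda>\<xi>. g (ind_pure t \<xi> a)) \<in> module_hom K (free_module K (carrier G2)) V"
      using module_hom_comp[OF p g] by (simp add: module_hom_group_algebra)
    show "\<xi> \<in> carrier (free_module K (carrier G2))" using \<xi> by (simp add: group_algebra_simps)
  qed (use eq a in \<open>auto simp: arrow_def\<close>)
  then show ?thesis
    using tensor_data.TP_hom_eqI[OF tensor_data_ind[OF t] V, folded ind_factor_def ind_pure_def,
        OF f g _ X] by blast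
qed

context
  fixes t and V :: "('k, 'z, 'y) module_scheme" and \<phi>
  assumes t: "t \<in> T" and V: "module K V" and \<phi>: "bilinear_map K KG2 A V \<phi>"
    and bal: "\<And>x z a. \<lbrakk>x \<in> carrier G2; z \<in> H2; a \<in> carrier A\<rbrakk> \<Longrightarrow>
      \<phi> (delta K (x \<otimes>\<^bsub>G2\<^esub> act t z)) a = \<phi> (delta K x) (\<omega>2 z \<otimes>\<^bsub>A\<^esub> a)"
begin

text \<open>Balancing is known for group elements x and z. Both sides are linear in
  \<open>\<xi>\<close> and, for \<open>\<xi>\<close> a basis element, in \<open>\<eta>\<close>, so
  it extends to the group algebras.\<close>

lemma ind_balanced:
  assumes \<xi>: "\<xi> \<in> carrier KG2" and \<eta>: "\<eta> \<in> carrier KH2" and a: "a \<in> carrier A"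
  shows "\<phi> (KG2_ract t \<xi> \<eta>) a = \<phi> \<xi> (A_lact \<eta> a)"
proof (rule R.free_module_hom_eqI[OF V, where S = "carrier G2" and \<xi> = \<xi>])
  note \<eta>' = \<eta>[unfolded KH2_carrier]
  show "(\<lambda>\<xi>. \<phi> (KG2_ract t \<xi> \<eta>) a) \<in> module_hom K (free_module K (carrier G2)) V"
    using module_hom_comp[OF KG2_ract_hom_left[OF t \<eta>'] bilinear_mapD(2)[OF \<phi> a]]
    by (simp add: module_hom_group_algebra)
  show "(\<lambda>\<xi>. \<phi> \<xi> (A_lact \<eta> a)) \<in> module_hom K (free_module K (carrier G2)) V"
    using bilinear_mapD(2)[OF \<phi> module_hom_mem[OF A_lact_hom_right[OF \<eta>'] a]]
    by (simp add: module_hom_group_algebra)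
  show "\<xi> \<in> carrier (free_module K (carrier G2))" using \<xi> by (simp add: group_algebra_simps)
  fix x assume x: "x \<in> carrier G2"
  show "\<phi> (KG2_ract t (delta K x) \<eta>) a = \<phi> (delta K x) (A_lact \<eta> a)"
  proof (rule R.free_module_hom_eqI[OF V, where S = H2 and \<xi> = \<eta>])
    show "(\<lambda>\<eta>. \<phi> (KG2_ract t (delta K x) \<eta>) a) \<in> module_hom K (free_module K H2) V"
      by (rule module_hom_comp[OF KG2_ract_hom[OF t delta_KG2[OF x]] bilinear_mapD(2)[OF \<phi> a]])
    show "(\<lambda>\<eta>. \<phi> (delta K x) (A_lact \<eta> a)) \<in> module_hom K (free_module K H2) V"
      by (rule module_hom_comp[OF A_lact_hom[OF a] bilinear_mapD(1)[OF \<phi> delta_KG2[OF x]]])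
  qed (use t x a bal \<eta>' in \<open>auto simp: KG2_ract_delta A_lact_delta\<close>)
qed

lemma ind_lift_hom: "tensor_lift K V \<phi> \<in> module_hom K (ind_factor t) V"
  unfolding ind_factor_def
  by (rule tensor_data.tensor_lift_hom[OF tensor_data_ind[OF t] V \<phi>, OF ind_balanced])

lemma ind_lift_arrow:
  "\<lbrakk>x \<in> carrier G2; a \<in> carrier A\<rbrakk> \<Longrightarrow> tensor_lift K V \<phi> (arrow t x a) = \<phi> (delta K x) a"
  unfolding arrow_def ind_pure_def
  by (rule tensor_data.tensor_lift_pure[OF tensor_data_ind[OF t] V \<phi>, OF ind_balanced]) auto

end

text \<open>Right multiplication by [x \<otimes> a] at t, on the one factor where it does not
  vanish, the one at \<open>tgt t x\<close>. That factor is absent from the body; it enters through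
  the balancing relation under which the lift is well defined.\<close>

definition right_mult where
  "right_mult t x a = tensor_lift K (ind_factor t) (\<lambda>\<xi> b.
    ind_pure t (\<xi> \<otimes>\<^bsub>KG2\<^esub> delta K x) (\<omega>1 (twist t x) b \<otimes>\<^bsub>A\<^esub> a))"

context
  fixes t x a
  assumes t: "t \<in> T" and x: "x \<in> carrier G2" and a: "a \<in> carrier A"
begin

lemma right_mult_bilinear:
  "bilinear_map K KG2 A (ind_factor t) (\<lambda>\<xi> b.
    ind_pure t (\<xi> \<otimes>\<^bsub>KG2\<^esub> delta K x) (\<omega>1 (twist t x) b \<otimes>\<^bsub>A\<^esub> a))"
  using t x a
  by (intro bilinear_map_comp[OF ind_pure_bilinear, where h = "\<lambda>X. X"]
      G2.group_algebra_mult_delta_hom[OF R.is_cring]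
      module_hom_comp[OF \<omega>1_module_hom mult_hom_left] module_hom_id) auto

lemma right_mult_value:
  assumes "y \<in> carrier G2" "b \<in> carrier A"
  shows "ind_pure t (delta K y \<otimes>\<^bsub>KG2\<^esub> delta K x) (\<omega>1 (twist t x) b \<otimes>\<^bsub>A\<^esub> a)
    = arrow t (y \<otimes>\<^bsub>G2\<^esub> x) (\<omega>1 (twist t x) b \<otimes>\<^bsub>A\<^esub> a)"
  using assms x by (simp add: arrow_def G2.group_algebra_delta_delta[OF R.is_cring])

text \<open>The product is well defined in its left factor. By \<open>act_tgt_conj\<close> the
  element z at the target crosses x and becomes \<open>act (twist t x) z\<close> at t, where it is
  absorbed into the coefficient; by \<open>\<omega>2_act\<close> the resulting unit is the twist of
  \<open>\<omega>2 z\<close>.\<close>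

lemma right_mult_balanced:
  assumes y: "y \<in> carrier G2" and z: "z \<in> H2" and b: "b \<in> carrier A"
  shows "ind_pure t (delta K (y \<otimes>\<^bsub>G2\<^esub> act (tgt t x) z) \<otimes>\<^bsub>KG2\<^esub> delta K x)
      (\<omega>1 (twist t x) b \<otimes>\<^bsub>A\<^esub> a)
    = ind_pure t (delta K y \<otimes>\<^bsub>KG2\<^esub> delta K x) (\<omega>1 (twist t x) (\<omega>2 z \<otimes>\<^bsub>A\<^esub> b) \<otimes>\<^bsub>A\<^esub> a)"
proof -
  note z' = H2_carrier[OF z]
  have az: "act (twist t x) z \<in> H2" using t x z by (intro act_H2) auto
  have mem: "act (tgt t x) z \<in> carrier G2" using t x z' by (auto intro!: T_carrier)
  have "y \<otimes>\<^bsub>G2\<^esub> act (tgt t x) z \<otimes>\<^bsub>G2\<^esub> x = y \<otimes>\<^bsub>G2\<^esub> x \<otimes>\<^bsub>G2\<^esub> act t (act (twist t x) z)"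
    using act_tgt_conj[OF t x z'] x y z' az mem t
    by (simp add: G2.m_assoc T_carrier H2_carrier)
  then have "arrow t (y \<otimes>\<^bsub>G2\<^esub> act (tgt t x) z \<otimes>\<^bsub>G2\<^esub> x) (\<omega>1 (twist t x) b \<otimes>\<^bsub>A\<^esub> a)
    = arrow t (y \<otimes>\<^bsub>G2\<^esub> x) (\<omega>2 (act (twist t x) z) \<otimes>\<^bsub>A\<^esub> (\<omega>1 (twist t x) b \<otimes>\<^bsub>A\<^esub> a))"
    using t x y a b az by (simp add: arrow_act)
  also have "\<omega>2 (act (twist t x) z) \<otimes>\<^bsub>A\<^esub> (\<omega>1 (twist t x) b \<otimes>\<^bsub>A\<^esub> a)
    = \<omega>1 (twist t x) (\<omega>2 z \<otimes>\<^bsub>A\<^esub> b) \<otimes>\<^bsub>A\<^esub> a"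
    using t x z a b by (simp add: \<omega>2_act \<omega>1_ring_mult m_assoc)
  finally show ?thesis
    using y z b mem by (simp add: right_mult_value)
qed

lemma right_mult_hom: "right_mult t x a \<in> module_hom K (ind_factor (tgt t x)) (ind_factor t)"
  unfolding right_mult_def
  using ind_lift_hom[OF tgt_T[OF t x] module_ind_factor[OF t] right_mult_bilinear right_mult_balanced]
  by simp

lemma right_mult_arrow:
  "\<lbrakk>y \<in> carrier G2; b \<in> carrier A\<rbrakk> \<Longrightarrow>
    right_mult t x a (arrow (tgt t x) y b) = arrow t (y \<otimes>\<^bsub>G2\<^esub> x) (\<omega>1 (twist t x) b \<otimes>\<^bsub>A\<^esub> a)"
  unfolding right_mult_def
  using ind_lift_arrow[OF tgt_T[OF t x] module_ind_factor[OF t] right_mult_bilinear right_mult_balanced]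
  by (simp add: right_mult_value)

end

lemma right_mult_closed [simp, intro]:
  "\<lbrakk>t \<in> T; x \<in> carrier G2; a \<in> carrier A; X \<in> carrier (ind_factor (tgt t x))\<rbrakk> \<Longrightarrow>
    right_mult t x a X \<in> carrier (ind_factor t)"
  by (rule module_hom_mem[OF right_mult_hom])

text \<open>The coefficient a is the second tensor entry of the right factor, so this is one half of
  the bilinearity of \<open>ind_mult_pure\<close>.\<close>

lemma right_mult_coeff_hom:
  assumes t: "t \<in> T" and x: "x \<in> carrier G2" and X: "X \<in> carrier (ind_factor (tgt t x))"
  shows "(\<lambda>a. right_mult t x a X) \<in> module_hom K A (ind_factor t)"
proof (rule module_homI)
  interpret F: module K "ind_factor t" by (rule module_ind_factor[OF t])
  have arr: "arrow t w \<in> module_hom K A (ind_factor t)" if "w \<in> carrier G2" for w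
    using t that by (rule arrow_hom)
  show "right_mult t x a X \<in> carrier (ind_factor t)" if "a \<in> carrier A" for a
    using assms that by simp
  show "right_mult t x (a \<oplus>\<^bsub>A\<^esub> b) X = right_mult t x a X \<oplus>\<^bsub>ind_factor t\<^esub> right_mult t x b X"
    if "a \<in> carrier A" "b \<in> carrier A" for a b
    by (rule ind_factor_hom_eqI[OF tgt_T[OF t x] F.module_axioms _ _ _ X],
        (intro right_mult_hom F.module_hom_add_fun t x that M.a_closed)+)
       (use t x that in \<open>simp add: right_mult_arrow r_distr module_hom_add[OF arr]\<close>)
  show "right_mult t x (c \<odot>\<^bsub>A\<^esub> a) X = c \<odot>\<^bsub>ind_factor t\<^esub> right_mult t x a X"
    if "c \<in> carrier K" "a \<in> carrier A" for c a
    by (rule ind_factor_hom_eqI[OF tgt_T[OF t x] F.module_axioms _ _ _ X],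
        (intro right_mult_hom F.module_hom_smult_fun t x that smult_closed)+)
       (use t x that in \<open>simp add: right_mult_arrow smult_mult_right module_hom_smult[OF arr]\<close>)
qed

lemma tgt_mult_act:
  assumes t: "t \<in> T" and x: "x \<in> carrier G2" and z: "z \<in> H2"
  shows "tgt t (x \<otimes>\<^bsub>G2\<^esub> act t z) = tgt t x"
    and "twist t (x \<otimes>\<^bsub>G2\<^esub> act t z) = bd (inv\<^bsub>G2\<^esub> z) \<otimes>\<^bsub>G1\<^esub> twist t x"
  using tgt_twist_mult[OF t _ x, of "act t z"] tgt_act[OF t z] t z by (auto simp: T_carrier H2_carrier)

text \<open>The product is well defined in its right factor. Passing from x to x times
  \<open>act t z\<close> leaves the target alone and changes the twist by \<open>bd (inv z)\<close>;
  by \<open>\<omega>2_\<omega>1_bd_inv\<close> this change amounts to inserting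
  \<open>\<omega>2 z\<close> before a.\<close>

lemma right_mult_act:
  assumes t: "t \<in> T" and x: "x \<in> carrier G2" and z: "z \<in> H2" and a: "a \<in> carrier A"
    and X: "X \<in> carrier (ind_factor (tgt t x))"
  shows "right_mult t (x \<otimes>\<^bsub>G2\<^esub> act t z) a X = right_mult t x (\<omega>2 z \<otimes>\<^bsub>A\<^esub> a) X"
proof (rule ind_factor_hom_eqI[OF tgt_T[OF t x] module_ind_factor[OF t] _ _ _ X])
  note z' = H2_carrier[OF z]
  have xz: "x \<otimes>\<^bsub>G2\<^esub> act t z \<in> carrier G2" using t x z' by (simp add: T_carrier)
  show "right_mult t (x \<otimes>\<^bsub>G2\<^esub> act t z) a \<in> module_hom K (ind_factor (tgt t x)) (ind_factor t)"
    using right_mult_hom[OF t xz a] by (simp add: tgt_mult_act[OF t x z])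
  show "right_mult t x (\<omega>2 z \<otimes>\<^bsub>A\<^esub> a) \<in> module_hom K (ind_factor (tgt t x)) (ind_factor t)"
    using t x z a by (intro right_mult_hom) auto
  fix y b assume y: "y \<in> carrier G2" and b: "b \<in> carrier A"
  let ?b = "\<omega>1 (twist t x) b"
  have bm: "?b \<in> carrier A" using t x b by auto
  have "right_mult t (x \<otimes>\<^bsub>G2\<^esub> act t z) a (arrow (tgt t x) y b)
      = arrow t (y \<otimes>\<^bsub>G2\<^esub> (x \<otimes>\<^bsub>G2\<^esub> act t z)) (\<omega>1 (bd (inv\<^bsub>G2\<^esub> z)) ?b \<otimes>\<^bsub>A\<^esub> a)"
    using right_mult_arrow[OF t xz a y b] t x z b
    by (simp add: tgt_mult_act[OF t x z] \<omega>1_\<omega>1 bd_H2_mem)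
  also have "\<dots> = arrow t (y \<otimes>\<^bsub>G2\<^esub> x) (\<omega>2 z \<otimes>\<^bsub>A\<^esub> (\<omega>1 (bd (inv\<^bsub>G2\<^esub> z)) ?b \<otimes>\<^bsub>A\<^esub> a))"
    using arrow_act[OF t, of "y \<otimes>\<^bsub>G2\<^esub> x" z "\<omega>1 (bd (inv\<^bsub>G2\<^esub> z)) ?b \<otimes>\<^bsub>A\<^esub> a"] t x y z z' a bm
    by (simp add: G2.m_assoc T_carrier bd_H2_mem)
  also have "\<omega>2 z \<otimes>\<^bsub>A\<^esub> (\<omega>1 (bd (inv\<^bsub>G2\<^esub> z)) ?b \<otimes>\<^bsub>A\<^esub> a) = ?b \<otimes>\<^bsub>A\<^esub> (\<omega>2 z \<otimes>\<^bsub>A\<^esub> a)"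
    using z a bm \<omega>2_\<omega>1_bd_inv[OF z bm] by (simp add: m_assoc[symmetric] bd_H2_mem)
  finally show "right_mult t (x \<otimes>\<^bsub>G2\<^esub> act t z) a (arrow (tgt t x) y b)
      = right_mult t x (\<omega>2 z \<otimes>\<^bsub>A\<^esub> a) (arrow (tgt t x) y b)"
    using t x y b z a by (simp add: right_mult_arrow)
qed

section \<open>The componentwise vector space structure\<close>

abbreviation "Ind \<equiv> induced_algebra"

lemma Ind_simps:
  "carrier Ind = (\<Pi>\<^sub>E t\<in>T. carrier (ind_factor t))"
  "X \<otimes>\<^bsub>Ind\<^esub> Y = (\<lambda>t\<in>T. tensor_lift K (ind_factor t) (ind_mult_pure X t) (Y t))"
  "\<one>\<^bsub>Ind\<^esub> = (\<lambda>t\<in>T. arrow t \<one>\<^bsub>G2\<^esub> \<one>\<^bsub>A\<^esub>)"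
  "\<zero>\<^bsub>Ind\<^esub> = (\<lambda>t\<in>T. \<zero>\<^bsub>ind_factor t\<^esub>)"
  "X \<oplus>\<^bsub>Ind\<^esub> Y = (\<lambda>t\<in>T. X t \<oplus>\<^bsub>ind_factor t\<^esub> Y t)"
  "c \<odot>\<^bsub>Ind\<^esub> X = (\<lambda>t\<in>T. c \<odot>\<^bsub>ind_factor t\<^esub> X t)"
  by (simp_all add: induced_algebra_def arrow_def)

lemma Ind_apply:
  assumes "t \<in> T"
  shows "\<one>\<^bsub>Ind\<^esub> t = arrow t \<one>\<^bsub>G2\<^esub> \<one>\<^bsub>A\<^esub>"
    and "\<zero>\<^bsub>Ind\<^esub> t = \<zero>\<^bsub>ind_factor t\<^esub>"
    and "(X \<oplus>\<^bsub>Ind\<^esub> Y) t = X t \<oplus>\<^bsub>ind_factor t\<^esub> Y t"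
    and "(c \<odot>\<^bsub>Ind\<^esub> X) t = c \<odot>\<^bsub>ind_factor t\<^esub> X t"
  using assms by (simp_all add: Ind_simps)

lemma Ind_mem: "\<lbrakk>X \<in> carrier Ind; t \<in> T\<rbrakk> \<Longrightarrow> X t \<in> carrier (ind_factor t)"
  by (auto simp: Ind_simps)

lemma Ind_ext:
  "\<lbrakk>X \<in> carrier Ind; Y \<in> carrier Ind; \<And>t. t \<in> T \<Longrightarrow> X t = Y t\<rbrakk> \<Longrightarrow> X = Y"
  unfolding Ind_simps by (rule PiE_ext)

lemma module_Ind: "module K Ind"
proof (rule module_criteria)
  note F = module_ind_factor
  have ag: "abelian_group (ind_factor t)" if "t \<in> T" for t
    using F[OF that] by (simp add: module_def)
  \<comment> \<open>An interpretation is tied to one index, so the facts about the factors are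
    exported with t as a parameter.\<close>
  have c: "\<zero>\<^bsub>ind_factor t\<^esub> \<in> carrier (ind_factor t)"
    "\<And>v w. \<lbrakk>v \<in> carrier (ind_factor t); w \<in> carrier (ind_factor t)\<rbrakk> \<Longrightarrow>
      v \<oplus>\<^bsub>ind_factor t\<^esub> w \<in> carrier (ind_factor t)"
    "\<And>c v. \<lbrakk>c \<in> carrier K; v \<in> carrier (ind_factor t)\<rbrakk> \<Longrightarrow>
      c \<odot>\<^bsub>ind_factor t\<^esub> v \<in> carrier (ind_factor t)"
    "\<And>v. v \<in> carrier (ind_factor t) \<Longrightarrow> \<ominus>\<^bsub>ind_factor t\<^esub> v \<in> carrier (ind_factor t)"
    if "t \<in> T" for t
  proof -
    interpret M: module K "ind_factor t" by (rule F[OF that])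
    show "\<zero>\<^bsub>ind_factor t\<^esub> \<in> carrier (ind_factor t)"
      "\<And>v w. \<lbrakk>v \<in> carrier (ind_factor t); w \<in> carrier (ind_factor t)\<rbrakk> \<Longrightarrow>
        v \<oplus>\<^bsub>ind_factor t\<^esub> w \<in> carrier (ind_factor t)"
      "\<And>c v. \<lbrakk>c \<in> carrier K; v \<in> carrier (ind_factor t)\<rbrakk> \<Longrightarrow>
        c \<odot>\<^bsub>ind_factor t\<^esub> v \<in> carrier (ind_factor t)"
      "\<And>v. v \<in> carrier (ind_factor t) \<Longrightarrow> \<ominus>\<^bsub>ind_factor t\<^esub> v \<in> carrier (ind_factor t)"
      by auto
  qed
  have m: "\<And>a b v. \<lbrakk>a \<in> carrier K; b \<in> carrier K; v \<in> carrier (ind_factor t)\<rbrakk> \<Longrightarrow>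
      (a \<otimes>\<^bsub>K\<^esub> b) \<odot>\<^bsub>ind_factor t\<^esub> v = a \<odot>\<^bsub>ind_factor t\<^esub> (b \<odot>\<^bsub>ind_factor t\<^esub> v)"
    "\<And>v. v \<in> carrier (ind_factor t) \<Longrightarrow> \<one>\<^bsub>K\<^esub> \<odot>\<^bsub>ind_factor t\<^esub> v = v"
    "\<And>a b v. \<lbrakk>a \<in> carrier K; b \<in> carrier K; v \<in> carrier (ind_factor t)\<rbrakk> \<Longrightarrow>
      (a \<oplus>\<^bsub>K\<^esub> b) \<odot>\<^bsub>ind_factor t\<^esub> v = a \<odot>\<^bsub>ind_factor t\<^esub> v \<oplus>\<^bsub>ind_factor t\<^esub> b \<odot>\<^bsub>ind_factor t\<^esub> v"
    "\<And>a v w. \<lbrakk>a \<in> carrier K; v \<in> carrier (ind_factor t); w \<in> carrier (ind_factor t)\<rbrakk> \<Longrightarrow>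
      a \<odot>\<^bsub>ind_factor t\<^esub> (v \<oplus>\<^bsub>ind_factor t\<^esub> w)
        = a \<odot>\<^bsub>ind_factor t\<^esub> v \<oplus>\<^bsub>ind_factor t\<^esub> a \<odot>\<^bsub>ind_factor t\<^esub> w"
    if "t \<in> T" for t
  proof -
    interpret M: module K "ind_factor t" by (rule F[OF that])
    show "\<And>a b v. \<lbrakk>a \<in> carrier K; b \<in> carrier K; v \<in> carrier (ind_factor t)\<rbrakk> \<Longrightarrow>
      (a \<otimes>\<^bsub>K\<^esub> b) \<odot>\<^bsub>ind_factor t\<^esub> v = a \<odot>\<^bsub>ind_factor t\<^esub> (b \<odot>\<^bsub>ind_factor t\<^esub> v)"
      by (rule M.smult_assoc1)
    show "\<And>v. v \<in> carrier (ind_factor t) \<Longrightarrow> \<one>\<^bsub>K\<^esub> \<odot>\<^bsub>ind_factor t\<^esub> v = v"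
      by (rule M.smult_one)
    show "\<And>a b v. \<lbrakk>a \<in> carrier K; b \<in> carrier K; v \<in> carrier (ind_factor t)\<rbrakk> \<Longrightarrow>
      (a \<oplus>\<^bsub>K\<^esub> b) \<odot>\<^bsub>ind_factor t\<^esub> v = a \<odot>\<^bsub>ind_factor t\<^esub> v \<oplus>\<^bsub>ind_factor t\<^esub> b \<odot>\<^bsub>ind_factor t\<^esub> v"
      by (rule M.smult_l_distr)
    show "\<And>a v w. \<lbrakk>a \<in> carrier K; v \<in> carrier (ind_factor t); w \<in> carrier (ind_factor t)\<rbrakk> \<Longrightarrow>
      a \<odot>\<^bsub>ind_factor t\<^esub> (v \<oplus>\<^bsub>ind_factor t\<^esub> w)
        = a \<odot>\<^bsub>ind_factor t\<^esub> v \<oplus>\<^bsub>ind_factor t\<^esub> a \<odot>\<^bsub>ind_factor t\<^esub> w"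
      by (rule M.smult_r_distr)
  qed
  have clo: "\<zero>\<^bsub>Ind\<^esub> \<in> carrier Ind"
    "\<And>v w. \<lbrakk>v \<in> carrier Ind; w \<in> carrier Ind\<rbrakk> \<Longrightarrow> v \<oplus>\<^bsub>Ind\<^esub> w \<in> carrier Ind"
    "\<And>c v. \<lbrakk>c \<in> carrier K; v \<in> carrier Ind\<rbrakk> \<Longrightarrow> c \<odot>\<^bsub>Ind\<^esub> v \<in> carrier Ind"
    using c by (auto simp: Ind_simps PiE_iff)
  show "cring K" by (rule R.is_cring)
  show "\<zero>\<^bsub>Ind\<^esub> \<in> carrier Ind" by (rule clo)
  show "\<forall>v w. v \<in> carrier Ind \<and> w \<in> carrier Ind \<longrightarrow> v \<oplus>\<^bsub>Ind\<^esub> w \<in> carrier Ind"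
    using clo by blast
  show "\<forall>c v. c \<in> carrier K \<and> v \<in> carrier Ind \<longrightarrow> c \<odot>\<^bsub>Ind\<^esub> v \<in> carrier Ind"
    using clo by blast
  show "\<forall>v\<in>carrier Ind. \<exists>w\<in>carrier Ind. v \<oplus>\<^bsub>Ind\<^esub> w = \<zero>\<^bsub>Ind\<^esub>"
  proof
    fix v assume v: "v \<in> carrier Ind"
    show "\<exists>w\<in>carrier Ind. v \<oplus>\<^bsub>Ind\<^esub> w = \<zero>\<^bsub>Ind\<^esub>"
    proof (rule bexI)
      show "(\<lambda>t\<in>T. \<ominus>\<^bsub>ind_factor t\<^esub> v t) \<in> carrier Ind"
        using v c by (auto simp: Ind_simps PiE_iff)
      show "v \<oplus>\<^bsub>Ind\<^esub> (\<lambda>t\<in>T. \<ominus>\<^bsub>ind_factor t\<^esub> v t) = \<zero>\<^bsub>Ind\<^esub>"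
        using Ind_mem[OF v] abelian_group.r_neg[OF ag] unfolding Ind_simps
        by (intro restrict_ext) simp
    qed
  qed
  have "v \<oplus>\<^bsub>Ind\<^esub> w = w \<oplus>\<^bsub>Ind\<^esub> v" if "v \<in> carrier Ind" "w \<in> carrier Ind" for v w
    using Ind_mem[OF that(1)] Ind_mem[OF that(2)] abelian_monoid.a_comm[OF abelian_group.axioms(1)[OF ag]]
    by (intro Ind_ext clo that) (simp add: Ind_apply)
  then show "\<forall>v w. v \<in> carrier Ind \<and> w \<in> carrier Ind \<longrightarrow> v \<oplus>\<^bsub>Ind\<^esub> w = w \<oplus>\<^bsub>Ind\<^esub> v" by blast
  have "(v \<oplus>\<^bsub>Ind\<^esub> w) \<oplus>\<^bsub>Ind\<^esub> x = v \<oplus>\<^bsub>Ind\<^esub> (w \<oplus>\<^bsub>Ind\<^esub> x)"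
    if "v \<in> carrier Ind" "w \<in> carrier Ind" "x \<in> carrier Ind" for v w x
    using Ind_mem[OF that(1)] Ind_mem[OF that(2)] Ind_mem[OF that(3)]
      abelian_monoid.a_assoc[OF abelian_group.axioms(1)[OF ag]]
    by (intro Ind_ext clo that) (simp add: Ind_apply)
  then show "\<forall>v w x. v \<in> carrier Ind \<and> w \<in> carrier Ind \<and> x \<in> carrier Ind \<longrightarrow>
      (v \<oplus>\<^bsub>Ind\<^esub> w) \<oplus>\<^bsub>Ind\<^esub> x = v \<oplus>\<^bsub>Ind\<^esub> (w \<oplus>\<^bsub>Ind\<^esub> x)" by blast
  have "v \<oplus>\<^bsub>Ind\<^esub> \<zero>\<^bsub>Ind\<^esub> = v" if "v \<in> carrier Ind" for v
    using Ind_mem[OF that] abelian_monoid.r_zero[OF abelian_group.axioms(1)[OF ag]]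
    by (intro Ind_ext clo that) (simp add: Ind_apply)
  then show "\<forall>v\<in>carrier Ind. v \<oplus>\<^bsub>Ind\<^esub> \<zero>\<^bsub>Ind\<^esub> = v" by blast
  have "(a \<otimes>\<^bsub>K\<^esub> b) \<odot>\<^bsub>Ind\<^esub> v = a \<odot>\<^bsub>Ind\<^esub> (b \<odot>\<^bsub>Ind\<^esub> v)"
    if "v \<in> carrier Ind" "a \<in> carrier K" "b \<in> carrier K" for a b v
    using Ind_mem[OF that(1)] m that(2,3)
    by (intro Ind_ext clo R.m_closed that) (simp add: Ind_apply)
  then show "\<forall>a b v. a \<in> carrier K \<and> b \<in> carrier K \<and> v \<in> carrier Ind \<longrightarrow>
      (a \<otimes>\<^bsub>K\<^esub> b) \<odot>\<^bsub>Ind\<^esub> v = a \<odot>\<^bsub>Ind\<^esub> (b \<odot>\<^bsub>Ind\<^esub> v)" by blast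
  have "\<one>\<^bsub>K\<^esub> \<odot>\<^bsub>Ind\<^esub> v = v" if "v \<in> carrier Ind" for v
    using Ind_mem[OF that] m
    by (intro Ind_ext clo R.one_closed that) (simp add: Ind_apply)
  then show "\<forall>v\<in>carrier Ind. \<one>\<^bsub>K\<^esub> \<odot>\<^bsub>Ind\<^esub> v = v" by blast
  have "(a \<oplus>\<^bsub>K\<^esub> b) \<odot>\<^bsub>Ind\<^esub> v = a \<odot>\<^bsub>Ind\<^esub> v \<oplus>\<^bsub>Ind\<^esub> b \<odot>\<^bsub>Ind\<^esub> v"
    if "v \<in> carrier Ind" "a \<in> carrier K" "b \<in> carrier K" for a b v
    using Ind_mem[OF that(1)] m that(2,3)
    by (intro Ind_ext clo R.a_closed that) (simp add: Ind_apply)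
  then show "\<forall>a b v. a \<in> carrier K \<and> b \<in> carrier K \<and> v \<in> carrier Ind \<longrightarrow>
      (a \<oplus>\<^bsub>K\<^esub> b) \<odot>\<^bsub>Ind\<^esub> v = a \<odot>\<^bsub>Ind\<^esub> v \<oplus>\<^bsub>Ind\<^esub> b \<odot>\<^bsub>Ind\<^esub> v" by blast
  have "a \<odot>\<^bsub>Ind\<^esub> (v \<oplus>\<^bsub>Ind\<^esub> w) = a \<odot>\<^bsub>Ind\<^esub> v \<oplus>\<^bsub>Ind\<^esub> a \<odot>\<^bsub>Ind\<^esub> w"
    if "v \<in> carrier Ind" "w \<in> carrier Ind" "a \<in> carrier K" for a v w
    using Ind_mem[OF that(1)] Ind_mem[OF that(2)] m that(3)
    by (intro Ind_ext clo that) (simp add: Ind_apply)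
  then show "\<forall>a v w. a \<in> carrier K \<and> v \<in> carrier Ind \<and> w \<in> carrier Ind \<longrightarrow>
      a \<odot>\<^bsub>Ind\<^esub> (v \<oplus>\<^bsub>Ind\<^esub> w) = a \<odot>\<^bsub>Ind\<^esub> v \<oplus>\<^bsub>Ind\<^esub> a \<odot>\<^bsub>Ind\<^esub> w" by blast
qed

lemma vectorspace_Ind: "vectorspace K Ind"
  by (intro vectorspace.intro module_Ind field_axioms)

text \<open>The component at t of a product depends on the right factor only through its component
  at t. Hence left multiplication by a family is a linear endomorphism of each factor, also when
  \<open>T\<close> is infinite.\<close>

definition left_mult where
  "left_mult X t = tensor_lift K (ind_factor t) (ind_mult_pure X t)"

lemma ind_mult_pure_lin_ext:
  "ind_mult_pure X t = (\<lambda>\<xi> a. lin_ext K (ind_factor t) (\<lambda>x. right_mult t x a (X (tgt t x))) \<xi>)"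
  by (simp add: fun_eq_iff ind_mult_pure_def Let_def lin_ext_def right_mult_def twist_def tgt_def)

context
  fixes X t assumes X: "X \<in> carrier Ind" and t: "t \<in> T"
begin

lemma ind_mult_pure_bilinear: "bilinear_map K KG2 A (ind_factor t) (ind_mult_pure X t)"
proof -
  interpret F: module K "ind_factor t" by (rule module_ind_factor[OF t])
  show ?thesis
    unfolding ind_mult_pure_lin_ext bilinear_map_group_algebra
    using X t by (intro F.lin_ext_bilinear module_axioms right_mult_coeff_hom Ind_mem) auto
qed

lemma ind_mult_pure_delta:
  assumes "x \<in> carrier G2" "a \<in> carrier A"
  shows "ind_mult_pure X t (delta K x) a = right_mult t x a (X (tgt t x))"
proof -
  interpret F: module K "ind_factor t" by (rule module_ind_factor[OF t])
  show ?thesis unfolding ind_mult_pure_lin_ext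
    using X t assms by (intro F.lin_ext_delta[where S = "carrier G2"] right_mult_closed Ind_mem) auto
qed

lemma ind_mult_pure_balanced:
  assumes x: "x \<in> carrier G2" and z: "z \<in> H2" and a: "a \<in> carrier A"
  shows "ind_mult_pure X t (delta K (x \<otimes>\<^bsub>G2\<^esub> act t z)) a = ind_mult_pure X t (delta K x) (\<omega>2 z \<otimes>\<^bsub>A\<^esub> a)"
  using t X x z a
  by (simp add: ind_mult_pure_delta T_carrier H2_carrier tgt_mult_act right_mult_act Ind_mem)

lemma left_mult_hom: "left_mult X t \<in> module_hom K (ind_factor t) (ind_factor t)"
  unfolding left_mult_def
  by (rule ind_lift_hom[OF t module_ind_factor[OF t] ind_mult_pure_bilinear ind_mult_pure_balanced])

lemma left_mult_arrow:
  "\<lbrakk>x \<in> carrier G2; a \<in> carrier A\<rbrakk> \<Longrightarrow> left_mult X t (arrow t x a) = right_mult t x a (X (tgt t x))"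
  unfolding left_mult_def
  using ind_lift_arrow[OF t module_ind_factor[OF t] ind_mult_pure_bilinear ind_mult_pure_balanced]
  by (simp add: ind_mult_pure_delta)

end

lemma left_mult_closed [simp, intro]:
  "\<lbrakk>X \<in> carrier Ind; t \<in> T; v \<in> carrier (ind_factor t)\<rbrakk> \<Longrightarrow> left_mult X t v \<in> carrier (ind_factor t)"
  by (rule module_hom_mem[OF left_mult_hom])

lemma Ind_mult: "X \<otimes>\<^bsub>Ind\<^esub> Y = (\<lambda>t\<in>T. left_mult X t (Y t))"
  by (simp add: Ind_simps left_mult_def)

lemma Ind_mult_apply: "t \<in> T \<Longrightarrow> (X \<otimes>\<^bsub>Ind\<^esub> Y) t = left_mult X t (Y t)"
  by (simp add: Ind_mult)

lemma Ind_mult_closed: "\<lbrakk>X \<in> carrier Ind; Y \<in> carrier Ind\<rbrakk> \<Longrightarrow> X \<otimes>\<^bsub>Ind\<^esub> Y \<in> carrier Ind"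
  using left_mult_closed[OF _ _ Ind_mem] unfolding Ind_mult by (auto simp: Ind_simps(1))

lemma left_mult_add:
  assumes X: "X \<in> carrier Ind" and Y: "Y \<in> carrier Ind" and t: "t \<in> T"
    and v: "v \<in> carrier (ind_factor t)"
  shows "left_mult (X \<oplus>\<^bsub>Ind\<^esub> Y) t v = left_mult X t v \<oplus>\<^bsub>ind_factor t\<^esub> left_mult Y t v"
proof -
  interpret F: module K "ind_factor t" by (rule module_ind_factor[OF t])
  interpret I: module K Ind by (rule module_Ind)
  show ?thesis
    by (rule ind_factor_hom_eqI[OF t F.module_axioms _ _ _ v],
        (intro left_mult_hom F.module_hom_add_fun X Y t I.a_closed)+)
       (use X Y t in \<open>simp add: left_mult_arrow module_hom_add[OF right_mult_hom] Ind_mem Ind_apply\<close>)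
qed

lemma left_mult_smult:
  assumes X: "X \<in> carrier Ind" and c: "c \<in> carrier K" and t: "t \<in> T"
    and v: "v \<in> carrier (ind_factor t)"
  shows "left_mult (c \<odot>\<^bsub>Ind\<^esub> X) t v = c \<odot>\<^bsub>ind_factor t\<^esub> left_mult X t v"
proof -
  interpret F: module K "ind_factor t" by (rule module_ind_factor[OF t])
  interpret I: module K Ind by (rule module_Ind)
  show ?thesis
    by (rule ind_factor_hom_eqI[OF t F.module_axioms _ _ _ v],
        (intro left_mult_hom F.module_hom_smult_fun X c t I.smult_closed)+)
       (use X c t in \<open>simp add: left_mult_arrow module_hom_smult[OF right_mult_hom] Ind_mem Ind_apply\<close>)
qed

text \<open>Associativity for three composable arrows: the cocycle rule for \<open>twist\<close>
  matches the two ways of twisting the leftmost coefficient.\<close>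

lemma right_mult_right_mult:
  assumes t: "t \<in> T" and x: "x \<in> carrier G2" and a: "a \<in> carrier A"
    and y: "y \<in> carrier G2" and b: "b \<in> carrier A"
    and v: "v \<in> carrier (ind_factor (tgt (tgt t x) y))"
  shows "right_mult t x a (right_mult (tgt t x) y b v)
    = right_mult t (y \<otimes>\<^bsub>G2\<^esub> x) (\<omega>1 (twist t x) b \<otimes>\<^bsub>A\<^esub> a) v"
proof (rule ind_factor_hom_eqI[OF _ module_ind_factor[OF t] _ _ _ v])
  let ?s = "tgt t x"
  show "tgt ?s y \<in> T" using t x y by auto
  show "(\<lambda>v. right_mult t x a (right_mult ?s y b v)) \<in> module_hom K (ind_factor (tgt ?s y)) (ind_factor t)"
    using assms by (intro module_hom_comp[OF right_mult_hom right_mult_hom]) auto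
  show "right_mult t (y \<otimes>\<^bsub>G2\<^esub> x) (\<omega>1 (twist t x) b \<otimes>\<^bsub>A\<^esub> a)
      \<in> module_hom K (ind_factor (tgt ?s y)) (ind_factor t)"
    using right_mult_hom[OF t, of "y \<otimes>\<^bsub>G2\<^esub> x" "\<omega>1 (twist t x) b \<otimes>\<^bsub>A\<^esub> a"] assms
    by (simp add: tgt_twist_mult)
  fix w c assume w: "w \<in> carrier G2" and c: "c \<in> carrier A"
  have "right_mult t (y \<otimes>\<^bsub>G2\<^esub> x) (\<omega>1 (twist t x) b \<otimes>\<^bsub>A\<^esub> a) (arrow (tgt ?s y) w c)
    = arrow t (w \<otimes>\<^bsub>G2\<^esub> (y \<otimes>\<^bsub>G2\<^esub> x))
        (\<omega>1 (twist t x \<otimes>\<^bsub>G1\<^esub> twist ?s y) c \<otimes>\<^bsub>A\<^esub> (\<omega>1 (twist t x) b \<otimes>\<^bsub>A\<^esub> a))"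
    using right_mult_arrow[OF t, of "y \<otimes>\<^bsub>G2\<^esub> x" "\<omega>1 (twist t x) b \<otimes>\<^bsub>A\<^esub> a" w c] assms w c
    by (simp add: tgt_twist_mult)
  then show "right_mult t x a (right_mult ?s y b (arrow (tgt ?s y) w c))
    = right_mult t (y \<otimes>\<^bsub>G2\<^esub> x) (\<omega>1 (twist t x) b \<otimes>\<^bsub>A\<^esub> a) (arrow (tgt ?s y) w c)"
    using assms w c
    by (simp add: right_mult_arrow \<omega>1_\<omega>1 \<omega>1_ring_mult m_assoc G2.m_assoc)
qed

text \<open>This extends associativity from arrows to an arbitrary family on the left. For an arrow
  v both sides are right multiples of the same component of X.\<close>

lemma left_mult_right_mult:
  assumes X: "X \<in> carrier Ind" and t: "t \<in> T" and x: "x \<in> carrier G2" and a: "a \<in> carrier A"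
    and v: "v \<in> carrier (ind_factor (tgt t x))"
  shows "right_mult t x a (left_mult X (tgt t x) v) = left_mult X t (right_mult t x a v)"
proof (rule ind_factor_hom_eqI[OF tgt_T[OF t x] module_ind_factor[OF t] _ _ _ v])
  show "(\<lambda>v. right_mult t x a (left_mult X (tgt t x) v))
      \<in> module_hom K (ind_factor (tgt t x)) (ind_factor t)"
    by (rule module_hom_comp[OF left_mult_hom[OF X tgt_T[OF t x]] right_mult_hom[OF t x a]])
  show "(\<lambda>v. left_mult X t (right_mult t x a v))
      \<in> module_hom K (ind_factor (tgt t x)) (ind_factor t)"
    by (rule module_hom_comp[OF right_mult_hom[OF t x a] left_mult_hom[OF X t]])
qed (use X t x a in \<open>simp_all add: left_mult_arrow right_mult_arrow right_mult_right_mult Ind_mem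
  tgt_twist_mult\<close>)

lemma Ind_assoc:
  assumes X: "X \<in> carrier Ind" and Y: "Y \<in> carrier Ind" and Z: "Z \<in> carrier Ind"
  shows "X \<otimes>\<^bsub>Ind\<^esub> Y \<otimes>\<^bsub>Ind\<^esub> Z = X \<otimes>\<^bsub>Ind\<^esub> (Y \<otimes>\<^bsub>Ind\<^esub> Z)"
proof (rule Ind_ext)
  fix t assume t: "t \<in> T"
  \<comment> \<open>When v is an arrow, the left side is a right multiple of the component of the
    product of X and Y at its target, and \<open>left_mult_right_mult\<close> pulls X out.\<close>
  have "left_mult (X \<otimes>\<^bsub>Ind\<^esub> Y) t v = left_mult X t (left_mult Y t v)"
    if v: "v \<in> carrier (ind_factor t)" for v
  proof (rule ind_factor_hom_eqI[OF t module_ind_factor[OF t] _ _ _ v])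
    show "left_mult (X \<otimes>\<^bsub>Ind\<^esub> Y) t \<in> module_hom K (ind_factor t) (ind_factor t)"
      by (rule left_mult_hom[OF Ind_mult_closed[OF X Y] t])
    show "(\<lambda>v. left_mult X t (left_mult Y t v)) \<in> module_hom K (ind_factor t) (ind_factor t)"
      by (rule module_hom_comp[OF left_mult_hom[OF Y t] left_mult_hom[OF X t]])
  qed (use X Y t in \<open>simp_all add: left_mult_arrow Ind_mult_closed Ind_mem left_mult_right_mult
    Ind_mult_apply\<close>)
  then show "(X \<otimes>\<^bsub>Ind\<^esub> Y \<otimes>\<^bsub>Ind\<^esub> Z) t = (X \<otimes>\<^bsub>Ind\<^esub> (Y \<otimes>\<^bsub>Ind\<^esub> Z)) t"
    using t Z by (simp add: Ind_mult_apply Ind_mem)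
qed (intro Ind_mult_closed X Y Z)+

lemma Ind_one_closed: "\<one>\<^bsub>Ind\<^esub> \<in> carrier Ind"
  by (auto simp: Ind_simps)

lemma Ind_l_one:
  assumes X: "X \<in> carrier Ind" shows "\<one>\<^bsub>Ind\<^esub> \<otimes>\<^bsub>Ind\<^esub> X = X"
proof (rule Ind_ext)
  fix t assume t: "t \<in> T"
  have "left_mult \<one>\<^bsub>Ind\<^esub> t v = v" if v: "v \<in> carrier (ind_factor t)" for v
    by (rule ind_factor_hom_eqI[OF t module_ind_factor[OF t] left_mult_hom[OF Ind_one_closed t]
          module_hom_id _ v])
       (use t in \<open>simp add: left_mult_arrow Ind_one_closed right_mult_arrow Ind_apply\<close>)
  then show "(\<one>\<^bsub>Ind\<^esub> \<otimes>\<^bsub>Ind\<^esub> X) t = X t" using t X by (simp add: Ind_mult_apply Ind_mem)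
qed (intro Ind_mult_closed Ind_one_closed X)+

lemma Ind_r_one:
  assumes X: "X \<in> carrier Ind" shows "X \<otimes>\<^bsub>Ind\<^esub> \<one>\<^bsub>Ind\<^esub> = X"
proof (rule Ind_ext)
  fix t assume t: "t \<in> T"
  have "right_mult t \<one>\<^bsub>G2\<^esub> \<one>\<^bsub>A\<^esub> v = v" if v: "v \<in> carrier (ind_factor t)" for v
    by (rule ind_factor_hom_eqI[OF t module_ind_factor[OF t] _ module_hom_id _ v])
       (use t right_mult_hom[OF t, of "\<one>\<^bsub>G2\<^esub>" "\<one>\<^bsub>A\<^esub>"]
         right_mult_arrow[OF t, of "\<one>\<^bsub>G2\<^esub>" "\<one>\<^bsub>A\<^esub>"] in simp_all)
  then show "(X \<otimes>\<^bsub>Ind\<^esub> \<one>\<^bsub>Ind\<^esub>) t = X t"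
    using t X by (simp add: Ind_mult_apply Ind_apply left_mult_arrow Ind_mem)
qed (intro Ind_mult_closed Ind_one_closed X)+

text \<open>\<open>separable_algebra\<close> includes \<open>assoc_algebra\<close>, and the calculus
  of the tensor square lives in that locale, so the algebra axioms have to be established
  first.\<close>

lemma assoc_algebra_Ind: "assoc_algebra K Ind"
proof -
  interpret I: module K Ind by (rule module_Ind)
  have "ring Ind"
  proof (rule ringI)
    show "abelian_group Ind" by (rule I.abelian_group_axioms)
    show "Group.monoid Ind"
      by (rule monoidI) (simp_all add: Ind_mult_closed Ind_one_closed Ind_assoc Ind_l_one Ind_r_one)
    show "(X \<oplus>\<^bsub>Ind\<^esub> Y) \<otimes>\<^bsub>Ind\<^esub> Z = X \<otimes>\<^bsub>Ind\<^esub> Z \<oplus>\<^bsub>Ind\<^esub> Y \<otimes>\<^bsub>Ind\<^esub> Z"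
      if "X \<in> carrier Ind" "Y \<in> carrier Ind" "Z \<in> carrier Ind" for X Y Z
      using that
      by (intro Ind_ext Ind_mult_closed I.a_closed)
         (auto simp: Ind_mult_apply Ind_apply left_mult_add Ind_mem)
    show "Z \<otimes>\<^bsub>Ind\<^esub> (X \<oplus>\<^bsub>Ind\<^esub> Y) = Z \<otimes>\<^bsub>Ind\<^esub> X \<oplus>\<^bsub>Ind\<^esub> Z \<otimes>\<^bsub>Ind\<^esub> Y"
      if "X \<in> carrier Ind" "Y \<in> carrier Ind" "Z \<in> carrier Ind" for X Y Z
      using that
      by (intro Ind_ext Ind_mult_closed I.a_closed)
         (auto simp: Ind_mult_apply Ind_apply module_hom_add[OF left_mult_hom] Ind_mem)
  qed
  then show ?thesis
  proof (intro assoc_algebra.intro vectorspace_Ind assoc_algebra_axioms.intro)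
    show "(c \<odot>\<^bsub>Ind\<^esub> X) \<otimes>\<^bsub>Ind\<^esub> Y = c \<odot>\<^bsub>Ind\<^esub> (X \<otimes>\<^bsub>Ind\<^esub> Y)"
      if "c \<in> carrier K" "X \<in> carrier Ind" "Y \<in> carrier Ind" for c X Y
      using that
      by (intro Ind_ext Ind_mult_closed I.smult_closed)
         (auto simp: Ind_mult_apply Ind_apply left_mult_smult Ind_mem)
    show "X \<otimes>\<^bsub>Ind\<^esub> (c \<odot>\<^bsub>Ind\<^esub> Y) = c \<odot>\<^bsub>Ind\<^esub> (X \<otimes>\<^bsub>Ind\<^esub> Y)"
      if "c \<in> carrier K" "X \<in> carrier Ind" "Y \<in> carrier Ind" for c X Y
      using that
      by (intro Ind_ext Ind_mult_closed I.smult_closed)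
         (auto simp: Ind_mult_apply Ind_apply module_hom_smult[OF left_mult_hom] Ind_mem)
  qed
qed

end

section \<open>Counting and the characteristic\<close>

lemma (in module) add_pow_smult_one:
  assumes "x \<in> carrier M"
  shows "add_pow M (n::nat) x = add_pow R n \<one> \<odot>\<^bsub>M\<^esub> x"
  using assms by (induction n) (simp_all add: smult_l_distr)

text \<open>For the later count of arrows: fibres of equal size n turn a sum over all arrows into n
  times a sum over their sources.\<close>

lemma (in module) finsum_Sigma_const:
  assumes "finite I" and "\<And>i. i \<in> I \<Longrightarrow> finite (J i)" and g: "\<And>i. i \<in> I \<Longrightarrow> g i \<in> carrier M"
    and card: "\<And>i. i \<in> I \<Longrightarrow> card (J i) = n"
  shows "(\<Oplus>\<^bsub>M\<^esub>p\<in>Sigma I J. g (fst p)) = (\<Oplus>\<^bsub>M\<^esub>i\<in>I. add_pow R n \<one> \<odot>\<^bsub>M\<^esub> g i)"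
proof -
  have n: "add_pow R n \<one> \<in> carrier R" by simp
  have "(\<Oplus>\<^bsub>M\<^esub>p\<in>{i} \<times> J i. g (fst p)) = add_pow R n \<one> \<odot>\<^bsub>M\<^esub> g i" if i: "i \<in> I" for i
  proof -
    have "(\<Oplus>\<^bsub>M\<^esub>p\<in>{i} \<times> J i. g (fst p)) = (\<Oplus>\<^bsub>M\<^esub>p\<in>{i} \<times> J i. g i)"
      using g i by (intro M.finsum_cong') auto
    also have "\<dots> = add_pow M n (g i)"
      using M.add.finprod_const[OF g[OF i], of "{i} \<times> J i"] card[OF i] by (simp add: card_cartesian_product)
    finally show ?thesis using g i by (simp add: add_pow_smult_one)
  qed
  moreover have "Sigma I J = \<Union> ((\<lambda>i. {i} \<times> J i) ` I)" by auto
  moreover have "(\<Oplus>\<^bsub>M\<^esub>p\<in>\<Union> ((\<lambda>i. {i} \<times> J i) ` I). g (fst p))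
      = (\<Oplus>\<^bsub>M\<^esub>i\<in>I. \<Oplus>\<^bsub>M\<^esub>p\<in>{i} \<times> J i. g (fst p))"
    using assms by (intro M.add.finprod_UN_disjoint) (auto simp: pairwise_def disjnt_def)
  ultimately show ?thesis using g n by (simp add: M.finsum_cong')
qed

text \<open>Divide n by the characteristic p with remainder: the remainder also annihilates 1, so it
  vanishes by minimality of p. In characteristic zero the hypothesis says that n is not 0.\<close>

lemma (in field) add_pow_one_ne_zero:
  assumes "\<not> ring_characteristic R dvd n"
  shows "add_pow R n \<one> \<noteq> \<zero>"
proof
  assume n: "add_pow R n \<one> = \<zero>"
  let ?P = "\<lambda>n::nat. 0 < n \<and> add_pow R n \<one> = \<zero>"
  \<comment> \<open>Every number divides 0, so n is positive; as it annihilates 1, the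
    characteristic is given by the \<open>LEAST\<close> branch.\<close>
  have "0 < n" using assms by (cases n) auto
  then have ex: "\<exists>n. ?P n" using n by blast
  define p where "p = ring_characteristic R"
  have p_def': "p = (LEAST n. ?P n)" using ex by (simp add: p_def ring_characteristic_def)
  have p: "?P p" unfolding p_def' by (rule LeastI_ex[OF ex])
  have r: "n mod p < p" using p by simp
  have "\<zero> = add_pow R (p * (n div p) + n mod p) \<one>" using n by simp
  also have "\<dots> = add_pow R (n div p) (add_pow R p \<one>) \<oplus> add_pow R (n mod p) \<one>"
    by (simp add: add.nat_pow_mult add.nat_pow_pow del: mult_div_mod_eq)
  also have "\<dots> = add_pow R (n mod p) \<one>" using p by simp
  finally have "n mod p = 0" using r not_less_Least[of "n mod p" ?P] unfolding p_def'[symmetric] by auto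
  then show False using assms by (auto simp: p_def)
qed

section \<open>Generators of the induced algebra\<close>

context induction_setup
begin

interpretation I: assoc_algebra K Ind
  by (rule assoc_algebra_Ind)

definition single where
  "single t v = (\<lambda>s\<in>T. if s = t then v else \<zero>\<^bsub>ind_factor s\<^esub>)"

lemma zero_ind_factor_closed: "t \<in> T \<Longrightarrow> \<zero>\<^bsub>ind_factor t\<^esub> \<in> carrier (ind_factor t)"
proof -
  assume "t \<in> T"
  then interpret F: module K "ind_factor t" by (rule module_ind_factor)
  show ?thesis by simp
qed

lemma single_closed: "\<lbrakk>t \<in> T; v \<in> carrier (ind_factor t)\<rbrakk> \<Longrightarrow> single t v \<in> carrier Ind"
  by (auto simp: single_def Ind_simps zero_ind_factor_closed)

lemma single_apply: "s \<in> T \<Longrightarrow> single t v s = (if s = t then v else \<zero>\<^bsub>ind_factor s\<^esub>)"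
  by (simp add: single_def)

lemma single_hom:
  assumes t: "t \<in> T" shows "single t \<in> module_hom K (ind_factor t) Ind"
proof (rule module_homI)
  interpret Ft: module K "ind_factor t" by (rule module_ind_factor[OF t])
  show "single t v \<in> carrier Ind" if "v \<in> carrier (ind_factor t)" for v
    using t that by (rule single_closed)
  show "single t (v \<oplus>\<^bsub>ind_factor t\<^esub> w) = single t v \<oplus>\<^bsub>Ind\<^esub> single t w"
    if "v \<in> carrier (ind_factor t)" "w \<in> carrier (ind_factor t)" for v w
  proof (rule Ind_ext)
    fix s assume s: "s \<in> T"
    interpret Fs: module K "ind_factor s" by (rule module_ind_factor[OF s])
    show "single t (v \<oplus>\<^bsub>ind_factor t\<^esub> w) s = (single t v \<oplus>\<^bsub>Ind\<^esub> single t w) s"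
      using s by (auto simp: Ind_apply single_apply)
  qed (use t that in \<open>auto intro: single_closed\<close>)
  show "single t (c \<odot>\<^bsub>ind_factor t\<^esub> v) = c \<odot>\<^bsub>Ind\<^esub> single t v"
    if "c \<in> carrier K" "v \<in> carrier (ind_factor t)" for c v
  proof (rule Ind_ext)
    fix s assume s: "s \<in> T"
    interpret Fs: module K "ind_factor s" by (rule module_ind_factor[OF s])
    show "single t (c \<odot>\<^bsub>ind_factor t\<^esub> v) s = (c \<odot>\<^bsub>Ind\<^esub> single t v) s"
      using s that by (auto simp: Ind_apply single_apply)
  qed (use t that in \<open>auto intro: single_closed\<close>)
qed

lemma finsum_single:
  assumes "finite S" "S \<subseteq> T" "\<And>t. t \<in> S \<Longrightarrow> v t \<in> carrier (ind_factor t)" "s \<in> T"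
  shows "(\<Oplus>\<^bsub>Ind\<^esub>t\<in>S. single t (v t)) s = (if s \<in> S then v s else \<zero>\<^bsub>ind_factor s\<^esub>)"
  using assms(1-3)
proof (induction S)
  case empty
  then show ?case using assms(4) by (simp add: Ind_apply)
next
  case (insert t S)
  interpret Fs: module K "ind_factor s" by (rule module_ind_factor[OF assms(4)])
  have "(\<Oplus>\<^bsub>Ind\<^esub>t\<in>insert t S. single t (v t)) = single t (v t) \<oplus>\<^bsub>Ind\<^esub> (\<Oplus>\<^bsub>Ind\<^esub>t\<in>S. single t (v t))"
    using insert by (intro I.M.finsum_insert) (auto intro: single_closed)
  then have eq: "(\<Oplus>\<^bsub>Ind\<^esub>t\<in>insert t S. single t (v t)) s
      = single t (v t) s \<oplus>\<^bsub>ind_factor s\<^esub> (if s \<in> S then v s else \<zero>\<^bsub>ind_factor s\<^esub>)"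
    using insert assms(4) by (simp add: Ind_apply)
  have "v s \<in> carrier (ind_factor s)" if "s \<in> insert t S" using insert.prems that by blast
  then show ?case
    unfolding eq using insert.hyps assms(4) by (cases "t = s") (simp_all add: single_apply)
qed

definition gen :: "'g \<Rightarrow> 'h \<Rightarrow> 'a \<Rightarrow> 'g \<Rightarrow> (('h \<Rightarrow> 'k) \<times> 'a \<Rightarrow> 'k) set" where
  "gen t x a = single t (arrow t x a)"

lemma gen_hom: "\<lbrakk>t \<in> T; x \<in> carrier G2\<rbrakk> \<Longrightarrow> gen t x \<in> module_hom K A Ind"
  unfolding gen_def[abs_def] by (rule module_hom_comp[OF arrow_hom single_hom])

lemma gen_closed [simp, intro]:
  "\<lbrakk>t \<in> T; x \<in> carrier G2; a \<in> carrier A\<rbrakk> \<Longrightarrow> gen t x a \<in> carrier Ind"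
  by (rule module_hom_mem[OF gen_hom])

lemma gen_act:
  "\<lbrakk>t \<in> T; x \<in> carrier G2; z \<in> H2; a \<in> carrier A\<rbrakk> \<Longrightarrow>
    gen t (x \<otimes>\<^bsub>G2\<^esub> act t z) a = gen t x (\<omega>2 z \<otimes>\<^bsub>A\<^esub> a)"
  by (simp add: gen_def arrow_act)

text \<open>The familiar product rule of the induced algebra, recovered from its componentwise
  definition. Its Kronecker delta becomes \<open>tgt t x = s\<close>: the cosets of t and of
  \<open>bd (inv x)\<close> times s agree exactly when s represents the coset of \<open>bd x\<close>
  times t.\<close>

lemma gen_mult:
  assumes s: "s \<in> T" and y: "y \<in> carrier G2" and b: "b \<in> carrier A"
    and t: "t \<in> T" and x: "x \<in> carrier G2" and a: "a \<in> carrier A"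
  shows "gen s y b \<otimes>\<^bsub>Ind\<^esub> gen t x a =
    (if tgt t x = s then gen t (y \<otimes>\<^bsub>G2\<^esub> x) (\<omega>1 (twist t x) b \<otimes>\<^bsub>A\<^esub> a) else \<zero>\<^bsub>Ind\<^esub>)"
proof (rule Ind_ext)
  have g: "gen s y b \<in> carrier Ind" using s y b by simp
  show "gen s y b \<otimes>\<^bsub>Ind\<^esub> gen t x a \<in> carrier Ind" using assms by simp
  show "(if tgt t x = s then gen t (y \<otimes>\<^bsub>G2\<^esub> x) (\<omega>1 (twist t x) b \<otimes>\<^bsub>A\<^esub> a) else \<zero>\<^bsub>Ind\<^esub>) \<in> carrier Ind"
    using assms by simp
  fix r assume r: "r \<in> T"
  interpret Fr: module K "ind_factor r" by (rule module_ind_factor[OF r])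
  interpret Fu: module K "ind_factor (tgt t x)" by (rule module_ind_factor[OF tgt_T[OF t x]])
  show "(gen s y b \<otimes>\<^bsub>Ind\<^esub> gen t x a) r =
    (if tgt t x = s then gen t (y \<otimes>\<^bsub>G2\<^esub> x) (\<omega>1 (twist t x) b \<otimes>\<^bsub>A\<^esub> a) else \<zero>\<^bsub>Ind\<^esub>) r"
  proof (cases "r = t")
    case False
    then have "(gen s y b \<otimes>\<^bsub>Ind\<^esub> gen t x a) r = \<zero>\<^bsub>ind_factor r\<^esub>"
      using r by (simp add: Ind_mult_apply gen_def[of t x a] single_apply
          Fr.module_hom_zero[OF Fr.module_axioms left_mult_hom[OF g r]])
    then show ?thesis using False r by (simp add: gen_def single_apply Ind_apply)
  next
    case True
    then have "(gen s y b \<otimes>\<^bsub>Ind\<^esub> gen t x a) r = right_mult t x a (gen s y b (tgt t x))"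
      using r x a g by (simp add: Ind_mult_apply gen_def[of t x a] single_apply left_mult_arrow)
    moreover have "right_mult t x a \<zero>\<^bsub>ind_factor (tgt t x)\<^esub> = \<zero>\<^bsub>ind_factor t\<^esub>"
      using Fu.module_hom_zero[OF module_ind_factor[OF t] right_mult_hom[OF t x a]] .
    ultimately show ?thesis
      using True t x a y b by (auto simp: gen_def single_apply right_mult_arrow Ind_apply)
  qed
qed

context
  assumes finite_T: "finite T"
begin

text \<open>Finiteness of \<open>T\<close> makes the product of the factors their direct
  sum.\<close>

lemma Ind_eq_finsum:
  assumes X: "X \<in> carrier Ind"
  shows "X = (\<Oplus>\<^bsub>Ind\<^esub>t\<in>T. single t (X t))"
proof (rule Ind_ext[OF X])
  show "(\<Oplus>\<^bsub>Ind\<^esub>t\<in>T. single t (X t)) \<in> carrier Ind"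
    using X by (intro I.M.finsum_closed) (auto simp: Ind_mem intro!: single_closed)
  show "X t = (\<Oplus>\<^bsub>Ind\<^esub>t\<in>T. single t (X t)) t" if "t \<in> T" for t
    using X finite_T that by (simp add: finsum_single Ind_mem)
qed

lemma Ind_one_eq: "\<one>\<^bsub>Ind\<^esub> = (\<Oplus>\<^bsub>Ind\<^esub>t\<in>T. gen t \<one>\<^bsub>G2\<^esub> \<one>\<^bsub>A\<^esub>)"
proof -
  have "(\<Oplus>\<^bsub>Ind\<^esub>t\<in>T. single t (\<one>\<^bsub>Ind\<^esub> t)) = (\<Oplus>\<^bsub>Ind\<^esub>t\<in>T. gen t \<one>\<^bsub>G2\<^esub> \<one>\<^bsub>A\<^esub>)"
    by (intro I.M.finsum_cong') (auto simp: gen_def Ind_apply intro!: single_closed)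
  then show ?thesis using Ind_eq_finsum[OF Ind_one_closed] by simp
qed

lemma Ind_hom_eqI:
  assumes V: "module K V" and f: "f \<in> module_hom K Ind V" and g: "g \<in> module_hom K Ind V"
    and eq: "\<And>t x a. \<lbrakk>t \<in> T; x \<in> carrier G2; a \<in> carrier A\<rbrakk> \<Longrightarrow> f (gen t x a) = g (gen t x a)"
    and X: "X \<in> carrier Ind"
  shows "f X = g X"
proof -
  interpret V: module K V by (rule V)
  have "f (single t v) = g (single t v)" if t: "t \<in> T" and v: "v \<in> carrier (ind_factor t)" for t v
    by (rule ind_factor_hom_eqI[OF t V module_hom_comp[OF single_hom[OF t] f]
          module_hom_comp[OF single_hom[OF t] g] _ v])
       (use eq t in \<open>simp add: gen_def\<close>)
  then have "(\<Oplus>\<^bsub>V\<^esub>t\<in>T. f (single t (X t))) = (\<Oplus>\<^bsub>V\<^esub>t\<in>T. g (single t (X t)))"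
    using X by (intro V.M.finsum_cong') (auto simp: Ind_mem intro!: module_hom_mem[OF g] single_closed)
  then have "f (\<Oplus>\<^bsub>Ind\<^esub>t\<in>T. single t (X t)) = g (\<Oplus>\<^bsub>Ind\<^esub>t\<in>T. single t (X t))"
    using X by (simp add: I.module_hom_finsum[OF V f finite_T] I.module_hom_finsum[OF V g finite_T]
        single_closed Ind_mem)
  then show ?thesis using Ind_eq_finsum[OF X] by simp
qed

text \<open>The projection modulo \<open>N\<close> and the zero map agree on the generators, hence
  everywhere.\<close>

lemma submodule_Ind_eq:
  assumes N: "submodule K N Ind"
    and gen: "\<And>t x a. \<lbrakk>t \<in> T; x \<in> carrier G2; a \<in> carrier A\<rbrakk> \<Longrightarrow> gen t x a \<in> N"
  shows "N = carrier Ind"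
proof
  interpret N: abelian_subgroup N Ind by (rule I.submodule_abelian_subgroup[OF N])
  show "N \<subseteq> carrier Ind" by (rule N.a_subset)
  show "carrier Ind \<subseteq> N"
  proof
    fix X assume X: "X \<in> carrier Ind"
    let ?Q = "quotient_module Ind N"
    interpret Q: module K ?Q by (rule I.module_quotient_module[OF N])
    have "N +>\<^bsub>Ind\<^esub> X = \<zero>\<^bsub>?Q\<^esub>"
    proof (rule Ind_hom_eqI[OF Q.module_axioms I.coset_hom[OF N] Q.module_hom_zero_fun _ X])
      fix t x a assume "t \<in> T" "x \<in> carrier G2" "a \<in> carrier A"
      then show "N +>\<^bsub>Ind\<^esub> gen t x a = \<zero>\<^bsub>?Q\<^esub>"
        using N.a_rcos_const gen by (simp add: quotient_module_simps)
    qed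
    then show "X \<in> N" using N.a_rcos_self[OF X] by (simp add: quotient_module_simps)
  qed
qed

end

section \<open>Cosets of the twisted subgroups and finite dimension\<close>

abbreviation "lcos t \<equiv> lcosets\<^bsub>G2\<^esub> (act t ` H2)"

lemma subgroup_act_H2: "t \<in> T \<Longrightarrow> subgroup (act t ` H2) G2"
  by (intro group_hom.subgroup_img_is_subgroup[OF act_group_hom] subgroup_H2 T_carrier)

lemma lcos_eq:
  assumes t: "t \<in> T" and D: "D \<in> lcos t" and x: "x \<in> D"
  shows "x \<in> carrier G2" and "D = x <#\<^bsub>G2\<^esub> act t ` H2"
proof -
  obtain a where a: "a \<in> carrier G2" "D = a <#\<^bsub>G2\<^esub> act t ` H2" using D by (auto simp: LCOSETS_def)
  then show "x \<in> carrier G2"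
    using x subgroup.elemlcos_carrier[OF subgroup_act_H2[OF t] G2.group_axioms] by blast
  show "D = x <#\<^bsub>G2\<^esub> act t ` H2"
    using G2.l_repr_independence[OF _ a(1) subgroup_act_H2[OF t]] a(2) x by blast
qed

lemma lcos_some:
  assumes t: "t \<in> T" and D: "D \<in> lcos t"
  shows "(SOME x. x \<in> D) \<in> D"
proof -
  obtain a where "a \<in> carrier G2" "D = a <#\<^bsub>G2\<^esub> act t ` H2" using D by (auto simp: LCOSETS_def)
  then have "a \<in> D" using G2.lcos_self[OF _ subgroup_act_H2[OF t]] by simp
  then show ?thesis by (rule someI)
qed

lemma lcos_mem: "x \<in> carrier G2 \<Longrightarrow> x <#\<^bsub>G2\<^esub> act t ` H2 \<in> lcos t"
  by (auto simp: LCOSETS_def)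

lemma lcos_self: "\<lbrakk>t \<in> T; x \<in> carrier G2\<rbrakk> \<Longrightarrow> x \<in> x <#\<^bsub>G2\<^esub> act t ` H2"
  using G2.lcos_self[OF _ subgroup_act_H2] by simp

lemma lcos_diff:
  assumes t: "t \<in> T" and D: "D \<in> lcos t" and x: "x \<in> D" and y: "y \<in> D"
  shows "\<exists>z\<in>H2. y = x \<otimes>\<^bsub>G2\<^esub> act t z"
  using y lcos_eq(2)[OF t D x] by (auto simp: l_coset_def)

text \<open>The automorphism \<open>act t\<close> carries \<open>H2\<close> to the twisted subgroup
  at t, so the index of the latter is that of \<open>H2\<close> for every t. Hence all objects have
  equally many outgoing arrows.\<close>

lemma lcos_card:
  assumes t: "t \<in> T"
  shows "bij_betw (\<lambda>C. act t ` C) (lcosets\<^bsub>G2\<^esub> H2) (lcos t)"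
proof -
  note t' = T_carrier[OF t]
  have img: "act t ` (w <#\<^bsub>G2\<^esub> H2) = act t w <#\<^bsub>G2\<^esub> act t ` H2" if "w \<in> carrier G2" for w
    using that t' H2_carrier by (auto simp: l_coset_def act_mult)
      (metis act_mult image_eqI UN_I singletonI)
  have "inj_on (\<lambda>C. act t ` C) (lcosets\<^bsub>G2\<^esub> H2)"
    by (rule inj_onI)
       (meson act_inj t' inj_on_image_eq_iff subgroup.lcosets_carrier[OF subgroup_H2 G2.group_axioms])
  moreover have "(\<lambda>C. act t ` C) ` (lcosets\<^bsub>G2\<^esub> H2) = lcos t"
  proof
    show "(\<lambda>C. act t ` C) ` (lcosets\<^bsub>G2\<^esub> H2) \<subseteq> lcos t"
    proof (rule image_subsetI)
      fix C assume "C \<in> lcosets\<^bsub>G2\<^esub> H2"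
      then obtain w where "w \<in> carrier G2" "C = w <#\<^bsub>G2\<^esub> H2" by (auto simp: LCOSETS_def)
      then show "act t ` C \<in> lcos t" using t' by (simp add: img lcos_mem)
    qed
    show "lcos t \<subseteq> (\<lambda>C. act t ` C) ` (lcosets\<^bsub>G2\<^esub> H2)"
    proof
      fix D assume "D \<in> lcos t"
      then obtain x where x: "x \<in> carrier G2" "D = x <#\<^bsub>G2\<^esub> act t ` H2" by (auto simp: LCOSETS_def)
      let ?w = "act (inv\<^bsub>G1\<^esub> t) x"
      have w: "?w \<in> carrier G2" using x t' by simp
      then have "D = act t ` (?w <#\<^bsub>G2\<^esub> H2)" using img[OF w] x t' by simp
      moreover have "?w <#\<^bsub>G2\<^esub> H2 \<in> lcosets\<^bsub>G2\<^esub> H2" using w by (auto simp: LCOSETS_def)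
      ultimately show "D \<in> (\<lambda>C. act t ` C) ` (lcosets\<^bsub>G2\<^esub> H2)" by blast
    qed
  qed
  ultimately show ?thesis by (simp add: bij_betw_def)
qed

lemma finite_transversal:
  assumes "finite (lcosets\<^bsub>G1\<^esub> H1)" shows "finite T"
proof (rule inj_on_finite[OF _ _ assms])
  show "inj_on (\<lambda>t. t <#\<^bsub>G1\<^esub> H1) T"
  proof (rule inj_onI)
    fix s t assume st: "s \<in> T" "t \<in> T" "s <#\<^bsub>G1\<^esub> H1 = t <#\<^bsub>G1\<^esub> H1"
    then have "s \<in> s <#\<^bsub>G1\<^esub> H1" "t \<in> s <#\<^bsub>G1\<^esub> H1"
      using G1.lcos_self[OF T_carrier subgroup_H1] by auto
    then show "s = t" using coset_rep_unique[OF T_carrier[OF st(1)]] st by blast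
  qed
  show "(\<lambda>t. t <#\<^bsub>G1\<^esub> H1) ` T \<subseteq> lcosets\<^bsub>G1\<^esub> H1"
    using T_carrier by (auto simp: LCOSETS_def)
qed

lemma fin_dim_Ind:
  assumes T: "finite T" and G2H2: "finite (lcosets\<^bsub>G2\<^esub> H2)" and fd: "vectorspace.fin_dim K A"
  shows "vectorspace.fin_dim K Ind"
proof -
  obtain B where B: "finite B" "B \<subseteq> carrier A" "span B = carrier A"
    using fd by (auto simp: fin_dim_def)
  \<comment> \<open>One representative per coset suffices, since \<open>gen_act\<close> moves the
    remaining part of a group element into the coefficient.\<close>
  define S where "S = (\<Union>t\<in>T. \<Union>D\<in>lcos t. gen t (SOME x. x \<in> D) ` B)"
  have fin: "finite S"
    unfolding S_def using T B(1) bij_betw_finite[OF lcos_card] G2H2 by simp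
  have sub: "S \<subseteq> carrier Ind"
    unfolding S_def using B(2) lcos_eq(1)[OF _ _ lcos_some] by blast
  have N: "submodule K (I.span S) Ind" by (rule I.span_is_submodule[OF sub])
  interpret N: submodule K "I.span S" Ind by (rule N)
  have "I.span S = carrier Ind"
  proof (rule submodule_Ind_eq[OF T N])
    fix t x a assume t: "t \<in> T" and x: "x \<in> carrier G2" and a: "a \<in> carrier A"
    let ?D = "x <#\<^bsub>G2\<^esub> act t ` H2"
    have D: "?D \<in> lcos t" using x by (rule lcos_mem)
    define r where "r = (SOME x. x \<in> ?D)"
    have r: "r \<in> ?D" unfolding r_def by (rule lcos_some[OF t D])
    have rG: "r \<in> carrier G2" using lcos_eq[OF t D r] by simp
    obtain z where z: "z \<in> H2" "x = r \<otimes>\<^bsub>G2\<^esub> act t z"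
      using lcos_diff[OF t D r lcos_self[OF t x]] by blast
    have gz: "gen t x a = gen t r (\<omega>2 z \<otimes>\<^bsub>A\<^esub> a)" using z t rG a by (simp add: gen_act)
    \<comment> \<open>The coefficients b that are good at r form a submodule of \<open>A\<close>; as
      it contains the spanning set \<open>B\<close>, it contains \<open>\<omega>2 z\<close> times
      a.\<close>
    let ?W = "{b \<in> carrier A. gen t r b \<in> I.span S}"
    note hom = gen_hom[OF t rG]
    have "submodule K ?W A"
    proof (rule submodule.intro)
      show "module K A" by (rule module_axioms)
      show "\<zero>\<^bsub>A\<^esub> \<in> ?W" by (simp add: module_hom_zero[OF I.module_axioms hom])
    qed (auto simp: module_hom_add[OF hom] module_hom_smult[OF hom])
    moreover have "B \<subseteq> ?W"
    proof
      fix b assume b: "b \<in> B"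
      then have "gen t r b \<in> S" unfolding S_def r_def using t D by blast
      then show "b \<in> ?W" using I.in_own_span[OF sub] B b by blast
    qed
    ultimately have "span B \<subseteq> ?W" by (intro span_is_subset)
    then have "\<omega>2 z \<otimes>\<^bsub>A\<^esub> a \<in> ?W" using B a z by auto
    then show "gen t x a \<in> I.span S" using gz by simp
  qed
  then show ?thesis using fin sub I.fin_dim_def by blast
qed

end

lemma (in abelian_monoid) finsum_bij_betw:
  assumes "bij_betw h S S" and "\<And>p. p \<in> S \<Longrightarrow> f p \<in> carrier G"
  shows "(\<Oplus>p\<in>S. f (h p)) = (\<Oplus>p\<in>S. f p)"
  using finsum_reindex[of f h S] assms by (auto simp: bij_betw_def)

section \<open>The separability idempotent of the induced algebra\<close>

context induction_setup
begin

interpretation I: assoc_algebra K Ind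
  by (rule assoc_algebra_Ind)

text \<open>In a general group the inverse of a left coset is a right coset. Here
  \<open>act_tgt_conj\<close>, applied to the inverse arrow, turns it back into a left coset, of the
  subgroup at the target.\<close>

lemma lcos_inv:
  assumes t: "t \<in> T" and x: "x \<in> carrier G2"
  shows "set_inv\<^bsub>G2\<^esub> (x <#\<^bsub>G2\<^esub> act t ` H2) = inv\<^bsub>G2\<^esub> x <#\<^bsub>G2\<^esub> act (tgt t x) ` H2"
proof -
  have sub: "set_inv\<^bsub>G2\<^esub> (x <#\<^bsub>G2\<^esub> act t ` H2) \<subseteq> inv\<^bsub>G2\<^esub> x <#\<^bsub>G2\<^esub> act (tgt t x) ` H2"
    if t: "t \<in> T" and x: "x \<in> carrier G2" for t x
  proof -
    let ?s = "tgt t x"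
    have s: "?s \<in> T" and xi: "inv\<^bsub>G2\<^esub> x \<in> carrier G2" using t x by auto
    have "inv\<^bsub>G2\<^esub> (x \<otimes>\<^bsub>G2\<^esub> act t z) \<in> inv\<^bsub>G2\<^esub> x <#\<^bsub>G2\<^esub> act ?s ` H2" if z: "z \<in> H2" for z
    proof -
      have "inv\<^bsub>G2\<^esub> (x \<otimes>\<^bsub>G2\<^esub> act t z) = act t (inv\<^bsub>G2\<^esub> z) \<otimes>\<^bsub>G2\<^esub> inv\<^bsub>G2\<^esub> x"
        using t x z by (simp add: G2.inv_mult_group act_inv T_carrier H2_carrier)
      also have "\<dots> = inv\<^bsub>G2\<^esub> x \<otimes>\<^bsub>G2\<^esub> act ?s (act (twist ?s (inv\<^bsub>G2\<^esub> x)) (inv\<^bsub>G2\<^esub> z))"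
        using act_tgt_conj[OF s xi, of "inv\<^bsub>G2\<^esub> z"] t x z by (simp add: tgt_inv H2_carrier)
      finally show ?thesis
        using z s xi act_H2[of "twist ?s (inv\<^bsub>G2\<^esub> x)" "inv\<^bsub>G2\<^esub> z"] by (auto simp: l_coset_def)
    qed
    then show ?thesis by (auto simp: l_coset_def[of _ x] SET_INV_def)
  qed
  have inv_inv: "set_inv\<^bsub>G2\<^esub> (set_inv\<^bsub>G2\<^esub> D) = D" if "D \<subseteq> carrier G2" for D
    using that by (force simp: SET_INV_def)
  let ?s = "tgt t x"
  have s: "?s \<in> T" and xi: "inv\<^bsub>G2\<^esub> x \<in> carrier G2" using t x by auto
  \<comment> \<open>The reverse inclusion is the first one for the inverse arrow, which leads from
    the target back to t.\<close>
  have "set_inv\<^bsub>G2\<^esub> (inv\<^bsub>G2\<^esub> x <#\<^bsub>G2\<^esub> act ?s ` H2) \<subseteq> x <#\<^bsub>G2\<^esub> act t ` H2"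
    using sub[OF s xi] t x by (simp add: tgt_inv)
  then have "set_inv\<^bsub>G2\<^esub> (set_inv\<^bsub>G2\<^esub> (inv\<^bsub>G2\<^esub> x <#\<^bsub>G2\<^esub> act ?s ` H2))
      \<subseteq> set_inv\<^bsub>G2\<^esub> (x <#\<^bsub>G2\<^esub> act t ` H2)"
    by (auto simp: SET_INV_def)
  moreover have "inv\<^bsub>G2\<^esub> x <#\<^bsub>G2\<^esub> act ?s ` H2 \<subseteq> carrier G2"
    using lcos_eq(1)[OF s lcos_mem[OF xi]] by blast
  ultimately show ?thesis using sub[OF t x] inv_inv by auto
qed

text \<open>For \<open>(t, D)\<close> in \<open>arrows\<close> the elements \<open>[x \<otimes> 1]\<close> at \<open>t\<close> with \<open>x \<in> D\<close> differ only by
  units of \<open>A\<close>, and inversion of arrows is \<open>D \<mapsto> D\<^sup>-\<^sup>1\<close> because of the Peiffer identity.\<close>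

abbreviation "arrows \<equiv> Sigma T lcos"

lemma tgt_lcos:
  assumes "t \<in> T" "D \<in> lcos t" "x \<in> D" "y \<in> D"
  shows "tgt t x = tgt t y"
  using lcos_diff[OF assms] lcos_eq(1)[OF assms(1-3)] tgt_mult_act(1)[OF assms(1)] by auto

text \<open>The chosen member of the coset only names the target, which is the same for all members
  by \<open>tgt_lcos\<close>.\<close>

definition arrow_inv where
  "arrow_inv = (\<lambda>(t, D). (tgt t (SOME x. x \<in> D), set_inv\<^bsub>G2\<^esub> D))"

lemma arrow_inv_eq:
  assumes t: "t \<in> T" and x: "x \<in> carrier G2"
  shows "arrow_inv (t, x <#\<^bsub>G2\<^esub> act t ` H2) = (tgt t x, inv\<^bsub>G2\<^esub> x <#\<^bsub>G2\<^esub> act (tgt t x) ` H2)"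
  using tgt_lcos[OF t lcos_mem[OF x] lcos_some[OF t lcos_mem[OF x]] lcos_self[OF t x]]
  by (simp add: arrow_inv_def lcos_inv[OF t x])

lemma arrow_cases:
  assumes "p \<in> arrows"
  obtains t x where "t \<in> T" "x \<in> carrier G2" "p = (t, x <#\<^bsub>G2\<^esub> act t ` H2)"
  using assms by (auto simp: LCOSETS_def)

lemma arrow_inv_mem:
  assumes "p \<in> arrows" shows "arrow_inv p \<in> arrows"
  using assms by (cases rule: arrow_cases) (auto simp: arrow_inv_eq lcos_mem)

lemma arrow_inv_inv:
  assumes "p \<in> arrows" shows "arrow_inv (arrow_inv p) = p"
  using assms by (cases rule: arrow_cases) (simp add: arrow_inv_eq tgt_inv)

lemma arrow_inv_bij: "bij_betw arrow_inv arrows arrows"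
  by (rule bij_betwI[where g = arrow_inv]) (auto simp: arrow_inv_mem arrow_inv_inv simp del: mem_Sigma_iff)

text \<open>Composition with w after an arrow: the source stays and the target moves.\<close>

definition arrow_shift where
  "arrow_shift w = (\<lambda>(t :: 'g, D). (t, w <#\<^bsub>G2\<^esub> D))"

lemma arrow_shift_eq:
  assumes "t \<in> T" "x \<in> carrier G2" "w \<in> carrier G2"
  shows "arrow_shift w (t, x <#\<^bsub>G2\<^esub> act t ` H2) = (t, (w \<otimes>\<^bsub>G2\<^esub> x) <#\<^bsub>G2\<^esub> act t ` H2)"
  using assms G2.lcos_m_assoc[OF subgroup.subset[OF subgroup_act_H2]] by (simp add: arrow_shift_def)

lemma arrow_shift_mem:
  assumes "p \<in> arrows" "w \<in> carrier G2" shows "arrow_shift w p \<in> arrows"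
  using assms(1)
  by (cases rule: arrow_cases) (use assms(2) in \<open>auto simp: arrow_shift_eq lcos_mem\<close>)

lemma arrow_shift_inv:
  assumes "p \<in> arrows" "w \<in> carrier G2"
  shows "arrow_shift (inv\<^bsub>G2\<^esub> w) (arrow_shift w p) = p"
  using assms(1)
  by (cases rule: arrow_cases) (use assms(2) in \<open>simp add: arrow_shift_eq G2.m_assoc[symmetric]\<close>)

lemma arrow_shift_bij:
  assumes w: "w \<in> carrier G2"
  shows "bij_betw (arrow_shift w) arrows arrows"
  using arrow_shift_inv[OF _ w] arrow_shift_inv[of _ "inv\<^bsub>G2\<^esub> w"] w
  by (intro bij_betwI[where g = "arrow_shift (inv\<^bsub>G2\<^esub> w)"])
     (auto simp: arrow_shift_mem simp del: mem_Sigma_iff)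

section \<open>Tensors built from two arrows\<close>

definition twisted_gen where
  "twisted_gen s y q = gen s y (\<omega>1 (twist s y) q)"

lemma twisted_gen_hom: "\<lbrakk>s \<in> T; y \<in> carrier G2\<rbrakk> \<Longrightarrow> twisted_gen s y \<in> module_hom K A Ind"
  unfolding twisted_gen_def[abs_def]
  by (intro module_hom_comp[OF \<omega>1_module_hom gen_hom]) auto

lemma twisted_gen_closed [simp, intro]:
  "\<lbrakk>s \<in> T; y \<in> carrier G2; q \<in> carrier A\<rbrakk> \<Longrightarrow> twisted_gen s y q \<in> carrier Ind"
  by (rule module_hom_mem[OF twisted_gen_hom])

text \<open>Automorphisms being surjective, every coefficient has the twisted form used here. In
  this form right multiplication by an arrow acts on q as right multiplication by b inside
  \<open>A\<close>, because twists compose by the cocycle rule.\<close>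

lemma twisted_gen_mult:
  assumes "s \<in> T" "y \<in> carrier G2" "q \<in> carrier A" "r \<in> T" "w \<in> carrier G2" "b \<in> carrier A"
  shows "twisted_gen s y q \<otimes>\<^bsub>Ind\<^esub> gen r w (\<omega>1 (twist r (y \<otimes>\<^bsub>G2\<^esub> w)) b)
    = (if tgt r w = s then twisted_gen r (y \<otimes>\<^bsub>G2\<^esub> w) (q \<otimes>\<^bsub>A\<^esub> b) else \<zero>\<^bsub>Ind\<^esub>)"
  using assms
  by (auto simp: twisted_gen_def gen_mult tgt_twist_mult \<omega>1_\<omega>1 \<omega>1_ring_mult)

text \<open>The linear map \<open>p \<otimes> q \<mapsto> [x \<otimes> p] \<otimes> [y \<otimes> q']\<close> with \<open>q'\<close> twisted so that, when
  \<open>tgt s y = t\<close>, the second factor is \<open>[e \<otimes> q] \<cdot> [y \<otimes> 1]\<close>.\<close>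

definition arrow_pair where
  "arrow_pair t x s y = tensor_lift K I.A2 (\<lambda>p q. I.pure2 (gen t x p) (twisted_gen s y q))"

context
  fixes t x s y
  assumes t: "t \<in> T" and x: "x \<in> carrier G2" and s: "s \<in> T" and y: "y \<in> carrier G2"
begin

lemma arrow_pair_bilinear:
  "bilinear_map K A A I.A2 (\<lambda>p q. I.pure2 (gen t x p) (twisted_gen s y q))"
  using bilinear_map_comp[OF I.pure2_bilinear gen_hom[OF t x] twisted_gen_hom[OF s y] module_hom_id] .

lemma arrow_pair_hom: "arrow_pair t x s y \<in> module_hom K A2 I.A2"
  unfolding arrow_pair_def by (rule A2_lift_hom[OF I.module_tensor_square arrow_pair_bilinear])

lemma arrow_pair_closed [simp, intro]: "E \<in> carrier A2 \<Longrightarrow> arrow_pair t x s y E \<in> carrier I.A2"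
  by (rule module_hom_mem[OF arrow_pair_hom])

lemma arrow_pair_pure:
  "\<lbrakk>p \<in> carrier A; q \<in> carrier A\<rbrakk> \<Longrightarrow>
    arrow_pair t x s y (pure2 p q) = I.pure2 (gen t x p) (twisted_gen s y q)"
  unfolding arrow_pair_def by (rule A2_lift_pure[OF I.module_tensor_square arrow_pair_bilinear])

end

lemma I_pure2_zero:
  "X \<in> carrier Ind \<Longrightarrow> I.pure2 \<zero>\<^bsub>Ind\<^esub> X = \<zero>\<^bsub>I.A2\<^esub>"
  "X \<in> carrier Ind \<Longrightarrow> I.pure2 X \<zero>\<^bsub>Ind\<^esub> = \<zero>\<^bsub>I.A2\<^esub>"
  using I.module_hom_zero[OF I.module_tensor_square bilinear_mapD(2)[OF I.pure2_bilinear]]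
    I.module_hom_zero[OF I.module_tensor_square bilinear_mapD(1)[OF I.pure2_bilinear]] by auto

text \<open>Together with \<open>arrow_pair_right\<close> this replaces multiplication in the
  induced algebra by multiplication of E inside the tensor square of \<open>A\<close>, where
  centrality of E is available.\<close>

lemma arrow_pair_left:
  assumes t: "t \<in> T" and x: "x \<in> carrier G2" and s: "s \<in> T" and y: "y \<in> carrier G2"
    and r: "r \<in> T" and w: "w \<in> carrier G2" and b: "b \<in> carrier A" and E: "E \<in> carrier A2"
  shows "I.bimult (gen r w b) (arrow_pair t x s y E) \<one>\<^bsub>Ind\<^esub> =
    (if tgt t x = r then arrow_pair t (w \<otimes>\<^bsub>G2\<^esub> x) s y (bimult (\<omega>1 (twist t x) b) E \<one>\<^bsub>A\<^esub>)
     else \<zero>\<^bsub>I.A2\<^esub>)"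
proof -
  interpret I2: module K I.A2 by (rule I.module_tensor_square)
  have g: "gen r w b \<in> carrier Ind" using r w b by simp
  have wx: "w \<otimes>\<^bsub>G2\<^esub> x \<in> carrier G2" using w x by simp
  have b': "\<omega>1 (twist t x) b \<in> carrier A" using t x b by auto
  have lhs: "(\<lambda>E. I.bimult (gen r w b) (arrow_pair t x s y E) \<one>\<^bsub>Ind\<^esub>) \<in> module_hom K A2 I.A2"
    by (rule module_hom_comp[OF arrow_pair_hom[OF t x s y] I.bimult_hom[OF g I.one_closed]])
  show ?thesis
  proof (cases "tgt t x = r")
    case True
    have "I.bimult (gen r w b) (arrow_pair t x s y E) \<one>\<^bsub>Ind\<^esub>
      = arrow_pair t (w \<otimes>\<^bsub>G2\<^esub> x) s y (bimult (\<omega>1 (twist t x) b) E \<one>\<^bsub>A\<^esub>)"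
      by (rule A2_hom_eqI[OF I2.module_axioms lhs
            module_hom_comp[OF bimult_hom[OF b' one_closed] arrow_pair_hom[OF t wx s y]] _ E])
         (use True assms g wx b' in \<open>simp add: arrow_pair_pure I.bimult_pure bimult_pure gen_mult\<close>)
    then show ?thesis using True by simp
  next
    case False
    have "I.bimult (gen r w b) (arrow_pair t x s y E) \<one>\<^bsub>Ind\<^esub> = \<zero>\<^bsub>I.A2\<^esub>"
      by (rule A2_hom_eqI[OF I2.module_axioms lhs I2.module_hom_zero_fun _ E])
         (use False assms g in \<open>simp add: arrow_pair_pure I.bimult_pure gen_mult I_pure2_zero\<close>)
    then show ?thesis using False by simp
  qed
qed

lemma arrow_pair_right:
  assumes t: "t \<in> T" and x: "x \<in> carrier G2" and s: "s \<in> T" and y: "y \<in> carrier G2"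
    and r: "r \<in> T" and w: "w \<in> carrier G2" and c: "c \<in> carrier A" and E: "E \<in> carrier A2"
  shows "I.bimult \<one>\<^bsub>Ind\<^esub> (arrow_pair t x s y E) (gen r w (\<omega>1 (twist r (y \<otimes>\<^bsub>G2\<^esub> w)) c)) =
    (if tgt r w = s then arrow_pair t x r (y \<otimes>\<^bsub>G2\<^esub> w) (bimult \<one>\<^bsub>A\<^esub> E c) else \<zero>\<^bsub>I.A2\<^esub>)"
proof -
  interpret I2: module K I.A2 by (rule I.module_tensor_square)
  let ?b = "\<omega>1 (twist r (y \<otimes>\<^bsub>G2\<^esub> w)) c"
  have yw: "y \<otimes>\<^bsub>G2\<^esub> w \<in> carrier G2" using w y by simp
  have g: "gen r w ?b \<in> carrier Ind" using r w c yw by auto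
  have lhs: "(\<lambda>E. I.bimult \<one>\<^bsub>Ind\<^esub> (arrow_pair t x s y E) (gen r w ?b)) \<in> module_hom K A2 I.A2"
    by (rule module_hom_comp[OF arrow_pair_hom[OF t x s y] I.bimult_hom[OF I.one_closed g]])
  show ?thesis
  proof (cases "tgt r w = s")
    case True
    have "I.bimult \<one>\<^bsub>Ind\<^esub> (arrow_pair t x s y E) (gen r w ?b)
      = arrow_pair t x r (y \<otimes>\<^bsub>G2\<^esub> w) (bimult \<one>\<^bsub>A\<^esub> E c)"
      by (rule A2_hom_eqI[OF I2.module_axioms lhs
            module_hom_comp[OF bimult_hom[OF one_closed c] arrow_pair_hom[OF t x r yw]] _ E])
         (use True assms g yw in
           \<open>simp add: arrow_pair_pure I.bimult_pure bimult_pure twisted_gen_mult\<close>)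
    then show ?thesis using True by simp
  next
    case False
    have "I.bimult \<one>\<^bsub>Ind\<^esub> (arrow_pair t x s y E) (gen r w ?b) = \<zero>\<^bsub>I.A2\<^esub>"
      by (rule A2_hom_eqI[OF I2.module_axioms lhs I2.module_hom_zero_fun _ E])
         (use False assms g in \<open>simp add: arrow_pair_pure I.bimult_pure twisted_gen_mult I_pure2_zero\<close>)
    then show ?thesis using False by simp
  qed
qed

text \<open>By the cocycle rule the twists of an arrow and of its inverse multiply to the twist of
  the identity.\<close>

lemma twist_inv:
  assumes t: "t \<in> T" and x: "x \<in> carrier G2" and b: "b \<in> carrier A"
  shows "\<omega>1 (twist (tgt t x) (inv\<^bsub>G2\<^esub> x)) (\<omega>1 (twist t x) b) = b"
  using tgt_twist_mult(2)[of "tgt t x" "inv\<^bsub>G2\<^esub> x" x, symmetric] t x b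
  by (simp add: tgt_inv \<omega>1_\<omega>1[symmetric])

section \<open>Conjugates of a separability idempotent along arrows\<close>

context
  fixes E
  assumes E: "E \<in> carrier A2" and mult_E: "mult_map K A E = \<one>\<^bsub>A\<^esub>"
    and central_E: "\<And>a. a \<in> carrier A \<Longrightarrow> bimult a E \<one>\<^bsub>A\<^esub> = bimult \<one>\<^bsub>A\<^esub> E a"
begin

text \<open>The name refers to the round trip: the second tensor entry leads from
  \<open>tgt t x\<close> to t, the first one back.\<close>

definition loop where
  "loop t x = arrow_pair t x (tgt t x) (inv\<^bsub>G2\<^esub> x) E"

lemma loop_closed [simp, intro]: "\<lbrakk>t \<in> T; x \<in> carrier G2\<rbrakk> \<Longrightarrow> loop t x \<in> carrier I.A2"
  unfolding loop_def using E by auto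

text \<open>The group elements cancel and both coefficients carry the same twist, so the product is
  the twist of the image of E, which is 1.\<close>

lemma mult_map_loop:
  assumes t: "t \<in> T" and x: "x \<in> carrier G2"
  shows "mult_map K Ind (loop t x) = gen (tgt t x) \<one>\<^bsub>G2\<^esub> \<one>\<^bsub>A\<^esub>"
proof -
  let ?s = "tgt t x" and ?y = "inv\<^bsub>G2\<^esub> x"
  have s: "?s \<in> T" and y: "?y \<in> carrier G2" using t x by auto
  have tw: "twist ?s ?y \<in> H1" using s y by simp
  have "mult_map K Ind (arrow_pair t x ?s ?y E)
      = gen ?s \<one>\<^bsub>G2\<^esub> (\<omega>1 (twist ?s ?y) (mult_map K A E))"
    by (rule A2_hom_eqI[OF I.module_axioms
          module_hom_comp[OF arrow_pair_hom[OF t x s y] I.mult_map_hom]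
          module_hom_comp[OF mult_map_hom module_hom_comp[OF \<omega>1_module_hom[OF tw] gen_hom[OF s G2.one_closed]]]
          _ E])
       (use t x s y tw in \<open>simp add: arrow_pair_pure I.mult_map_pure mult_map_pure twisted_gen_def
          gen_mult tgt_inv \<omega>1_ring_mult\<close>)
  then show ?thesis using tw by (simp add: loop_def mult_E)
qed

lemma loop_act:
  assumes t: "t \<in> T" and x: "x \<in> carrier G2" and z: "z \<in> H2"
  shows "loop t (x \<otimes>\<^bsub>G2\<^esub> act t z) = loop t x"
proof -
  let ?s = "tgt t x" and ?y = "inv\<^bsub>G2\<^esub> x" and ?z = "inv\<^bsub>G2\<^esub> z"
  have s: "?s \<in> T" and y: "?y \<in> carrier G2" using t x by auto
  have tw: "twist ?s ?y \<in> H1" using s y by simp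
  note zG = H2_carrier[OF z]
  \<comment> \<open>The element that z turns into when the coset is inverted, so that the inverse of
    x times \<open>act t z\<close> stays in the left coset of \<open>inv x\<close> at the
    target.\<close>
  define z' where "z' = act (twist ?s ?y) ?z"
  have z': "z' \<in> H2" unfolding z'_def using tw z by (intro act_H2) auto
  have xz: "x \<otimes>\<^bsub>G2\<^esub> act t z \<in> carrier G2" using t x zG by (simp add: T_carrier)
  have inv: "inv\<^bsub>G2\<^esub> (x \<otimes>\<^bsub>G2\<^esub> act t z) = ?y \<otimes>\<^bsub>G2\<^esub> act ?s z'"
    using act_tgt_conj[OF s y, of ?z] t x zG
    by (simp add: z'_def tgt_inv G2.inv_mult_group act_inv T_carrier)
  have yz: "?y \<otimes>\<^bsub>G2\<^esub> act ?s z' \<in> carrier G2" using inv xz by (metis G2.inv_closed)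
  have tgen: "twisted_gen ?s (?y \<otimes>\<^bsub>G2\<^esub> act ?s z') q = twisted_gen ?s ?y (q \<otimes>\<^bsub>A\<^esub> \<omega>2 ?z)"
    if q: "q \<in> carrier A" for q
  proof -
    have "twisted_gen ?s (?y \<otimes>\<^bsub>G2\<^esub> act ?s z') q
      = gen ?s ?y (\<omega>2 z' \<otimes>\<^bsub>A\<^esub> \<omega>1 (bd (inv\<^bsub>G2\<^esub> z')) (\<omega>1 (twist ?s ?y) q))"
      using s y z' q tw
      by (simp add: twisted_gen_def tgt_mult_act gen_act \<omega>1_\<omega>1 bd_H2_mem)
    also have "\<omega>2 z' \<otimes>\<^bsub>A\<^esub> \<omega>1 (bd (inv\<^bsub>G2\<^esub> z')) (\<omega>1 (twist ?s ?y) q)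
      = \<omega>1 (twist ?s ?y) (q \<otimes>\<^bsub>A\<^esub> \<omega>2 ?z)"
      using \<omega>2_\<omega>1_bd_inv[OF z', of "\<omega>1 (twist ?s ?y) q"] tw q z
      by (simp add: \<omega>1_ring_mult \<omega>2_act z'_def)
    finally show ?thesis by (simp add: twisted_gen_def)
  qed
  have \<omega>: "\<omega>2 z \<in> carrier A" "\<omega>2 ?z \<in> carrier A" using z by auto
  \<comment> \<open>The change of representative puts \<open>\<omega>2 z\<close> before the first
    entries of E and \<open>\<omega>2 (inv z)\<close> after the second ones.\<close>
  have "arrow_pair t (x \<otimes>\<^bsub>G2\<^esub> act t z) ?s (?y \<otimes>\<^bsub>G2\<^esub> act ?s z') E
      = arrow_pair t x ?s ?y (bimult (\<omega>2 z) E (\<omega>2 ?z))"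
    by (rule A2_hom_eqI[OF I.module_tensor_square arrow_pair_hom[OF t xz s yz]
          module_hom_comp[OF bimult_hom[OF \<omega>] arrow_pair_hom[OF t x s y]] _ E])
       (use t x s y xz yz \<omega> z in \<open>simp add: arrow_pair_pure bimult_pure gen_act tgen\<close>)
  \<comment> \<open>Centrality of E brings both units to the same side, where they cancel.\<close>
  also have "bimult (\<omega>2 z) E (\<omega>2 ?z) = bimult \<one>\<^bsub>A\<^esub> (bimult (\<omega>2 z) E \<one>\<^bsub>A\<^esub>) (\<omega>2 ?z)"
    using E \<omega> by (simp add: bimult_bimult)
  also have "\<dots> = bimult \<one>\<^bsub>A\<^esub> E (\<omega>2 z \<otimes>\<^bsub>A\<^esub> \<omega>2 ?z)"
    using E \<omega> by (simp add: central_E bimult_bimult)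
  also have "\<dots> = E" using E z by (simp add: \<omega>2_r_inv bimult_one)
  finally show ?thesis using t x z by (simp add: loop_def inv tgt_mult_act)
qed

text \<open>Left multiplication by an arrow at w prolongs the first entry to w x. Right
  multiplication of the loop at w x reaches the same pair, since the inverse of w x times w is
  \<open>inv x\<close>.\<close>

lemma loop_central:
  assumes t: "t \<in> T" and x: "x \<in> carrier G2" and r: "r \<in> T" and w: "w \<in> carrier G2"
    and b: "b \<in> carrier A"
  shows "I.bimult (gen r w b) (loop t x) \<one>\<^bsub>Ind\<^esub> = I.bimult \<one>\<^bsub>Ind\<^esub> (loop t (w \<otimes>\<^bsub>G2\<^esub> x)) (gen r w b)"
proof -
  have wx: "w \<otimes>\<^bsub>G2\<^esub> x \<in> carrier G2" using w x by simp
  have iwx: "inv\<^bsub>G2\<^esub> (w \<otimes>\<^bsub>G2\<^esub> x) \<otimes>\<^bsub>G2\<^esub> w = inv\<^bsub>G2\<^esub> x"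
    using w x by (simp add: G2.inv_mult_group G2.m_assoc)
  \<comment> \<open>Both sides vanish under the same condition, because the arrow w can be
    cancelled.\<close>
  have iff: "tgt r w = tgt t (w \<otimes>\<^bsub>G2\<^esub> x) \<longleftrightarrow> tgt t x = r"
  proof
    assume "tgt r w = tgt t (w \<otimes>\<^bsub>G2\<^esub> x)"
    then have "tgt (tgt r w) (inv\<^bsub>G2\<^esub> w) = tgt (tgt (tgt t x) w) (inv\<^bsub>G2\<^esub> w)"
      using t x w by (simp add: tgt_twist_mult)
    then show "tgt t x = r" using t x w r by (simp add: tgt_inv)
  qed (use t x w in \<open>simp add: tgt_twist_mult\<close>)
  show ?thesis
  proof (cases "tgt t x = r")
    case True
    \<comment> \<open>This is both the coefficient produced by \<open>arrow_pair_left\<close> and,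
      by \<open>twist_inv\<close>, the preimage of b required by \<open>arrow_pair_right\<close>. So
      centrality of E at this element connects the two sides.\<close>
    let ?c = "\<omega>1 (twist t x) b"
    have c: "?c \<in> carrier A" using t x b by auto
    have bc: "\<omega>1 (twist r (inv\<^bsub>G2\<^esub> x)) ?c = b" using twist_inv[OF t x b] True by simp
    have "I.bimult (gen r w b) (loop t x) \<one>\<^bsub>Ind\<^esub>
      = arrow_pair t (w \<otimes>\<^bsub>G2\<^esub> x) r (inv\<^bsub>G2\<^esub> x) (bimult ?c E \<one>\<^bsub>A\<^esub>)"
      using arrow_pair_left[OF t x _ _ r w b E, of "tgt t x" "inv\<^bsub>G2\<^esub> x"] t x r True
      by (simp add: loop_def)
    also have "\<dots> = arrow_pair t (w \<otimes>\<^bsub>G2\<^esub> x) r (inv\<^bsub>G2\<^esub> x) (bimult \<one>\<^bsub>A\<^esub> E ?c)"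
      using c by (simp add: central_E)
    also have "\<dots> = I.bimult \<one>\<^bsub>Ind\<^esub> (loop t (w \<otimes>\<^bsub>G2\<^esub> x)) (gen r w b)"
      using arrow_pair_right[OF t wx _ _ r w c E, of "tgt t (w \<otimes>\<^bsub>G2\<^esub> x)" "inv\<^bsub>G2\<^esub> (w \<otimes>\<^bsub>G2\<^esub> x)"]
        t wx True iff
      by (simp add: loop_def iwx bc)
    finally show ?thesis .
  next
    case False
    \<comment> \<open>Here x does not end at r, so the preimage of b under the twist is taken
      directly from the inverse of the twist.\<close>
    let ?c = "\<omega>1 (inv\<^bsub>G1\<^esub> (twist r (inv\<^bsub>G2\<^esub> x))) b"
    have tw: "twist r (inv\<^bsub>G2\<^esub> x) \<in> H1" "inv\<^bsub>G1\<^esub> (twist r (inv\<^bsub>G2\<^esub> x)) \<in> H1"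
      using r x by (auto intro!: subgroup.m_inv_closed[OF subgroup_H1])
    then have c: "?c \<in> carrier A" using b by auto
    have bc: "\<omega>1 (twist r (inv\<^bsub>G2\<^esub> x)) ?c = b"
      using tw b by (simp add: \<omega>1_\<omega>1[symmetric] H1_carrier)
    have "I.bimult \<one>\<^bsub>Ind\<^esub> (loop t (w \<otimes>\<^bsub>G2\<^esub> x)) (gen r w b) = \<zero>\<^bsub>I.A2\<^esub>"
      using arrow_pair_right[OF t wx _ _ r w c E, of "tgt t (w \<otimes>\<^bsub>G2\<^esub> x)" "inv\<^bsub>G2\<^esub> (w \<otimes>\<^bsub>G2\<^esub> x)"]
        t wx False iff
      by (simp add: loop_def iwx bc)
    moreover have "I.bimult (gen r w b) (loop t x) \<one>\<^bsub>Ind\<^esub> = \<zero>\<^bsub>I.A2\<^esub>"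
      using arrow_pair_left[OF t x _ _ r w b E, of "tgt t x" "inv\<^bsub>G2\<^esub> x"] t x False
      by (simp add: loop_def)
    ultimately show ?thesis by simp
  qed
qed

text \<open>By \<open>loop_act\<close> the choice within the coset does not affect the
  value.\<close>

definition coset_loop where
  "coset_loop = (\<lambda>(t, D). loop t (SOME x. x \<in> D))"

lemma coset_loop_eq:
  assumes t: "t \<in> T" and x: "x \<in> carrier G2"
  shows "coset_loop (t, x <#\<^bsub>G2\<^esub> act t ` H2) = loop t x"
proof -
  let ?D = "x <#\<^bsub>G2\<^esub> act t ` H2"
  obtain z where "z \<in> H2" "(SOME x. x \<in> ?D) = x \<otimes>\<^bsub>G2\<^esub> act t z"
    using lcos_diff[OF t lcos_mem[OF x] lcos_self[OF t x] lcos_some[OF t lcos_mem[OF x]]] by blast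
  then show ?thesis using loop_act[OF t x] by (simp add: coset_loop_def)
qed

lemma coset_loop_closed: "p \<in> arrows \<Longrightarrow> coset_loop p \<in> carrier I.A2"
  by (cases rule: arrow_cases) (auto simp: coset_loop_eq)

lemma mult_map_coset_loop:
  "p \<in> arrows \<Longrightarrow> mult_map K Ind (coset_loop p) = gen (fst (arrow_inv p)) \<one>\<^bsub>G2\<^esub> \<one>\<^bsub>A\<^esub>"
  by (cases rule: arrow_cases) (auto simp: coset_loop_eq mult_map_loop arrow_inv_eq)

lemma coset_loop_central:
  assumes "p \<in> arrows" "r \<in> T" "w \<in> carrier G2" "b \<in> carrier A"
  shows "I.bimult (gen r w b) (coset_loop p) \<one>\<^bsub>Ind\<^esub>
    = I.bimult \<one>\<^bsub>Ind\<^esub> (coset_loop (arrow_shift w p)) (gen r w b)"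
  using assms(1)
  by (cases rule: arrow_cases)
     (use assms(2-4) in \<open>simp add: coset_loop_eq arrow_shift_eq loop_central\<close>)

lemma separable_Ind_of_idempotent:
  assumes T: "finite T" and G2H2: "finite (lcosets\<^bsub>G2\<^esub> H2)"
    and char: "\<not> ring_characteristic K dvd card (lcosets\<^bsub>G2\<^esub> H2)"
  shows "separable_algebra K Ind"
proof -
  interpret I2: module K I.A2 by (rule I.module_tensor_square)
  define n where "n = add_pow K (card (lcosets\<^bsub>G2\<^esub> H2)) \<one>\<^bsub>K\<^esub>"
  have n: "n \<in> carrier K" "n \<noteq> \<zero>\<^bsub>K\<^esub>" using add_pow_one_ne_zero[OF char] by (simp_all add: n_def)
  have ninv: "inv\<^bsub>K\<^esub> n \<in> carrier K" "inv\<^bsub>K\<^esub> n \<otimes>\<^bsub>K\<^esub> n = \<one>\<^bsub>K\<^esub>"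
    using n by (auto simp: field_Units intro: R.Units_inv_closed R.Units_l_inv)
  have fin_lcos: "finite (lcos t)" and card_lcos: "card (lcos t) = card (lcosets\<^bsub>G2\<^esub> H2)"
    if "t \<in> T" for t
    using bij_betw_finite[OF lcos_card[OF that]] bij_betw_same_card[OF lcos_card[OF that]] G2H2 by auto
  have fin: "finite arrows" using T fin_lcos by (rule finite_SigmaI)
  \<comment> \<open>This is n times the idempotent sought.\<close>
  define S where "S = (\<Oplus>\<^bsub>I.A2\<^esub>p\<in>arrows. coset_loop p)"
  have S: "S \<in> carrier I.A2"
    unfolding S_def by (intro I2.M.finsum_closed) (auto intro: coset_loop_closed simp del: mem_Sigma_iff)
  have one: "gen t \<one>\<^bsub>G2\<^esub> \<one>\<^bsub>A\<^esub> \<in> carrier Ind" if "t \<in> T" for t using that by simp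
  have fst_T: "fst p \<in> T" if "p \<in> arrows" for p using that by auto
  have "mult_map K Ind S = (\<Oplus>\<^bsub>Ind\<^esub>p\<in>arrows. mult_map K Ind (coset_loop p))"
    unfolding S_def
    by (rule I2.module_hom_finsum[OF I.module_axioms I.mult_map_hom fin coset_loop_closed])
  also have "\<dots> = (\<Oplus>\<^bsub>Ind\<^esub>p\<in>arrows. gen (fst (arrow_inv p)) \<one>\<^bsub>G2\<^esub> \<one>\<^bsub>A\<^esub>)"
    using one fst_T[OF arrow_inv_mem]
    by (intro I.M.finsum_cong') (simp_all add: mult_map_coset_loop Pi_iff del: mem_Sigma_iff)
  \<comment> \<open>The summands are indexed by targets, whereas the number of arrows is known for
    each source; inversion exchanges the two.\<close>
  also have "\<dots> = (\<Oplus>\<^bsub>Ind\<^esub>p\<in>arrows. gen (fst p) \<one>\<^bsub>G2\<^esub> \<one>\<^bsub>A\<^esub>)"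
    using one fst_T by (intro I.M.finsum_bij_betw[OF arrow_inv_bij]) blast
  also have "\<dots> = (\<Oplus>\<^bsub>Ind\<^esub>t\<in>T. n \<odot>\<^bsub>Ind\<^esub> gen t \<one>\<^bsub>G2\<^esub> \<one>\<^bsub>A\<^esub>)"
    unfolding n_def using T fin_lcos one card_lcos by (rule I.finsum_Sigma_const)
  also have "\<dots> = n \<odot>\<^bsub>Ind\<^esub> \<one>\<^bsub>Ind\<^esub>"
    using T one n I.finsum_smult_ldistr[of T n "\<lambda>t. gen t \<one>\<^bsub>G2\<^esub> \<one>\<^bsub>A\<^esub>"]
    by (simp add: Ind_one_eq)
  finally have mult_S: "mult_map K Ind S = n \<odot>\<^bsub>Ind\<^esub> \<one>\<^bsub>Ind\<^esub>" .
  have central_S: "I.bimult X S \<one>\<^bsub>Ind\<^esub> = I.bimult \<one>\<^bsub>Ind\<^esub> S X" if X: "X \<in> carrier Ind" for X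
  proof (rule Ind_hom_eqI[OF T I2.module_axioms I.bimult_hom_left[OF S I.one_closed]
        I.bimult_hom_right[OF S I.one_closed] _ X])
    fix r w b assume r: "r \<in> T" and w: "w \<in> carrier G2" and b: "b \<in> carrier A"
    have g: "gen r w b \<in> carrier Ind" using r w b by simp
    have "I.bimult (gen r w b) S \<one>\<^bsub>Ind\<^esub>
      = (\<Oplus>\<^bsub>I.A2\<^esub>p\<in>arrows. I.bimult (gen r w b) (coset_loop p) \<one>\<^bsub>Ind\<^esub>)"
      unfolding S_def
      by (rule I2.module_hom_finsum[OF I2.module_axioms I.bimult_hom[OF g I.one_closed] fin
            coset_loop_closed])
    also have "\<dots> = (\<Oplus>\<^bsub>I.A2\<^esub>p\<in>arrows. I.bimult \<one>\<^bsub>Ind\<^esub> (coset_loop (arrow_shift w p)) (gen r w b))"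
      using r w b g coset_loop_closed[OF arrow_shift_mem]
      by (intro I2.M.finsum_cong') (simp_all add: coset_loop_central Pi_iff del: mem_Sigma_iff)
    \<comment> \<open>The shift by w introduced by \<open>coset_loop_central\<close> is a
      permutation of the arrows.\<close>
    also have "\<dots> = (\<Oplus>\<^bsub>I.A2\<^esub>p\<in>arrows. I.bimult \<one>\<^bsub>Ind\<^esub> (coset_loop p) (gen r w b))"
      using g coset_loop_closed
      by (intro I2.M.finsum_bij_betw[OF arrow_shift_bij[OF w],
            of "\<lambda>p. I.bimult \<one>\<^bsub>Ind\<^esub> (coset_loop p) (gen r w b)"]) simp
    also have "\<dots> = I.bimult \<one>\<^bsub>Ind\<^esub> S (gen r w b)"
      unfolding S_def
      by (rule I2.module_hom_finsum[OF I2.module_axioms I.bimult_hom[OF I.one_closed g] fin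
            coset_loop_closed, symmetric])
    finally show "I.bimult (gen r w b) S \<one>\<^bsub>Ind\<^esub> = I.bimult \<one>\<^bsub>Ind\<^esub> S (gen r w b)" .
  qed
  show ?thesis
    unfolding I.separable_algebra_iff
  proof (intro bexI conjI ballI)
    \<comment> \<open>Dividing by n, which is invertible by the assumption on the characteristic,
      turns the image n under multiplication into 1.\<close>
    show "inv\<^bsub>K\<^esub> n \<odot>\<^bsub>I.A2\<^esub> S \<in> carrier I.A2" using S ninv by simp
    show "mult_map K Ind (inv\<^bsub>K\<^esub> n \<odot>\<^bsub>I.A2\<^esub> S) = \<one>\<^bsub>Ind\<^esub>"
      using S n ninv by (simp add: module_hom_smult[OF I.mult_map_hom] mult_S I.smult_assoc1[symmetric])
    show "I.bimult X (inv\<^bsub>K\<^esub> n \<odot>\<^bsub>I.A2\<^esub> S) \<one>\<^bsub>Ind\<^esub> = I.bimult \<one>\<^bsub>Ind\<^esub> (inv\<^bsub>K\<^esub> n \<odot>\<^bsub>I.A2\<^esub> S) X"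
      if "X \<in> carrier Ind" for X
      using that S ninv central_S[OF that]
      by (simp add: module_hom_smult[OF I.bimult_hom])
  qed
qed

end

lemma separable_Ind:
  assumes "finite T" and "finite (lcosets\<^bsub>G2\<^esub> H2)"
    and "\<not> ring_characteristic K dvd card (lcosets\<^bsub>G2\<^esub> H2)" and "separable_algebra K A"
  shows "separable_algebra K Ind"
  using assms(4) separable_Ind_of_idempotent[OF _ _ _ assms(1-3)] unfolding separable_algebra_iff by blast

end

text \<open>The vector space property accompanies finite dimension because the constant
  \<open>vectorspace.fin_dim\<close> is total and by itself does not assert it.\<close>

theorem proposition4p2:
  fixes G1 :: "('g, 'u) monoid_scheme" and G2 :: "('h, 'v) monoid_scheme"
    and act :: "'g \<Rightarrow> 'h \<Rightarrow> 'h" and bd :: "'h \<Rightarrow> 'g"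
    and H1 :: "'g set" and H2 :: "'h set"
    and K :: "('k, 'w) ring_scheme" and A :: "('k, 'a, 'x) module_scheme"
    and \<omega>1 :: "'g \<Rightarrow> 'a \<Rightarrow> 'a" and \<omega>2 :: "'h \<Rightarrow> 'a" and T :: "'g set"
  assumes "Ind = induction_setup.induced_algebra G1 G2 act bd H1 H2 K A \<omega>1 \<omega>2 T"
    and "induction_setup G1 G2 act bd H1 H2 K A \<omega>1 \<omega>2 T"
    and "finite (lcosets\<^bsub>G1\<^esub> H1)" and "finite (lcosets\<^bsub>G2\<^esub> H2)"
  shows "(vectorspace.fin_dim K A \<longrightarrow> vectorspace K Ind \<and> vectorspace.fin_dim K Ind) \<and>
    (\<not> ring_characteristic K dvd card (lcosets\<^bsub>G2\<^esub> H2) \<longrightarrow>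
      separable_algebra K A \<longrightarrow> separable_algebra K Ind)"
proof -
  interpret S: induction_setup G1 G2 act bd H1 H2 K A \<omega>1 \<omega>2 T by fact
  have "finite T" using assms(3) by (rule S.finite_transversal)
  then show ?thesis
    unfolding assms(1)
    using S.vectorspace_Ind S.fin_dim_Ind[OF _ assms(4)] S.separable_Ind[OF _ assms(4)] by blast
qed

end
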